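(* Let $\alpha\in(0,1)$, $T>0$, and let $t_j=T(j/M)^r$, $j=0,\dots,M$, for some $r\ge1$; put $\tau_m:=t_m-t_{m-1}$ and $t_m^*:=t_m-\frac12\alpha\tau_m$. Suppose that $u$ is the unique solution of $$D_t^\alpha u+\mathcal Lu=f(x,t)\ \text{ in }\Omega\times(0,T],\qquad u=0\ \text{ on }\partial\Omega\times(0,T],\qquad u(x,0)=u_0(x)\ \text{ for } x\in\Omega,$$ where $\mathcal L$ is independent of $t$ and has no first-order terms, i.e. $\mathcal Lu=-\sum_{k=1}^d\partial_{x_k}(a_k(x)\,\partial_{x_k}u)+c(x)\,u$. Also, let $\|\partial_t^lu(\cdot,t)\|_{L_2(\Omega)}\lesssim1+t^{\alpha-l}$ for $l=1,3$ and $\|\partial_t^2\mathcal Lu(\cdot,t)\|_{L_2(\Omega)}\lesssim1+t^{\alpha-2}$ for all $t\in(0,T]$. Let $\{U^m\}_{m=0}^M$ be defined by the Alikhanov-type semidiscretization $$\delta_t^{\alpha,*}U^m+\mathcal LU^{m,*}=f(\cdot,t_m^* )\ \text{ in }\Omega,\quad U^m=0\ \text{ on }\partial\Omega\quad\forall m=1,\dots,M;\qquad U^0=u_0,$$ $$U^{m,*}:=\tfrac12\alpha\,U^{m-1}+\bigl(1-\tfrac12\alpha\bigr)U^m .$$ Then for all $m\ge1$ $$\|u(\cdot,t_m)-U^m\|_{L_2(\Omega)}\lesssim\mathcal E^{m,**}:=\mathcal E^{m,*}+M^{-2}\begin{cases}t_m^{2\alpha-2/r}&\text{if } 2/r<\alpha+1,\\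 0&\text{otherwise,}\end{cases}$$ where $$\mathcal E^{m,*}:=\begin{cases}M^{-r}\,t_m^{\alpha-1}&\text{if }1\le r<3-\alpha,\\ M^{\alpha-3}\,t_m^{\alpha-1}\,[1+\ln(t_m/t_1)]&\text{if } r=3-\alpha,\\ M^{\alpha-3}\,t_m^{\alpha-(3-\alpha)/r}&\text{if } r>3-\alpha.\end{cases}$$
   Context: Standing setting: $\Omega\subset\mathbb{R}^d$, $d\in\{1,2,3\}$, is a bounded Lipschitz domain; the coefficients $a_k$, $c$ are sufficiently smooth (in $C(\bar\Omega)$), $a_k>0$ in $\bar\Omega$, and $c\ge0$ (the paper assumes for general $\mathcal L$ with first-order coefficients $b_k$ that either $c\ge0$ or $c-\frac12\sum_k\partial_{x_k}b_k\ge0$; here $b_k=0$). It is assumed that the initial-boundary value problem has a unique solution $u$. Caputo derivative: $D_t^\alpha v(\cdot,t):=\frac1{\Gamma(1-\alpha)}\int_0^t(t-s)^{-\alpha}\,\partial_sv(\cdot,s)\,ds$. Alikhanov operator: let $\Pi_{1,j}$ and $\Pi_{2,j}$ be the Lagrange interpolation operators (in time) with interpolation points $\{t_{j-1},t_j\}$ (linear) and $\{t_{j-1},t_j,t_{j+1}\}$ (quadratic), respectively. For $m=1,\dots,M$, $$\delta_t^{\alpha,*}U^m:=D_t^\alpha(\Pi^mU)(t_m^* ),\qquad \Pi^m:=\begin{cases}\Pi_{2,j}&\text{on }(t_{j-1},t_j)\ \ \forall j<m,\\ \Pi_{1,m}&\text{on }(t_{m-1},t_m^* ).\end{cases}$$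 Notation: $a\lesssim b$ means $a\le Cb$ with a generic constant $C>0$ that does not depend on the number $M$ of mesh intervals or on mesh indices (it may depend on $\Omega,T,u_0,f$, on other fixed data such as $\alpha,r$ and the coefficients of $\mathcal L$, and on the constants implicit in the hypotheses). *)

theory Defs
  imports "HOL-Analysis.Analysis"
begin

section \<open>The Hilbert space of square-integrable functions\<close>

text \<open>
  Elements of \<open>'a l2\<close> are square-integrable functions on the whole space modulo equality almost
  everywhere. For \<open>\<Omega> \<subseteq> 'a\<close>, the space $L_2(\Omega)$ is identified, isometrically, with the subspace
  \<open>L2_on \<Omega>\<close> of those classes that vanish almost everywhere outside \<open>\<Omega>\<close> (extension by zero).
\<close>

definition sq_integrable :: "('a::euclidean_space \<Rightarrow> real) \<Rightarrow> bool" where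
  "sq_integrable f \<longleftrightarrow> f \<in> borel_measurable lborel \<and> integrable lborel (\<lambda>x. (f x)\<^sup>2)"

lemma sq_integrable_mult:
  assumes "sq_integrable f" "sq_integrable g"
  shows "integrable lborel (\<lambda>x. f x * g x)"
proof -
  have "integrable lborel (\<lambda>x. (f x)\<^sup>2 + (g x)\<^sup>2)"
    using assms by (auto simp: sq_integrable_def)
  then show ?thesis
  proof (rule Bochner_Integration.integrable_bound)
    show "(\<lambda>x. f x * g x) \<in> borel_measurable lborel"
      using assms unfolding sq_integrable_def by (intro borel_measurable_times) auto
    have "\<bar>y * z\<bar> \<le> y\<^sup>2 + z\<^sup>2" for y z :: real
    proof -
      have "2 * (\<bar>y\<bar> * \<bar>z\<bar>) \<le> y\<^sup>2 + z\<^sup>2"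
        using sum_squares_bound[of "\<bar>y\<bar>" "\<bar>z\<bar>"] by simp
      moreover have "0 \<le> \<bar>y\<bar> * \<bar>z\<bar>" by simp
      ultimately show ?thesis by (simp only: abs_mult)
    qed
    then show "AE x in lborel. norm (f x * g x) \<le> norm ((f x)\<^sup>2 + (g x)\<^sup>2)"
      by (intro AE_I2) (auto intro: order_trans[OF _ abs_ge_self])
  qed
qed

lemma sq_integrable_0: "sq_integrable (\<lambda>x. 0)"
  by (simp add: sq_integrable_def)

lemma sq_integrable_add:
  assumes "sq_integrable f" "sq_integrable g"
  shows "sq_integrable (\<lambda>x. f x + g x)"
proof -
  have "integrable lborel (\<lambda>x. (f x)\<^sup>2 + (g x)\<^sup>2 + 2 * (f x * g x))"
    using assms sq_integrable_mult[OF assms] by (auto simp: sq_integrable_def)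
  then show ?thesis
    using assms unfolding sq_integrable_def
    by (auto simp: power2_sum algebra_simps intro!: borel_measurable_add)
qed

lemma sq_integrable_scale:
  assumes "sq_integrable f"
  shows "sq_integrable (\<lambda>x. c * f x)"
  using assms unfolding sq_integrable_def
  by (auto simp: power_mult_distrib intro!: borel_measurable_times)

definition l2_rel :: "('a::euclidean_space \<Rightarrow> real) \<Rightarrow> ('a \<Rightarrow> real) \<Rightarrow> bool" where
  "l2_rel f g \<longleftrightarrow> sq_integrable f \<and> sq_integrable g \<and> (AE x in lborel. f x = g x)"

lemma l2_rel_part_equivp: "part_equivp l2_rel"
proof (rule part_equivpI)
  show "\<exists>f. l2_rel f f"
    by (rule exI[of _ "\<lambda>x. 0"]) (simp add: l2_rel_def sq_integrable_0)
  show "symp l2_rel"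
    by (rule sympI) (auto simp: l2_rel_def eq_commute)
  show "transp l2_rel"
    by (rule transpI) (auto simp: l2_rel_def)
qed

quotient_type (overloaded) 'a l2 = "'a::euclidean_space \<Rightarrow> real" / partial: l2_rel
  by (rule l2_rel_part_equivp)

instantiation l2 :: (euclidean_space) real_inner
begin

lift_definition zero_l2 :: "'a l2" is "\<lambda>x. 0"
  by (simp add: l2_rel_def sq_integrable_0)

lift_definition plus_l2 :: "'a l2 \<Rightarrow> 'a l2 \<Rightarrow> 'a l2" is "\<lambda>f g x. f x + g x"
  by (auto simp: l2_rel_def sq_integrable_add)

lift_definition scaleR_l2 :: "real \<Rightarrow> 'a l2 \<Rightarrow> 'a l2" is "\<lambda>c f x. c * f x"
  by (auto simp: l2_rel_def sq_integrable_scale)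

lift_definition inner_l2 :: "'a l2 \<Rightarrow> 'a l2 \<Rightarrow> real" is "\<lambda>f g. \<integral>x. f x * g x \<partial>lborel"
  by (intro integral_cong_AE) (auto simp: l2_rel_def sq_integrable_def)

definition uminus_l2 :: "'a l2 \<Rightarrow> 'a l2" where
  "uminus_l2 v = (-1) *\<^sub>R v"

definition minus_l2 :: "'a l2 \<Rightarrow> 'a l2 \<Rightarrow> 'a l2" where
  "minus_l2 v w = v + (-1) *\<^sub>R w"

definition norm_l2 :: "'a l2 \<Rightarrow> real" where
  "norm_l2 v = sqrt (inner v v)"

definition sgn_l2 :: "'a l2 \<Rightarrow> 'a l2" where
  "sgn_l2 v = inverse (norm v) *\<^sub>R v"

definition dist_l2 :: "'a l2 \<Rightarrow> 'a l2 \<Rightarrow> real" where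
  "dist_l2 v w = norm (v - w)"

definition uniformity_l2 :: "('a l2 \<times> 'a l2) filter" where
  "uniformity_l2 = (INF e\<in>{0<..}. principal {(v, w). dist v w < e})"

definition open_l2 :: "'a l2 set \<Rightarrow> bool" where
  "open_l2 S = (\<forall>v\<in>S. \<forall>\<^sub>F (v', w) in uniformity. v' = v \<longrightarrow> w \<in> S)"

instance
proof
  fix u v w :: "'a l2" and a b :: real
  show "u + v + w = u + (v + w)"
    by transfer (auto simp: l2_rel_def algebra_simps sq_integrable_add)
  show "u + v = v + u"
    by transfer (auto simp: l2_rel_def algebra_simps sq_integrable_add)
  show "0 + u = u"
    by transfer (auto simp: l2_rel_def)
  show "- u + u = 0"
    unfolding uminus_l2_def
    by transfer (auto simp: l2_rel_def sq_integrable_0)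
  show "u - v = u + - v"
    unfolding uminus_l2_def minus_l2_def by simp
  show "a *\<^sub>R (u + v) = a *\<^sub>R u + a *\<^sub>R v"
    by transfer (auto simp: l2_rel_def algebra_simps intro!: sq_integrable_add sq_integrable_scale)
  show "(a + b) *\<^sub>R u = a *\<^sub>R u + b *\<^sub>R u"
    by transfer (auto simp: l2_rel_def algebra_simps intro!: sq_integrable_add sq_integrable_scale)
  show "a *\<^sub>R b *\<^sub>R u = (a * b) *\<^sub>R u"
    by transfer (auto simp: l2_rel_def mult.assoc intro!: sq_integrable_scale)
  show "1 *\<^sub>R u = u"
    by transfer (auto simp: l2_rel_def)
  show "dist u v = norm (u - v)"
    by (rule dist_l2_def)
  show "sgn u = inverse (norm u) *\<^sub>R u"
    by (rule sgn_l2_def)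
  show "uniformity = (INF e\<in>{0<..}. principal {(v, w :: 'a l2). dist v w < e})"
    by (rule uniformity_l2_def)
  show "open S = (\<forall>v\<in>S. \<forall>\<^sub>F (v', w) in uniformity. v' = v \<longrightarrow> w \<in> S)" for S :: "'a l2 set"
    by (rule open_l2_def)
  show "inner u v = inner v u"
    by transfer (simp add: mult.commute)
  show "inner (u + v) w = inner u w + inner v w"
    by transfer (auto simp: l2_rel_def algebra_simps Bochner_Integration.integral_add sq_integrable_mult)
  show "inner (a *\<^sub>R u) v = a * inner u v"
    by transfer (simp add: mult.assoc)
  show "0 \<le> inner u u"
    by transfer (simp add: Bochner_Integration.integral_nonneg)
  show "inner u u = 0 \<longleftrightarrow> u = 0"
    by transfer
      (auto simp: l2_rel_def sq_integrable_0 sq_integrable_def integral_nonneg_eq_0_iff_AE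
            simp flip: power2_eq_square)
  show "norm u = sqrt (inner u u)"
    by (rule norm_l2_def)
qed

end

text \<open>The class of a square-integrable function (and \<open>0\<close> for all other functions).\<close>

definition l2_of :: "('a::euclidean_space \<Rightarrow> real) \<Rightarrow> 'a l2" where
  "l2_of f = (if sq_integrable f then abs_l2 f else 0)"

text \<open>A representative; it is only meaningful up to sets of measure zero.\<close>

definition l2_fun :: "'a::euclidean_space l2 \<Rightarrow> 'a \<Rightarrow> real" where
  "l2_fun v = rep_l2 v"

lemma l2_fun_sq_integrable: "sq_integrable (l2_fun v)"
  using Quotient_rep_reflp[OF Quotient_l2, of v] by (simp add: l2_fun_def l2_rel_def)

lemma l2_of_l2_fun: "l2_of (l2_fun v) = v"
  using l2_fun_sq_integrable[of v] Quotient_abs_rep[OF Quotient_l2, of v]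
  by (simp add: l2_of_def l2_fun_def)

lemma AE_l2_fun_l2_of:
  assumes "sq_integrable f"
  shows "AE x in lborel. l2_fun (l2_of f) x = f x"
proof -
  have "l2_rel f f" using assms by (simp add: l2_rel_def)
  then have "l2_rel (rep_l2 (abs_l2 f)) f"
    by (rule Quotient3_rep_abs[OF Quotient3_l2])
  then show ?thesis using assms by (simp add: l2_of_def l2_fun_def l2_rel_def)
qed

lemma inner_l2_eq: "inner v w = (\<integral>x. l2_fun v x * l2_fun w x \<partial>lborel)"
  unfolding l2_fun_def inner_l2.rep_eq by simp

lemma norm_l2_eq: "norm v = sqrt (\<integral>x. (l2_fun v x)\<^sup>2 \<partial>lborel)"
  unfolding norm_eq_sqrt_inner inner_l2_eq by (simp add: power2_eq_square)

definition L2_on :: "'a::euclidean_space set \<Rightarrow> 'a l2 set" where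
  "L2_on \<Omega> = {v. AE x in lborel. x \<notin> \<Omega> \<longrightarrow> l2_fun v x = 0}"


section \<open>Domains, test functions and the elliptic operator\<close>

text \<open>
  Near each boundary point, \<open>\<Omega>\<close> is the strict epigraph of a Lipschitz function \<open>\<gamma>\<close> over the
  hyperplane orthogonal to some unit vector \<open>n\<close>.
\<close>

definition bounded_lipschitz_domain :: "'a::euclidean_space set \<Rightarrow> bool" where
  "bounded_lipschitz_domain \<Omega> \<longleftrightarrow>
     open \<Omega> \<and> connected \<Omega> \<and> \<Omega> \<noteq> {} \<and> bounded \<Omega> \<and>
     (\<forall>p\<in>frontier \<Omega>. \<exists>n \<rho> K \<gamma>.
        norm n = 1 \<and> \<rho> > 0 \<and> K-lipschitz_on {y. y \<bullet> n = 0} \<gamma> \<and>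
        (\<forall>x\<in>ball p \<rho>. x \<in> \<Omega> \<longleftrightarrow> \<gamma> (x - (x \<bullet> n) *\<^sub>R n) < x \<bullet> n))"

definition pderiv_at :: "'a::euclidean_space \<Rightarrow> ('a \<Rightarrow> real) \<Rightarrow> 'a \<Rightarrow> real" where
  "pderiv_at b \<phi> x = frechet_derivative \<phi> (at x) b"

primrec C_diff :: "nat \<Rightarrow> ('a::euclidean_space \<Rightarrow> real) \<Rightarrow> bool" where
  "C_diff 0 \<phi> \<longleftrightarrow> continuous_on UNIV \<phi>"
| "C_diff (Suc n) \<phi> \<longleftrightarrow> (\<forall>x. \<phi> differentiable (at x)) \<and> (\<forall>b\<in>Basis. C_diff n (pderiv_at b \<phi>))"

text \<open>The functions in $C_c^\infty(\Omega)$, extended by zero.\<close>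

definition test_fun :: "'a::euclidean_space set \<Rightarrow> ('a \<Rightarrow> real) \<Rightarrow> bool" where
  "test_fun \<Omega> \<phi> \<longleftrightarrow>
     (\<forall>n. C_diff n \<phi>) \<and> compact (closure {x. \<phi> x \<noteq> 0}) \<and> closure {x. \<phi> x \<noteq> 0} \<subseteq> \<Omega>"

text \<open>
  $H^1_0(\Omega)$ is the closure of the test functions in the $H^1$ norm; \<open>H10_grad \<Omega> v g\<close> says that
  \<open>v\<close> lies in this closure and that \<open>g b\<close> is its (weak) partial derivative in direction \<open>b\<close>.
  The condition $v = 0$ on $\partial\Omega$ is understood as membership in $H^1_0(\Omega)$.
\<close>

definition H10_grad :: "'a::euclidean_space set \<Rightarrow> 'a l2 \<Rightarrow> ('a \<Rightarrow> 'a l2) \<Rightarrow> bool" where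
  "H10_grad \<Omega> v g \<longleftrightarrow>
     (\<exists>\<phi>. (\<forall>n. test_fun \<Omega> (\<phi> n)) \<and> (\<lambda>n. l2_of (\<phi> n)) \<longlonglongrightarrow> v \<and>
          (\<forall>b\<in>Basis. (\<lambda>n. l2_of (pderiv_at b (\<phi> n))) \<longlonglongrightarrow> g b))"

definition H10 :: "'a::euclidean_space set \<Rightarrow> 'a l2 set" where
  "H10 \<Omega> = {v. \<exists>g. H10_grad \<Omega> v g}"

text \<open>
  \<open>elliptic_rel \<Omega> a c v w\<close>: $v \in H^1_0(\Omega)$ and
  $-\sum_k \partial_{x_k}(a_k \partial_{x_k} v) + c v = w \in L_2(\Omega)$ in the sense of distributions.
  The coefficient $a_k$ is \<open>a b\<close> for the basis vector \<open>b\<close> of the $k$-th coordinate.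
\<close>

definition elliptic_rel ::
  "'a::euclidean_space set \<Rightarrow> ('a \<Rightarrow> 'a \<Rightarrow> real) \<Rightarrow> ('a \<Rightarrow> real) \<Rightarrow> 'a l2 \<Rightarrow> 'a l2 \<Rightarrow> bool" where
  "elliptic_rel \<Omega> a c v w \<longleftrightarrow> w \<in> L2_on \<Omega> \<and>
     (\<exists>g. H10_grad \<Omega> v g \<and>
       (\<forall>\<phi>. test_fun \<Omega> \<phi> \<longrightarrow>
          (\<Sum>b\<in>Basis. LINT x:\<Omega>|lborel. a b x * l2_fun (g b) x * pderiv_at b \<phi> x)
            + (LINT x:\<Omega>|lborel. c x * l2_fun v x * \<phi> x)
          = (LINT x:\<Omega>|lborel. l2_fun w x * \<phi> x)))"

definition elliptic_dom ::
  "'a::euclidean_space set \<Rightarrow> ('a \<Rightarrow> 'a \<Rightarrow> real) \<Rightarrow> ('a \<Rightarrow> real) \<Rightarrow> 'a l2 set" where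
  "elliptic_dom \<Omega> a c = {v. \<exists>w. elliptic_rel \<Omega> a c v w}"

text \<open>
  The value is determined uniquely on the domain (both the weak gradient and \<open>w\<close> are unique, as
  test functions are dense in $L_2(\Omega)$), so the choice operator makes no actual choice there.
\<close>

definition elliptic_op ::
  "'a::euclidean_space set \<Rightarrow> ('a \<Rightarrow> 'a \<Rightarrow> real) \<Rightarrow> ('a \<Rightarrow> real) \<Rightarrow> 'a l2 \<Rightarrow> 'a l2" where
  "elliptic_op \<Omega> a c v = (SOME w. elliptic_rel \<Omega> a c v w)"


section \<open>Time derivatives and the initial-boundary value problem\<close>

text \<open>
  Functions of $(x,t)$ are functions of \<open>t\<close> with values in $L_2(\Omega)$, and $\partial_t$ is the
  derivative in the $L_2$ norm (one-sided at \<open>t = T\<close>).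
\<close>

definition time_deriv ::
  "real \<Rightarrow> (real \<Rightarrow> 'b::real_normed_vector) \<Rightarrow> real \<Rightarrow> 'b" where
  "time_deriv T v t = vector_derivative v (at t within {0<..T})"

definition time_diff :: "nat \<Rightarrow> real \<Rightarrow> (real \<Rightarrow> 'b::real_normed_vector) \<Rightarrow> bool" where
  "time_diff n T v \<longleftrightarrow>
     (\<forall>l<n. \<forall>t\<in>{0<..T}. ((time_deriv T ^^ l) v) differentiable (at t within {0<..T}))"

text \<open>
  The integrand may be undefined at finitely many points (such as \<open>0\<close>, \<open>t\<close> and the mesh points),
  which does not affect the integral.
\<close>

definition caputo_integrand ::
  "real \<Rightarrow> (real \<Rightarrow> 'b::real_normed_vector) \<Rightarrow> real \<Rightarrow> real \<Rightarrow> 'b" where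
  "caputo_integrand \<alpha> v t s = ((t - s) powr (- \<alpha>)) *\<^sub>R vector_derivative v (at s)"

definition caputo :: "real \<Rightarrow> (real \<Rightarrow> 'b::real_normed_vector) \<Rightarrow> real \<Rightarrow> 'b" where
  "caputo \<alpha> v t = (1 / Gamma (1 - \<alpha>)) *\<^sub>R integral {0..t} (caputo_integrand \<alpha> v t)"

definition ibvp_solution ::
  "'a::euclidean_space set \<Rightarrow> ('a \<Rightarrow> 'a \<Rightarrow> real) \<Rightarrow> ('a \<Rightarrow> real) \<Rightarrow> real \<Rightarrow> real \<Rightarrow>
   (real \<Rightarrow> 'a l2) \<Rightarrow> 'a l2 \<Rightarrow> (real \<Rightarrow> 'a l2) \<Rightarrow> bool" where
  "ibvp_solution \<Omega> a c \<alpha> T f u0 u \<longleftrightarrow>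
     continuous_on {0..T} u \<and> u 0 = u0 \<and> time_diff 1 T u \<and>
     (\<forall>t\<in>{0<..T}.
        caputo_integrand \<alpha> u t integrable_on {0..t} \<and>
        u t \<in> H10 \<Omega> \<and> u t \<in> elliptic_dom \<Omega> a c \<and>
        caputo \<alpha> u t + elliptic_op \<Omega> a c (u t) = f t)"


section \<open>The Alikhanov scheme on a graded mesh\<close>

definition mesh :: "real \<Rightarrow> real \<Rightarrow> nat \<Rightarrow> nat \<Rightarrow> real" where
  "mesh T r M j = T * (real j / real M) powr r"

definition tstar :: "real \<Rightarrow> (nat \<Rightarrow> real) \<Rightarrow> nat \<Rightarrow> real" where
  "tstar \<alpha> t m = t m - \<alpha> / 2 * (t m - t (m - 1))"

definition ustar :: "real \<Rightarrow> (nat \<Rightarrow> 'b::real_vector) \<Rightarrow> nat \<Rightarrow> 'b" where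
  "ustar \<alpha> U m = (\<alpha> / 2) *\<^sub>R U (m - 1) + (1 - \<alpha> / 2) *\<^sub>R U m"

definition lagrange :: "(nat \<Rightarrow> real) \<Rightarrow> nat set \<Rightarrow> (nat \<Rightarrow> 'b::real_vector) \<Rightarrow> real \<Rightarrow> 'b" where
  "lagrange t I U s = (\<Sum>i\<in>I. (\<Prod>k\<in>I - {i}. (s - t k) / (t i - t k)) *\<^sub>R U i)"

text \<open>\<open>j\<close> below is the index with \<open>s \<in> (t (j - 1), t j]\<close>.\<close>

definition alikhanov_interp ::
  "(nat \<Rightarrow> real) \<Rightarrow> nat \<Rightarrow> (nat \<Rightarrow> 'b::real_vector) \<Rightarrow> real \<Rightarrow> 'b" where
  "alikhanov_interp t m U s =
     (if s \<le> t (m - 1)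
      then (let j = (LEAST j. 1 \<le> j \<and> s \<le> t j) in lagrange t {j - 1, j, j + 1} U s)
      else lagrange t {m - 1, m} U s)"

definition alikhanov_op ::
  "real \<Rightarrow> (nat \<Rightarrow> real) \<Rightarrow> (nat \<Rightarrow> 'b::real_normed_vector) \<Rightarrow> nat \<Rightarrow> 'b" where
  "alikhanov_op \<alpha> t U m = caputo \<alpha> (alikhanov_interp t m U) (tstar \<alpha> t m)"

definition alikhanov_scheme ::
  "'a::euclidean_space set \<Rightarrow> ('a \<Rightarrow> 'a \<Rightarrow> real) \<Rightarrow> ('a \<Rightarrow> real) \<Rightarrow> real \<Rightarrow> (nat \<Rightarrow> real) \<Rightarrow> nat \<Rightarrow>
   (real \<Rightarrow> 'a l2) \<Rightarrow> 'a l2 \<Rightarrow> (nat \<Rightarrow> 'a l2) \<Rightarrow> bool" where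
  "alikhanov_scheme \<Omega> a c \<alpha> t M f u0 U \<longleftrightarrow>
     U 0 = u0 \<and>
     (\<forall>m\<in>{1..M}.
        U m \<in> H10 \<Omega> \<and> ustar \<alpha> U m \<in> elliptic_dom \<Omega> a c \<and>
        alikhanov_op \<alpha> t U m + elliptic_op \<Omega> a c (ustar \<alpha> U m) = f (tstar \<alpha> t m))"

definition err_star :: "real \<Rightarrow> real \<Rightarrow> real \<Rightarrow> nat \<Rightarrow> nat \<Rightarrow> real" where
  "err_star \<alpha> T r M m =
     (let t = mesh T r M in
      if r < 3 - \<alpha> then real M powr (- r) * t m powr (\<alpha> - 1)
      else if r = 3 - \<alpha> then real M powr (\<alpha> - 3) * t m powr (\<alpha> - 1) * (1 + ln (t m / t 1))
      else real M powr (\<alpha> - 3) * t m powr (\<alpha> - (3 - \<alpha>) / r))"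

definition err_star2 :: "real \<Rightarrow> real \<Rightarrow> real \<Rightarrow> nat \<Rightarrow> nat \<Rightarrow> real" where
  "err_star2 \<alpha> T r M m =
     err_star \<alpha> T r M m +
     real M powr (- 2) *
       (if 2 / r < \<alpha> + 1 then mesh T r M m powr (2 * \<alpha> - 2 / r) else 0)"

end

theory Submission
  imports Defs
begin

text \<open>
  The error \<open>e\<^sub>j = u(t\<^sub>j) - U\<^sup>j\<close> satisfies the scheme with the consistency error as right-hand side. On
  a graded mesh the weight \<open>g\<^sub>j\<close> of \<open>U\<^sup>j - U\<^sup>j\<^sup>-\<^sup>1\<close> is bracketed by the kernel values \<open>(t\<^sub>m\<^sup>* - s)\<^sup>-\<^sup>\<alpha>\<close> at
  the two ends of step \<open>j\<close> (and \<open>g\<^sub>m\<close> is large enough), so the weights increase in \<open>j\<close>. Pairing the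
  error equation with \<open>e\<^sup>m\<^sup>,\<^sup>*\<close>, and using only that the elliptic operator is positive, shows that the
  discrete operator applied to the scalars \<open>\<parallel>e\<^sub>j\<parallel>\<close> is bounded by the norm of the consistency error.

  That norm is estimated by pairing with a unit vector. Integration by parts reduces the truncation
  error to the quadratic interpolation error on the steps before the last one; on the last step the
  choice of \<open>t\<^sub>m\<^sup>*\<close> makes the leading term of the interpolation error orthogonal to the kernel.

  By discrete comparison it remains to find barriers, for which the discrete operator dominates the
  powers of \<open>t\<^sub>m\<close> in the consistency bound. They are built from shifted powers \<open>(s + a)\<^sup>\<sigma>\<close> with
  \<open>\<alpha> - 1 \<le> \<sigma> < 0\<close>, set to \<open>0\<close> at time \<open>0\<close>: their Riemann--Liouville derivative is explicitly bounded
  below, and the truncation estimate transfers this bound to the discrete operator.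
\<close>

section \<open>The elliptic operator\<close>

text \<open>The exponent \<alpha> - 1 is critical: the Riemann-Liouville derivative of the unshifted
  power vanishes, and a shift \<open>a\<close> leaves only
  \<open>a powr \<alpha> * x powr (-\<alpha>) / (x + a)\<close>. Hence one power does not suffice
  once the consistency bound decays like 1/t or faster, and the superposition brings in the factor
  \<open>t m powr (\<alpha> - 1)\<close> of the error bound. The fractional derivative contributes
  \<open>(t1 / t m) powr (min (\<alpha> + 1) ((3 - \<alpha>) / r))\<close> to the consistency bound,
  with \<open>t1\<close> the first mesh point: (3 - \<alpha>) / r is the order of the local error
  near \<open>t m\<close>, and \<alpha> + 1 reflects the memory of the initial layer. The minimum is
  above, at or below 1 as \<open>r\<close> is below, at or above 3 - \<alpha>, whence the three
  cases. Averaging the elliptic term contributes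
  \<open>t1 powr (2 / r) * t m powr (\<alpha> - 2 / r)\<close>, the source of the extra term. The
  shifts are a multiple \<open>N\<close> of mesh points with \<open>N\<close> depending on \<alpha>,
  \<open>r\<close> and the exponent only, which makes all constants uniform in the mesh. The first
  step needs separate treatment: derivatives blow up at 0 and \<open>u0\<close> may lie outside the
  domain of the elliptic operator.\<close>

lemma sq_integrable_imp_l2_rel: "sq_integrable f \<Longrightarrow> l2_rel f f"
  by (simp add: l2_rel_def)

lemma l2_fun_measurable [measurable]: "l2_fun v \<in> borel_measurable borel"
  using l2_fun_sq_integrable[of v] by (simp add: sq_integrable_def)

lemma inner_l2_of:
  assumes "sq_integrable f" "sq_integrable g"
  shows "inner (l2_of f) (l2_of g) = (\<integral>x. f x * g x \<partial>lborel)"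
  using AE_l2_fun_l2_of[OF assms(1)] AE_l2_fun_l2_of[OF assms(2)] assms
  unfolding inner_l2_eq sq_integrable_def
  by (intro integral_cong_AE) (auto intro!: borel_measurable_times)

lemma inner_l2_of_right:
  assumes "sq_integrable g"
  shows "inner v (l2_of g) = (\<integral>x. l2_fun v x * g x \<partial>lborel)"
  using inner_l2_of[OF l2_fun_sq_integrable assms, of v] by (simp add: l2_of_l2_fun)

lemma l2_of_lincomb:
  assumes "sq_integrable f" "sq_integrable g"
  shows "l2_of (\<lambda>x. p * f x + q * g x) = p *\<^sub>R l2_of f + q *\<^sub>R l2_of g"
proof -
  have "sq_integrable (\<lambda>x. p * f x)" "sq_integrable (\<lambda>x. q * g x)"
    "sq_integrable (\<lambda>x. p * f x + q * g x)"
    using assms by (auto intro!: sq_integrable_add sq_integrable_scale)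
  then show ?thesis using assms
    by (simp add: l2_of_def plus_l2.abs_eq scaleR_l2.abs_eq sq_integrable_imp_l2_rel)
qed

text \<open>Representatives are chosen class by class, so linearity of \<open>l2_fun\<close> can be
  asserted only almost everywhere.\<close>

lemma AE_l2_fun_lincomb:
  "AE x in lborel. l2_fun (p *\<^sub>R v + q *\<^sub>R w) x = p * l2_fun v x + q * l2_fun w x"
proof -
  have "p *\<^sub>R v + q *\<^sub>R w = l2_of (\<lambda>x. p * l2_fun v x + q * l2_fun w x)"
    by (simp add: l2_of_lincomb l2_fun_sq_integrable l2_of_l2_fun)
  moreover have "sq_integrable (\<lambda>x. p * l2_fun v x + q * l2_fun w x)"
    by (intro sq_integrable_add sq_integrable_scale l2_fun_sq_integrable)
  ultimately show ?thesis
    using AE_l2_fun_l2_of[of "\<lambda>x. p * l2_fun v x + q * l2_fun w x"] by simp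
qed

section \<open>Linear structure of test functions and of \<open>H10\<close>\<close>

lemma C_diff_imp_continuous: "C_diff n \<phi> \<Longrightarrow> continuous_on UNIV \<phi>"
  by (cases n) (auto intro!: continuous_at_imp_continuous_on differentiable_imp_continuous_within)

lemma pderiv_at_lincomb:
  assumes "\<phi> differentiable (at x)" "\<psi> differentiable (at x)"
  shows "pderiv_at b (\<lambda>x. p * \<phi> x + q * \<psi> x) x = p * pderiv_at b \<phi> x + q * pderiv_at b \<psi> x"
proof -
  have "((\<lambda>x. p * \<phi> x + q * \<psi> x) has_derivative
      (\<lambda>h. p * frechet_derivative \<phi> (at x) h + q * frechet_derivative \<psi> (at x) h)) (at x)"
    using assms unfolding frechet_derivative_works
    by (intro has_derivative_add has_derivative_mult_right)
  from frechet_derivative_at[OF this, symmetric] show ?thesis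
    by (simp add: pderiv_at_def)
qed

lemma C_diff_lincomb:
  "C_diff n \<phi> \<Longrightarrow> C_diff n \<psi> \<Longrightarrow> C_diff n (\<lambda>x. p * \<phi> x + q * \<psi> x)"
proof (induction n arbitrary: \<phi> \<psi>)
  case 0
  then show ?case by (auto intro!: continuous_intros)
next
  case (Suc n)
  have "pderiv_at b (\<lambda>x. p * \<phi> x + q * \<psi> x) = (\<lambda>x. p * pderiv_at b \<phi> x + q * pderiv_at b \<psi> x)" for b
    using Suc.prems by (auto simp: fun_eq_iff intro!: pderiv_at_lincomb)
  then show ?case
    using Suc by (simp add: differentiable_add differentiable_mult)
qed

lemma test_fun_lincomb:
  assumes "test_fun \<Omega> \<phi>" "test_fun \<Omega> \<psi>"
  shows "test_fun \<Omega> (\<lambda>x. p * \<phi> x + q * \<psi> x)"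
proof -
  let ?S = "\<lambda>\<phi>. closure {x. \<phi> x \<noteq> 0}"
  have "{x. p * \<phi> x + q * \<psi> x \<noteq> 0} \<subseteq> {x. \<phi> x \<noteq> 0} \<union> {x. \<psi> x \<noteq> 0}" by auto
  then have sub: "?S (\<lambda>x. p * \<phi> x + q * \<psi> x) \<subseteq> ?S \<phi> \<union> ?S \<psi>"
    unfolding closure_Un[symmetric] by (rule closure_mono)
  have "compact (?S \<phi> \<union> ?S \<psi>)" using assms by (auto simp: test_fun_def)
  then have "compact (?S (\<lambda>x. p * \<phi> x + q * \<psi> x))"
    using bounded_subset[OF compact_imp_bounded sub]
    by (simp add: compact_eq_bounded_closed)
  then show ?thesis
    using assms sub by (auto simp: test_fun_def intro!: C_diff_lincomb)
qed

lemma pderiv_at_outside_support: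
  assumes "x \<notin> closure {x. \<phi> x \<noteq> 0}"
  shows "pderiv_at b \<phi> x = 0"
proof -
  have "(\<phi> has_derivative (\<lambda>h. 0)) (at x)"
  proof (rule has_derivative_transform_within_open)
    show "((\<lambda>x. 0) has_derivative (\<lambda>h. 0)) (at x)" by simp
    show "open (- closure {x. \<phi> x \<noteq> 0})" by auto
    show "x \<in> - closure {x. \<phi> x \<noteq> 0}" using assms by auto
    show "0 = \<phi> x" if "x \<in> - closure {x. \<phi> x \<noteq> 0}" for x
      using that closure_subset[of "{x. \<phi> x \<noteq> 0}"] by auto
  qed
  from frechet_derivative_at[OF this, symmetric] show ?thesis
    by (simp add: pderiv_at_def)
qed

lemma sq_integrable_compact_support:
  fixes f :: "'a::euclidean_space \<Rightarrow> real"
  assumes "continuous_on UNIV f" "compact K" "\<And>x. x \<notin> K \<Longrightarrow> f x = 0"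
  shows "sq_integrable f"
proof -
  have "integrable lborel (\<lambda>x. indicator K x *\<^sub>R (f x)\<^sup>2)"
    by (rule borel_integrable_compact[OF assms(2)])
       (auto intro!: continuous_intros continuous_on_subset[OF assms(1)])
  also have "(\<lambda>x. indicator K x *\<^sub>R (f x)\<^sup>2) = (\<lambda>x. (f x)\<^sup>2)"
    using assms(3) by (auto simp: indicator_def fun_eq_iff)
  finally show ?thesis
    using assms(1) by (auto simp: sq_integrable_def borel_measurable_continuous_onI)
qed

lemma test_fun_sq_integrable: "test_fun \<Omega> \<phi> \<Longrightarrow> sq_integrable \<phi>"
  unfolding test_fun_def
  by (rule sq_integrable_compact_support[of _ "closure {x. \<phi> x \<noteq> 0}"])
     (use closure_subset[of "{x. \<phi> x \<noteq> 0}"] in \<open>auto dest: C_diff_imp_continuous\<close>)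

lemma test_fun_pderiv_sq_integrable:
  assumes "test_fun \<Omega> \<phi>" "b \<in> Basis"
  shows "sq_integrable (pderiv_at b \<phi>)"
proof -
  have "C_diff (Suc 0) \<phi>" using assms unfolding test_fun_def by blast
  then have "continuous_on UNIV (pderiv_at b \<phi>)" using assms(2) by simp
  then show ?thesis
    using assms unfolding test_fun_def
    by (intro sq_integrable_compact_support[of _ "closure {x. \<phi> x \<noteq> 0}"])
       (auto simp: pderiv_at_outside_support)
qed

lemma H10_grad_lincomb:
  assumes "H10_grad \<Omega> v g" "H10_grad \<Omega> v' g'"
  shows "H10_grad \<Omega> (p *\<^sub>R v + q *\<^sub>R v') (\<lambda>b. p *\<^sub>R g b + q *\<^sub>R g' b)"
proof -
  obtain \<phi> \<psi> where \<phi>: "\<forall>n. test_fun \<Omega> (\<phi> n)" "(\<lambda>n. l2_of (\<phi> n)) \<longlonglongrightarrow> v"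
      "\<forall>b\<in>Basis. (\<lambda>n. l2_of (pderiv_at b (\<phi> n))) \<longlonglongrightarrow> g b"
    and \<psi>: "\<forall>n. test_fun \<Omega> (\<psi> n)" "(\<lambda>n. l2_of (\<psi> n)) \<longlonglongrightarrow> v'"
      "\<forall>b\<in>Basis. (\<lambda>n. l2_of (pderiv_at b (\<psi> n))) \<longlonglongrightarrow> g' b"
    using assms unfolding H10_grad_def by blast
  have "C_diff (Suc 0) (\<phi> n)" "C_diff (Suc 0) (\<psi> n)" for n
    using \<phi>(1) \<psi>(1) unfolding test_fun_def by blast+
  then have diff: "\<And>n x. \<phi> n differentiable (at x)" "\<And>n x. \<psi> n differentiable (at x)"
    by simp_all
  have p: "pderiv_at b (\<lambda>x. p * \<phi> n x + q * \<psi> n x) =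
      (\<lambda>x. p * pderiv_at b (\<phi> n) x + q * pderiv_at b (\<psi> n) x)" for b n
    using diff by (auto simp: fun_eq_iff intro!: pderiv_at_lincomb)
  show ?thesis
    unfolding H10_grad_def
  proof (intro exI[of _ "\<lambda>n x. p * \<phi> n x + q * \<psi> n x"] conjI allI ballI)
    show "test_fun \<Omega> (\<lambda>x. p * \<phi> n x + q * \<psi> n x)" for n
      using \<phi>(1) \<psi>(1) by (auto intro: test_fun_lincomb)
    show "(\<lambda>n. l2_of (\<lambda>x. p * \<phi> n x + q * \<psi> n x)) \<longlonglongrightarrow> p *\<^sub>R v + q *\<^sub>R v'"
      using \<phi> \<psi> by (subst l2_of_lincomb) (auto intro!: tendsto_intros test_fun_sq_integrable)
    show "(\<lambda>n. l2_of (pderiv_at b (\<lambda>x. p * \<phi> n x + q * \<psi> n x))) \<longlonglongrightarrow> p *\<^sub>R g b + q *\<^sub>R g' b"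
      if "b \<in> Basis" for b
      unfolding p using \<phi> \<psi> that
      by (subst l2_of_lincomb) (auto intro!: tendsto_intros test_fun_pderiv_sq_integrable)
  qed
qed

section \<open>The weak form as a sum of L2 inner products, its positivity and linearity\<close>

lemma bounded_coeff_indicator:
  fixes \<Omega> :: "'a::euclidean_space set" and c :: "'a \<Rightarrow> real"
  assumes "open \<Omega>" "bounded \<Omega>" "continuous_on (closure \<Omega>) c"
  obtains B where "(\<lambda>x. indicator \<Omega> x * c x) \<in> borel_measurable borel"
    "\<And>x. \<bar>indicator \<Omega> x * c x\<bar> \<le> B"
proof -
  have "(\<lambda>x. indicator \<Omega> x *\<^sub>R c x) \<in> borel_measurable borel"
    by (rule borel_measurable_continuous_on_indicator)
       (use assms in \<open>auto intro: continuous_on_subset[OF _ closure_subset]\<close>)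
  moreover have "bounded (c ` closure \<Omega>)"
    using assms by (intro compact_imp_bounded compact_continuous_image) (auto simp: compact_closure)
  then obtain B where "\<forall>x\<in>closure \<Omega>. \<bar>c x\<bar> \<le> B"
    by (auto simp: bounded_iff)
  then have "\<bar>indicator \<Omega> x * c x\<bar> \<le> max B 0" for x
    using closure_subset[of \<Omega>] by (force simp: indicator_def)
  ultimately show thesis using that by auto
qed

lemma sq_integrable_bounded_mult:
  fixes f c :: "'a::euclidean_space \<Rightarrow> real"
  assumes f: "sq_integrable f" and c: "c \<in> borel_measurable borel" "\<And>x. \<bar>c x\<bar> \<le> B"
  shows "sq_integrable (\<lambda>x. c x * f x)"
  unfolding sq_integrable_def
proof
  have m[measurable]: "f \<in> borel_measurable borel" "c \<in> borel_measurable borel"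
    using f c by (auto simp: sq_integrable_def)
  show "(\<lambda>x. c x * f x) \<in> borel_measurable lborel" by simp
  have "integrable lborel (\<lambda>x. B\<^sup>2 * (f x)\<^sup>2)"
    using f by (auto simp: sq_integrable_def)
  then show "integrable lborel (\<lambda>x. (c x * f x)\<^sup>2)"
  proof (rule Bochner_Integration.integrable_bound)
    have "(c x)\<^sup>2 \<le> B\<^sup>2" for x
      using c(2)[of x] by (metis abs_le_square_iff abs_ge_zero abs_of_nonneg order_trans)
    then show "AE x in lborel. norm ((c x * f x)\<^sup>2) \<le> norm (B\<^sup>2 * (f x)\<^sup>2)"
      by (auto simp: power_mult_distrib intro!: mult_right_mono)
  qed simp
qed

text \<open>With the coefficient, which is bounded on the compact closure, absorbed into the first
  factor, each term of the weak form becomes an \<open>inner\<close> on the whole space. Limits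
  along test functions then follow from continuity of \<open>inner\<close>.\<close>

lemma set_lint_mult_eq_inner:
  fixes \<Omega> :: "'a::euclidean_space set"
  assumes "open \<Omega>" "bounded \<Omega>" "continuous_on (closure \<Omega>) c" "sq_integrable f" "sq_integrable \<phi>"
  shows "sq_integrable (\<lambda>x. indicator \<Omega> x * c x * f x)"
    and "(LINT x:\<Omega>|lborel. c x * f x * \<phi> x) =
      inner (l2_of (\<lambda>x. indicator \<Omega> x * c x * f x)) (l2_of \<phi>)"
proof -
  obtain B where "(\<lambda>x. indicator \<Omega> x * c x) \<in> borel_measurable borel"
      "\<And>x. \<bar>indicator \<Omega> x * c x\<bar> \<le> B"
    using bounded_coeff_indicator assms(1-3) by blast
  from sq_integrable_bounded_mult[OF assms(4) this]
  show *: "sq_integrable (\<lambda>x. indicator \<Omega> x * c x * f x)" by simp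
  show "(LINT x:\<Omega>|lborel. c x * f x * \<phi> x) =
      inner (l2_of (\<lambda>x. indicator \<Omega> x * c x * f x)) (l2_of \<phi>)"
    unfolding inner_l2_of[OF * assms(5)] set_lebesgue_integral_def
    by (simp add: mult.assoc)
qed

text \<open>The weak equation is available for test functions only. Inserting a sequence that
  converges to \<open>v\<close> together with its partial derivatives expresses
  \<open>inner w v\<close> through the weak gradient and \<open>v\<close> itself; every term is the
  integral of a nonnegative coefficient times a square.\<close>

lemma elliptic_rel_nonneg:
  fixes \<Omega> :: "'a::euclidean_space set"
  assumes \<Omega>: "open \<Omega>" "bounded \<Omega>"
    and a: "\<And>b. b \<in> Basis \<Longrightarrow> continuous_on (closure \<Omega>) (a b)"
      "\<And>b x. b \<in> Basis \<Longrightarrow> x \<in> closure \<Omega> \<Longrightarrow> a b x > 0"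
    and c: "continuous_on (closure \<Omega>) c" "\<And>x. x \<in> closure \<Omega> \<Longrightarrow> c x \<ge> 0"
    and rel: "elliptic_rel \<Omega> a c v w"
  shows "inner w v \<ge> 0"
proof -
  obtain g where "H10_grad \<Omega> v g" and eq: "\<And>\<phi>. test_fun \<Omega> \<phi> \<Longrightarrow>
          (\<Sum>b\<in>Basis. LINT x:\<Omega>|lborel. a b x * l2_fun (g b) x * pderiv_at b \<phi> x)
            + (LINT x:\<Omega>|lborel. c x * l2_fun v x * \<phi> x)
          = (LINT x:\<Omega>|lborel. l2_fun w x * \<phi> x)"
    using rel unfolding elliptic_rel_def by blast
  then obtain \<phi> where \<phi>: "\<And>n. test_fun \<Omega> (\<phi> n)" "(\<lambda>n. l2_of (\<phi> n)) \<longlonglongrightarrow> v"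
      "\<And>b. b \<in> Basis \<Longrightarrow> (\<lambda>n. l2_of (pderiv_at b (\<phi> n))) \<longlonglongrightarrow> g b"
    unfolding H10_grad_def by blast
  have l2: "sq_integrable (l2_fun z)" for z :: "'a l2" by (rule l2_fun_sq_integrable)
  have sq: "sq_integrable (\<phi> n)" "b \<in> Basis \<Longrightarrow> sq_integrable (pderiv_at b (\<phi> n))" for n b
    using \<phi>(1) by (auto intro: test_fun_sq_integrable test_fun_pderiv_sq_integrable)
  define A where "A b = l2_of (\<lambda>x. indicator \<Omega> x * a b x * l2_fun (g b) x)" for b
  define D where "D = l2_of (\<lambda>x. indicator \<Omega> x * c x * l2_fun v x)"
  have w: "(LINT x:\<Omega>|lborel. l2_fun w x * \<phi> n x) = inner w (l2_of (\<phi> n))" for n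
    unfolding inner_l2_of_right[OF sq(1)] set_lebesgue_integral_def
    using \<phi>(1)[of n] closure_subset[of "{x. \<phi> n x \<noteq> 0}"]
    by (intro Bochner_Integration.integral_cong) (auto simp: test_fun_def indicator_def)
  have "(\<Sum>b\<in>Basis. inner (A b) (l2_of (pderiv_at b (\<phi> n)))) + inner D (l2_of (\<phi> n))
      = inner w (l2_of (\<phi> n))" for n
    using eq[OF \<phi>(1)[of n]] unfolding w A_def D_def
    by (simp add: set_lint_mult_eq_inner(2)[OF \<Omega> c(1) l2 sq(1)]
        set_lint_mult_eq_inner(2)[OF \<Omega> a(1) l2 sq(2)])
  moreover have "(\<lambda>n. (\<Sum>b\<in>Basis. inner (A b) (l2_of (pderiv_at b (\<phi> n)))) + inner D (l2_of (\<phi> n)))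
      \<longlonglongrightarrow> (\<Sum>b\<in>Basis. inner (A b) (g b)) + inner D v"
    using \<phi>(2,3) by (intro tendsto_intros)
  moreover have "(\<lambda>n. inner w (l2_of (\<phi> n))) \<longlonglongrightarrow> inner w v"
    using \<phi>(2) by (intro tendsto_intros)
  ultimately have "inner w v = (\<Sum>b\<in>Basis. inner (A b) (g b)) + inner D v"
    using LIMSEQ_unique by fastforce
  moreover have pos: "inner (l2_of (\<lambda>x. indicator \<Omega> x * d x * l2_fun z x)) z \<ge> 0"
    if "continuous_on (closure \<Omega>) d" "\<And>x. x \<in> closure \<Omega> \<Longrightarrow> d x \<ge> 0" for d z
  proof -
    have "inner (l2_of (\<lambda>x. indicator \<Omega> x * d x * l2_fun z x)) (l2_of (l2_fun z)) \<ge> 0"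
      unfolding inner_l2_of[OF set_lint_mult_eq_inner(1)[OF \<Omega> that(1) l2 l2] l2]
      using that(2) closure_subset[of \<Omega>]
      by (intro Bochner_Integration.integral_nonneg)
         (auto simp: indicator_def mult.assoc subset_iff intro!: mult_nonneg_nonneg[OF _ zero_le_square])
    then show ?thesis by (simp add: l2_of_l2_fun)
  qed
  ultimately show ?thesis
    unfolding A_def D_def using a c
    by (simp, intro add_nonneg_nonneg sum_nonneg pos) (auto intro: less_imp_le)
qed

text \<open>Linearity is stated for the relation: values of \<open>elliptic_op\<close> selected at
  different arguments can be combined and fed into \<open>elliptic_rel_nonneg\<close>, whatever
  value is selected at the combined argument.\<close>

lemma elliptic_rel_lincomb:
  fixes \<Omega> :: "'a::euclidean_space set"
  assumes \<Omega>: "open \<Omega>" "bounded \<Omega>"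
    and a: "\<And>b. b \<in> Basis \<Longrightarrow> continuous_on (closure \<Omega>) (a b)"
    and c: "continuous_on (closure \<Omega>) c"
    and rel: "elliptic_rel \<Omega> a c v w" "elliptic_rel \<Omega> a c v' w'"
  shows "elliptic_rel \<Omega> a c (p *\<^sub>R v + q *\<^sub>R v') (p *\<^sub>R w + q *\<^sub>R w')"
proof -
  obtain g g' where g: "H10_grad \<Omega> v g" "\<And>\<phi>. test_fun \<Omega> \<phi> \<Longrightarrow>
          (\<Sum>b\<in>Basis. LINT x:\<Omega>|lborel. a b x * l2_fun (g b) x * pderiv_at b \<phi> x)
            + (LINT x:\<Omega>|lborel. c x * l2_fun v x * \<phi> x)
          = (LINT x:\<Omega>|lborel. l2_fun w x * \<phi> x)"
    and g': "H10_grad \<Omega> v' g'" "\<And>\<phi>. test_fun \<Omega> \<phi> \<Longrightarrow>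
          (\<Sum>b\<in>Basis. LINT x:\<Omega>|lborel. a b x * l2_fun (g' b) x * pderiv_at b \<phi> x)
            + (LINT x:\<Omega>|lborel. c x * l2_fun v' x * \<phi> x)
          = (LINT x:\<Omega>|lborel. l2_fun w' x * \<phi> x)"
    using rel unfolding elliptic_rel_def by blast
  have lin: "(LINT x:\<Omega>|lborel. d x * l2_fun (p *\<^sub>R z + q *\<^sub>R z') x * \<phi> x) =
      p * (LINT x:\<Omega>|lborel. d x * l2_fun z x * \<phi> x) + q * (LINT x:\<Omega>|lborel. d x * l2_fun z' x * \<phi> x)"
    if d: "continuous_on (closure \<Omega>) d" and \<phi>: "sq_integrable \<phi>" for d \<phi> z z'
  proof -
    let ?m = "\<lambda>z x. indicator \<Omega> x * d x * l2_fun z x"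
    have sq: "sq_integrable (?m z)" for z
      by (rule set_lint_mult_eq_inner(1)[OF \<Omega> d l2_fun_sq_integrable \<phi>])
    have "AE x in lborel. ?m (p *\<^sub>R z + q *\<^sub>R z') x = p * ?m z x + q * ?m z' x"
      using AE_l2_fun_lincomb[of p z q z'] by eventually_elim (simp add: algebra_simps)
    then have "l2_rel (?m (p *\<^sub>R z + q *\<^sub>R z')) (\<lambda>x. p * ?m z x + q * ?m z' x)"
      using sq by (auto simp: l2_rel_def intro!: sq_integrable_add sq_integrable_scale)
    then have "abs_l2 (?m (p *\<^sub>R z + q *\<^sub>R z')) = abs_l2 (\<lambda>x. p * ?m z x + q * ?m z' x)"
      using Quotient_rel_abs[OF Quotient_l2] by blast
    moreover have "sq_integrable (\<lambda>x. p * ?m z x + q * ?m z' x)"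
      using sq by (auto intro!: sq_integrable_add sq_integrable_scale)
    ultimately have "l2_of (?m (p *\<^sub>R z + q *\<^sub>R z')) = p *\<^sub>R l2_of (?m z) + q *\<^sub>R l2_of (?m z')"
      using sq by (simp add: l2_of_lincomb[OF sq sq, symmetric]) (simp add: l2_of_def)
    then show ?thesis
      by (simp add: set_lint_mult_eq_inner(2)[OF \<Omega> d l2_fun_sq_integrable \<phi>] inner_add_left)
  qed
  have "p *\<^sub>R w + q *\<^sub>R w' \<in> L2_on \<Omega>"
    using AE_l2_fun_lincomb[of p w q w'] rel unfolding elliptic_rel_def L2_on_def by auto
  moreover have "(\<Sum>b\<in>Basis. LINT x:\<Omega>|lborel. a b x * l2_fun (p *\<^sub>R g b + q *\<^sub>R g' b) x * pderiv_at b \<phi> x)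
            + (LINT x:\<Omega>|lborel. c x * l2_fun (p *\<^sub>R v + q *\<^sub>R v') x * \<phi> x)
          = (LINT x:\<Omega>|lborel. l2_fun (p *\<^sub>R w + q *\<^sub>R w') x * \<phi> x)" if "test_fun \<Omega> \<phi>" for \<phi>
  proof -
    have "(\<Sum>b\<in>Basis. LINT x:\<Omega>|lborel. a b x * l2_fun (p *\<^sub>R g b + q *\<^sub>R g' b) x * pderiv_at b \<phi> x) =
        p * (\<Sum>b\<in>Basis. LINT x:\<Omega>|lborel. a b x * l2_fun (g b) x * pderiv_at b \<phi> x)
        + q * (\<Sum>b\<in>Basis. LINT x:\<Omega>|lborel. a b x * l2_fun (g' b) x * pderiv_at b \<phi> x)"
      unfolding sum_distrib_left sum.distrib[symmetric]
      by (intro sum.cong refl lin a test_fun_pderiv_sq_integrable[OF that])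
    then show ?thesis
      using lin[OF c test_fun_sq_integrable[OF that], of v v']
        lin[of "\<lambda>x. 1" \<phi> w w'] test_fun_sq_integrable[OF that]
      unfolding g(2)[OF that, symmetric] g'(2)[OF that, symmetric]
      by (simp add: g(2)[OF that, symmetric] g'(2)[OF that, symmetric] distrib_left)
  qed
  ultimately show ?thesis
    unfolding elliptic_rel_def using H10_grad_lincomb[OF g(1) g'(1)] by blast
qed

lemma elliptic_op_rel: "v \<in> elliptic_dom \<Omega> a c \<Longrightarrow> elliptic_rel \<Omega> a c v (elliptic_op \<Omega> a c v)"
  unfolding elliptic_dom_def elliptic_op_def by (auto intro: someI)

section \<open>Weights of the Alikhanov operator\<close>

lemma has_integral_kernel:
  fixes x \<beta> :: real
  assumes "\<beta> < 1" "lo \<le> hi" "hi \<le> x"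
  shows "((\<lambda>s. (x - s) powr (-\<beta>)) has_integral
    ((x - lo) powr (1 - \<beta>) - (x - hi) powr (1 - \<beta>)) / (1 - \<beta>)) {lo..hi}"
proof -
  have "((\<lambda>s. (x - s) powr (-\<beta>)) has_integral
      (- ((x - hi) powr (1 - \<beta>)) / (1 - \<beta>)) - (- ((x - lo) powr (1 - \<beta>)) / (1 - \<beta>))) {lo..hi}"
  proof (rule fundamental_theorem_of_calculus_interior[OF assms(2)])
    show "continuous_on {lo..hi} (\<lambda>s. - ((x - s) powr (1 - \<beta>)) / (1 - \<beta>))"
      using assms by (intro continuous_intros continuous_on_powr') auto
    show "((\<lambda>s. - ((x - s) powr (1 - \<beta>)) / (1 - \<beta>)) has_vector_derivative (x - s) powr - \<beta>) (at s)"
      if "s \<in> {lo<..<hi}" for s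
      unfolding has_real_derivative_iff_has_vector_derivative[symmetric]
      using assms that by (auto intro!: derivative_eq_intros)
  qed
  then show ?thesis by (simp add: diff_divide_distrib)
qed

text \<open>The level \<open>m\<close> is a parameter because kernel and weights change with it; the
  comparison argument interprets the locale at every level of one mesh. Nondecreasing steps are what
  makes the weights monotone.\<close>

locale alikhanov_mesh =
  fixes \<alpha> :: real and t :: "nat \<Rightarrow> real" and m :: nat
  assumes alpha: "0 < \<alpha>" "\<alpha> < 1"
    and t0: "t 0 = 0" and t_mono: "strict_mono t"
    and step_mono: "\<And>j. 1 \<le> j \<Longrightarrow> t j - t (j - 1) \<le> t (j + 1) - t j"
    and m: "1 \<le> m"
begin

text \<open>
  \<open>g j\<close> is the coefficient of \<open>U j - U (j - 1)\<close> in \<open>\<Gamma>(1 - \<alpha>)\<close> times the discrete operator. On step \<open>j\<close> the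
  slope of the interpolant is \<open>(1 - q j s)\<close> times the difference quotient of step \<open>j\<close> plus \<open>q j s\<close> times
  that of step \<open>j + 1\<close>; \<open>aa\<close> and \<open>bb\<close> are the corresponding kernel moments.
\<close>

definition "ts = tstar \<alpha> t m"
definition \<kappa> where "\<kappa> s = (ts - s) powr (-\<alpha>)"
definition hi where "hi j = (if j < m then t j else ts)"
definition \<tau> where "\<tau> j = t j - t (j - 1)"
definition q where "q j s = (if j < m then (2 * s - t (j - 1) - t j) / (t (j + 1) - t (j - 1)) else 0)"
definition bb where "bb j = (if 1 \<le> j then integral {t (j - 1)..hi j} (\<lambda>s. \<kappa> s * q j s) else 0)"
definition aa where "aa j = integral {t (j - 1)..hi j} \<kappa>"
definition g where "g j = (aa j - bb j + bb (j - 1)) / \<tau> j"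

lemma t_less: "i < j \<Longrightarrow> t i < t j"
  using t_mono by (simp add: strict_mono_def)

lemma t_le: "i \<le> j \<Longrightarrow> t i \<le> t j"
  using t_mono by (simp add: strict_mono_less_eq)

lemma tau_pos: "1 \<le> j \<Longrightarrow> \<tau> j > 0"
  using t_less[of "j - 1" j] by (simp add: \<tau>_def)

lemma tau_le: "1 \<le> j \<Longrightarrow> \<tau> j \<le> \<tau> (Suc j)"
  using step_mono[of j] by (simp add: \<tau>_def)

lemma ts_eq: "ts - t (m - 1) = (1 - \<alpha> / 2) * \<tau> m"
  by (simp add: ts_def tstar_def \<tau>_def algebra_simps)

lemma ts_bounds: "t (m - 1) < ts" "ts < t m"
proof -
  have "0 < (1 - \<alpha> / 2) * \<tau> m"
    using alpha tau_pos[OF m] by (intro mult_pos_pos) auto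
  then show "t (m - 1) < ts" using ts_eq by linarith
  show "ts < t m"
    using alpha tau_pos[OF m] by (simp add: ts_def tstar_def \<tau>_def)
qed

lemma t_less_ts: "j < m \<Longrightarrow> t j < ts"
  by (rule order.strict_trans1[OF t_le ts_bounds(1)]) simp

lemma hi_bounds: "j \<le> m \<Longrightarrow> 1 \<le> j \<Longrightarrow> t (j - 1) < hi j" "j \<le> m \<Longrightarrow> hi j \<le> ts" "j \<le> m \<Longrightarrow> hi j \<le> t j"
proof -
  show "t (j - 1) < hi j" if "j \<le> m" "1 \<le> j"
    using that t_less[of "j - 1" j] t_less_ts[of "j - 1"] by (auto simp: hi_def)
  show "hi j \<le> ts" if "j \<le> m" using t_less_ts[of j] by (auto simp: hi_def)
  show "hi j \<le> t j" if "j \<le> m" using ts_bounds that by (auto simp: hi_def not_less)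
qed

lemma kappa_pos: "s < ts \<Longrightarrow> \<kappa> s > 0"
  by (simp add: \<kappa>_def)

lemma kappa_mono: "s \<le> s' \<Longrightarrow> s' < ts \<Longrightarrow> \<kappa> s \<le> \<kappa> s'"
  unfolding \<kappa>_def using alpha by (intro powr_mono2') auto

lemma kappa_continuous: "b < ts \<Longrightarrow> continuous_on {a..b} \<kappa>"
  unfolding \<kappa>_def by (intro continuous_intros) auto

lemma kappa_deriv: "s < ts \<Longrightarrow> (\<kappa> has_real_derivative \<alpha> * (ts - s) powr (-\<alpha> - 1)) (at s)"
  unfolding \<kappa>_def by (auto intro!: derivative_eq_intros)

lemma kappa_diff:
  assumes "a \<le> b" "b < ts"
  shows "\<alpha> * (ts - a) powr (-\<alpha> - 1) * (b - a) \<le> \<kappa> b - \<kappa> a"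
    and "\<kappa> b - \<kappa> a \<le> \<alpha> * (ts - b) powr (-\<alpha> - 1) * (b - a)"
proof -
  have "\<alpha> * (ts - a) powr (-\<alpha> - 1) * (b - a) \<le> \<kappa> b - \<kappa> a \<and>
      \<kappa> b - \<kappa> a \<le> \<alpha> * (ts - b) powr (-\<alpha> - 1) * (b - a)"
  proof (cases "a = b")
    case False
    then obtain z where z: "a < z" "z < b" "\<kappa> b - \<kappa> a = (b - a) * (\<alpha> * (ts - z) powr (-\<alpha> - 1))"
      using MVT2[of a b \<kappa> "\<lambda>s. \<alpha> * (ts - s) powr (-\<alpha> - 1)"] assms kappa_deriv by force
    have "(ts - a) powr (-\<alpha> - 1) \<le> (ts - z) powr (-\<alpha> - 1)"
      "(ts - z) powr (-\<alpha> - 1) \<le> (ts - b) powr (-\<alpha> - 1)"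
      using z assms alpha by (auto intro!: powr_mono2')
    then show ?thesis
      using assms alpha by (auto simp: z(3) mult.commute intro!: mult_left_mono)
  qed auto
  then show "\<alpha> * (ts - a) powr (-\<alpha> - 1) * (b - a) \<le> \<kappa> b - \<kappa> a"
    "\<kappa> b - \<kappa> a \<le> \<alpha> * (ts - b) powr (-\<alpha> - 1) * (b - a)" by auto
qed

lemma kappa_integral:
  assumes "a \<le> b" "b \<le> ts"
  shows "(\<kappa> has_integral ((ts - a) powr (1 - \<alpha>) - (ts - b) powr (1 - \<alpha>)) / (1 - \<alpha>)) {a..b}"
  unfolding \<kappa>_def using has_integral_kernel[of \<alpha> a b ts] assms alpha by simp

lemma aa_integral: "1 \<le> j \<Longrightarrow> j \<le> m \<Longrightarrow> (\<kappa> has_integral aa j) {t (j - 1)..hi j}"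
  unfolding aa_def using kappa_integral hi_bounds[of j] by (meson integrable_integral less_imp_le integrable_on_def)

lemma q_continuous: "continuous_on S (q j)"
  unfolding q_def by (cases "j < m") (auto intro!: continuous_intros simp: t_less less_imp_neq[THEN not_sym])

lemma bb_integral:
  assumes "1 \<le> j" "j \<le> m"
  shows "((\<lambda>s. \<kappa> s * q j s) has_integral bb j) {t (j - 1)..hi j}"
proof (cases "j < m")
  case True
  then have "(\<lambda>s. \<kappa> s * q j s) integrable_on {t (j - 1)..hi j}"
    by (intro integrable_continuous_real continuous_intros kappa_continuous q_continuous)
       (simp add: hi_def t_less_ts)
  then show ?thesis using assms by (simp add: bb_def integrable_integral)
next
  case False
  then show ?thesis using assms by (simp add: bb_def q_def)
qed

text \<open>\<open>q j\<close> is the derivative of a quadratic bubble that vanishes at both ends of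
  the step. Therefore any constant may be subtracted from the kernel inside \<open>bb j\<close>, and
  the next bounds differ in the constant they subtract.\<close>

lemma q_integral:
  assumes "1 \<le> j" "j < m"
  shows "(q j has_integral 0) {t (j - 1)..t j}"
proof -
  define d where "d = 1 / (t (j + 1) - t (j - 1))"
  have q: "q j s = d * (2 * s - t (j - 1) - t j)" for s using assms by (simp add: q_def d_def)
  let ?F = "\<lambda>s. d * ((s - t (j - 1)) * (s - t j))"
  have "(q j has_integral ?F (t j) - ?F (t (j - 1))) {t (j - 1)..t j}"
  proof (rule fundamental_theorem_of_calculus)
    show "t (j - 1) \<le> t j" by (simp add: t_le)
    show "(?F has_vector_derivative q j s) (at s within {t (j - 1)..t j})" for s
      unfolding has_real_derivative_iff_has_vector_derivative[symmetric] q
      by (auto intro!: derivative_eq_intros simp: algebra_simps)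
  qed
  then show ?thesis by simp
qed

lemma q_bound:
  assumes "1 \<le> j" "j < m" "s \<in> {t (j - 1)..t j}"
  shows "\<bar>q j s\<bar> \<le> 1 / 2"
proof -
  have "t (j + 1) - t (j - 1) = \<tau> j + \<tau> (Suc j)" by (simp add: \<tau>_def)
  moreover have "\<bar>2 * s - t (j - 1) - t j\<bar> \<le> \<tau> j" using assms(3) by (auto simp: \<tau>_def)
  ultimately show ?thesis
    using tau_pos[OF assms(1)] tau_le[OF assms(1)] assms(2)
    by (simp add: q_def abs_divide field_simps)
qed

lemma bb_eq:
  assumes "1 \<le> j" "j < m"
  shows "((\<lambda>s. (\<kappa> s - c) * q j s) has_integral bb j) {t (j - 1)..t j}"
  using has_integral_diff[OF _ has_integral_mult_right[OF q_integral[OF assms], of c]] bb_integral[of j] assms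
  by (fastforce simp: hi_def left_diff_distrib)

text \<open>\<open>q j\<close> changes sign at the midpoint of the step, and so does the increasing
  kernel minus its midpoint value.\<close>

lemma bb_nonneg:
  assumes "1 \<le> j" "j < m"
  shows "0 \<le> bb j"
proof (rule has_integral_nonneg[OF bb_eq[OF assms, of "\<kappa> ((t (j - 1) + t j) / 2)"]])
  fix s assume s: "s \<in> {t (j - 1)..t j}"
  let ?c = "(t (j - 1) + t j) / 2"
  have c: "?c < ts" "s < ts"
    using s t_less_ts[of j] t_less[of "j-1" j] assms by (auto simp: field_simps)
  have d: "t (j + 1) - t (j - 1) > 0" using t_less[of "j-1" "j+1"] by simp
  show "0 \<le> (\<kappa> s - \<kappa> ?c) * q j s"
  proof (cases "s \<le> ?c")
    case True
    then show ?thesis using kappa_mono[of s ?c] c d assms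
      by (intro mult_nonpos_nonpos) (auto simp: q_def field_simps)
  next
    case False
    then show ?thesis using kappa_mono[of ?c s] c d assms
      by (intro mult_nonneg_nonneg) (auto simp: q_def field_simps)
  qed
qed

text \<open>Subtracting the kernel value at the left end makes the first factor nonnegative, and
  \<open>q j\<close> is at most 1/2. Combined with \<open>bb_nonneg\<close> this also yields
  \<open>\<tau> j * \<kappa> (t (j - 1)) \<le> aa j\<close>, which \<open>g_lower\<close> uses
  implicitly.\<close>

lemma bb_le_aa:
  assumes "1 \<le> j" "j < m"
  shows "bb j \<le> (aa j - \<tau> j * \<kappa> (t (j - 1))) / 2"
proof -
  have "((\<lambda>s. (\<kappa> s - \<kappa> (t (j - 1))) * (1 / 2)) has_integral (aa j - \<tau> j * \<kappa> (t (j - 1))) * (1 / 2)) {t (j - 1)..t j}"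
    using aa_integral[of j] has_integral_const_real[of "\<kappa> (t (j - 1))" "t (j - 1)" "t j"] assms t_le[of "j-1" j]
    by (intro has_integral_mult_left has_integral_diff) (auto simp: hi_def \<tau>_def)
  from bb_eq[OF assms, of "\<kappa> (t (j - 1))"] this
  have "bb j \<le> (aa j - \<tau> j * \<kappa> (t (j - 1))) * (1 / 2)"
  proof (rule has_integral_le)
    fix s assume s: "s \<in> {t (j - 1)..t j}"
    have "\<kappa> (t (j - 1)) \<le> \<kappa> s" using s t_less_ts[of j] assms by (intro kappa_mono) auto
    moreover have "q j s \<le> 1 / 2" using q_bound[OF assms s] by simp
    ultimately show "(\<kappa> s - \<kappa> (t (j - 1))) * q j s \<le> (\<kappa> s - \<kappa> (t (j - 1))) * (1 / 2)"
      by (intro mult_left_mono) auto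
  qed
  then show ?thesis by simp
qed

lemma bb_le_deriv:
  assumes "1 \<le> j" "j < m"
  shows "bb j \<le> \<alpha> * (ts - t j) powr (-\<alpha> - 1) * (\<tau> j)\<^sup>2 / 2"
proof -
  let ?D = "\<alpha> * (ts - t j) powr (-\<alpha> - 1)"
  have "norm (bb j) \<le> ?D * \<tau> j * (1/2) * measure lborel (cbox (t (j - 1)) (t j))"
  proof (rule has_integral_bound)
    show "0 \<le> ?D * \<tau> j * (1/2)" using alpha tau_pos[OF assms(1)] by simp
    show "((\<lambda>s. (\<kappa> s - \<kappa> (t (j - 1))) * q j s) has_integral bb j) (cbox (t (j - 1)) (t j))"
      using bb_eq[OF assms] by simp
    fix s assume "s \<in> cbox (t (j - 1)) (t j)"
    then have s: "t (j - 1) \<le> s" "s \<le> t j" by auto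
    have ts: "t j < ts" using assms t_less_ts by blast
    have "\<kappa> s - \<kappa> (t (j - 1)) \<le> \<alpha> * (ts - s) powr (-\<alpha> - 1) * (s - t (j - 1))"
      using kappa_diff(2)[of "t (j - 1)" s] s ts by simp
    also have "\<dots> \<le> ?D * \<tau> j"
      using s ts alpha by (intro mult_mono mult_left_mono powr_mono2') (auto simp: \<tau>_def)
    finally have "\<bar>\<kappa> s - \<kappa> (t (j - 1))\<bar> \<le> ?D * \<tau> j"
      using kappa_mono[of "t (j - 1)" s] s ts by simp
    then show "norm ((\<kappa> s - \<kappa> (t (j - 1))) * q j s) \<le> ?D * \<tau> j * (1/2)"
      unfolding real_norm_def abs_mult using q_bound[OF assms] s by (intro mult_mono) auto
  qed
  then show ?thesis using t_le[of "j-1" j] by (simp add: \<tau>_def power2_eq_square)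
qed

text \<open>The weight \<open>g (Suc j)\<close> receives \<open>bb j\<close> from the step before,
  which could lift it above the kernel value at the right end. Convexity prevents this: the gap
  between that value and the kernel integrates over step \<open>Suc j\<close> to at least half the
  kernel slope at \<open>t j\<close> times the squared step, and \<open>bb j\<close> is at most the
  same expression with the shorter step \<open>j\<close>.\<close>

lemma bb_le_next:
  assumes "1 \<le> j" "Suc j < m"
  shows "bb j \<le> \<tau> (Suc j) * \<kappa> (t (Suc j)) - aa (Suc j)"
proof -
  define D where "D = \<alpha> * (ts - t j) powr (-\<alpha> - 1)"
  have ts: "t (Suc j) < ts" and tj: "t j < t (Suc j)" using assms t_less_ts t_less by auto
  have "((\<lambda>s. D * (t (Suc j) - s)) has_integral
      (- D / 2) * (t (Suc j) - t (Suc j))\<^sup>2 - (- D / 2) * (t (Suc j) - t j)\<^sup>2) {t j..t (Suc j)}"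
  proof (rule fundamental_theorem_of_calculus)
    show "t j \<le> t (Suc j)" using tj by simp
    show "((\<lambda>s. (- D / 2) * (t (Suc j) - s)\<^sup>2) has_vector_derivative D * (t (Suc j) - s))
        (at s within {t j..t (Suc j)})" for s
      unfolding has_real_derivative_iff_has_vector_derivative[symmetric]
      by (auto intro!: derivative_eq_intros simp: field_simps)
  qed
  then have "((\<lambda>s. D * (t (Suc j) - s)) has_integral D * (\<tau> (Suc j))\<^sup>2 / 2) {t j..t (Suc j)}"
    by (simp add: \<tau>_def)
  moreover have "((\<lambda>s. \<kappa> (t (Suc j)) - \<kappa> s) has_integral \<tau> (Suc j) * \<kappa> (t (Suc j)) - aa (Suc j)) {t j..t (Suc j)}"
    using aa_integral[of "Suc j"] has_integral_const_real[of "\<kappa> (t (Suc j))" "t j" "t (Suc j)"] assms tj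
    by (intro has_integral_diff) (auto simp: hi_def \<tau>_def)
  ultimately have "D * (\<tau> (Suc j))\<^sup>2 / 2 \<le> \<tau> (Suc j) * \<kappa> (t (Suc j)) - aa (Suc j)"
  proof (rule has_integral_le)
    fix s assume s: "s \<in> {t j..t (Suc j)}"
    have "D * (t (Suc j) - s) \<le> \<alpha> * (ts - s) powr (-\<alpha> - 1) * (t (Suc j) - s)"
    proof (cases "s = t (Suc j)")
      case False
      then show ?thesis
        using s ts alpha unfolding D_def by (intro mult_right_mono mult_left_mono powr_mono2') auto
    qed simp
    also have "\<dots> \<le> \<kappa> (t (Suc j)) - \<kappa> s"
      using kappa_diff(1)[of s "t (Suc j)"] s ts by simp
    finally show "D * (t (Suc j) - s) \<le> \<kappa> (t (Suc j)) - \<kappa> s" .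
  qed
  moreover have "D * (\<tau> j)\<^sup>2 / 2 \<le> D * (\<tau> (Suc j))\<^sup>2 / 2"
    using tau_pos[OF assms(1)] tau_le[OF assms(1)] alpha
    unfolding D_def by (intro divide_right_mono mult_left_mono power_mono) auto
  ultimately show ?thesis using bb_le_deriv[of j] assms by (simp add: D_def)
qed

lemma g_lower:
  assumes "1 \<le> j" "j < m"
  shows "\<kappa> (t (j - 1)) \<le> g j"
proof -
  have "0 \<le> bb (j - 1)"
    using bb_nonneg[of "j - 1"] assms by (cases "j = 1") (auto simp: bb_def)
  moreover have "0 \<le> bb j" using bb_nonneg assms by blast
  ultimately have "\<tau> j * \<kappa> (t (j - 1)) \<le> aa j - bb j + bb (j - 1)"
    using bb_le_aa[OF assms] by simp
  then show ?thesis
    using tau_pos[OF assms(1)] by (simp add: g_def field_simps)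
qed

lemma g_upper:
  assumes "1 \<le> j" "j < m"
  shows "g j \<le> \<kappa> (t j)"
proof -
  have "aa j - bb j + bb (j - 1) \<le> \<tau> j * \<kappa> (t j)"
  proof (cases "j = 1")
    case True
    have "(\<kappa> has_integral aa j) {t (j - 1)..t j}"
      using aa_integral[of j] assms by (simp add: hi_def)
    moreover have "((\<lambda>_. \<kappa> (t j)) has_integral \<tau> j * \<kappa> (t j)) {t (j - 1)..t j}"
      using has_integral_const_real[of "\<kappa> (t j)" "t (j - 1)" "t j"] t_le[of "j-1" j]
      by (simp add: \<tau>_def)
    ultimately have "aa j \<le> \<tau> j * \<kappa> (t j)"
    proof (rule has_integral_le)
      show "\<kappa> s \<le> \<kappa> (t j)" if "s \<in> {t (j - 1)..t j}" for s
        using that t_less_ts[of j] assms by (intro kappa_mono) auto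
    qed
    then show ?thesis using bb_nonneg[OF assms] True by (simp add: bb_def)
  next
    case False
    then have "1 \<le> j - 1" "Suc (j - 1) = j" using assms by auto
    then show ?thesis using bb_le_next[of "j - 1"] bb_nonneg[OF assms] assms by simp
  qed
  then show ?thesis
    using tau_pos[OF assms(1)] by (simp add: g_def field_simps)
qed

text \<open>The last kernel integral is explicit, and \<open>ts - t (m - 1)\<close> is 1 - \<alpha>
  / 2 times the last step. Set against \<open>g j \<le> \<kappa> (t j)\<close> one step earlier,
  this is precisely the gain that \<open>g_ratio\<close> requires.\<close>

lemma g_last: "(1 - \<alpha> / 2) * \<kappa> (t (m - 1)) \<le> (1 - \<alpha>) * g m"
proof -
  have "aa m = (ts - t (m - 1)) powr (1 - \<alpha>) / (1 - \<alpha>)"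
    using kappa_integral[of "t (m - 1)" ts] ts_bounds alpha
    by (simp add: aa_def hi_def integral_unique)
  also have "(ts - t (m - 1)) powr (1 - \<alpha>) = (ts - t (m - 1)) * \<kappa> (t (m - 1))"
    using ts_bounds powr_add[of "ts - t (m - 1)" 1 "-\<alpha>"] by (simp add: \<kappa>_def)
  finally have "(1 - \<alpha>) * aa m = (ts - t (m - 1)) * \<kappa> (t (m - 1))"
    using alpha by (simp del: One_nat_def)
  then have "(1 - \<alpha>) * aa m = (1 - \<alpha> / 2) * \<tau> m * \<kappa> (t (m - 1))"
    by (simp only: ts_eq)
  moreover have "bb m = 0" by (simp add: bb_def q_def)
  moreover have "0 \<le> bb (m - 1)"
  proof (cases "m - 1 = 0")
    case True
    show ?thesis unfolding True by (simp add: bb_def)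
  next
    case False
    then show ?thesis by (intro bb_nonneg) auto
  qed
  then have "0 \<le> (1 - \<alpha>) * bb (m - 1)" using alpha by (intro mult_nonneg_nonneg) auto
  ultimately have "(1 - \<alpha> / 2) * \<kappa> (t (m - 1)) * \<tau> m \<le> (1 - \<alpha>) * (aa m - bb m + bb (m - 1))"
    by (simp add: algebra_simps)
  then show ?thesis
    using tau_pos[OF m] by (simp add: g_def field_simps)
qed

lemma g_pos:
  assumes "1 \<le> j" "j \<le> m"
  shows "0 < g j"
proof (cases "j < m")
  case True
  then show ?thesis using g_lower[of j] kappa_pos[of "t (j - 1)"] t_less_ts[of "j - 1"] assms by simp
next
  case False
  have "0 < (1 - \<alpha> / 2) * \<kappa> (t (m - 1))" using kappa_pos[OF ts_bounds(1)] alpha by simp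
  with g_last have "0 < (1 - \<alpha>) * g m" by linarith
  then show ?thesis using alpha False assms by (simp add: zero_less_mult_iff)
qed

lemma g_first: "\<kappa> 0 \<le> g 1"
proof (cases "1 < m")
  case True
  then show ?thesis using g_lower[of 1] by (simp add: t0)
next
  case False
  then have m1: "m = 1" using m by simp
  have "(1 - \<alpha>) * \<kappa> 0 \<le> (1 - \<alpha> / 2) * \<kappa> 0"
    using kappa_pos[of 0] ts_bounds(1) alpha by (intro mult_right_mono) (auto simp: m1 t0)
  also have "\<dots> \<le> (1 - \<alpha>) * g 1" using g_last by (simp add: m1 t0)
  finally show ?thesis using alpha by simp
qed

lemma g_mono:
  assumes "1 \<le> j" "j < m"
  shows "g j \<le> g (Suc j)"
proof (cases "Suc j < m")
  case True
  then show ?thesis using g_upper[of j] g_lower[of "Suc j"] assms by simp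
next
  case False
  then have j: "m = Suc j" using assms by simp
  have "(1 - \<alpha>) * \<kappa> (t j) \<le> (1 - \<alpha> / 2) * \<kappa> (t j)"
    using kappa_pos[of "t j"] t_less_ts[of j] alpha assms by (intro mult_right_mono) auto
  also have "\<dots> \<le> (1 - \<alpha>) * g m" using g_last by (simp add: j)
  finally have "(1 - \<alpha>) * \<kappa> (t j) \<le> (1 - \<alpha>) * g m" .
  then show ?thesis using g_upper[OF assms] alpha j by simp
qed

text \<open>The inequality that makes the choice of the point \<open>tstar\<close> compatible with an energy argument.\<close>

lemma g_ratio:
  assumes "1 \<le> j" "j < m" "m = Suc j"
  shows "\<alpha> / 2 * g m \<le> (1 - \<alpha> / 2) * (g m - g j)"
proof -
  have "(1 - \<alpha> / 2) * g j \<le> (1 - \<alpha> / 2) * \<kappa> (t j)"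
    using g_upper[OF assms(1,2)] alpha by (intro mult_left_mono) auto
  then show ?thesis using g_last assms(3) by (simp add: algebra_simps)
qed

end

section \<open>Newton form of the interpolants; the discrete operator as a weighted sum of
  increments\<close>

lemma vector_derivative_quadratic:
  fixes A B C :: "'b::real_normed_vector"
  shows "((\<lambda>s. A + (s - a) *\<^sub>R B + ((s - a) * (s - b)) *\<^sub>R C) has_vector_derivative
    B + (2 * s - a - b) *\<^sub>R C) (at s)"
  by (auto intro!: derivative_eq_intros simp: has_vector_derivative_def algebra_simps)

lemma lagrange_two:
  assumes "i \<noteq> j"
  shows "lagrange t {i, j} U s = ((s - t j) / (t i - t j)) *\<^sub>R U i + ((s - t i) / (t j - t i)) *\<^sub>R U j"
proof -
  have "{i, j} - {i} = {j}" "{i, j} - {j} = {i}" using assms by auto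
  then show ?thesis using assms by (simp add: lagrange_def)
qed

lemma lagrange_three:
  assumes "i \<noteq> j" "j \<noteq> k" "i \<noteq> k"
  shows "lagrange t {i, j, k} U s =
      ((s - t j) / (t i - t j) * ((s - t k) / (t i - t k))) *\<^sub>R U i
      + ((s - t i) / (t j - t i) * ((s - t k) / (t j - t k))) *\<^sub>R U j
      + ((s - t i) / (t k - t i) * ((s - t j) / (t k - t j))) *\<^sub>R U k"
proof -
  have "{i, j, k} - {i} = {j, k}" "{i, j, k} - {j} = {i, k}" "{i, j, k} - {k} = {i, j}"
    using assms by auto
  then show ?thesis using assms by (simp add: lagrange_def)
qed

text \<open>Newton form: the linear interpolant plus a second divided difference. It exposes the
  increments \<open>U j - U (j - 1)\<close>, on which the weights \<open>g\<close> act.\<close>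

lemma lagrange_quadratic:
  fixes U :: "nat \<Rightarrow> 'b::real_vector"
  assumes "1 \<le> j" and t: "t (j - 1) < t j" "t j < t (j + 1)"
  shows "lagrange t {j - 1, j, j + 1} U s = U (j - 1)
    + ((s - t (j - 1)) / (t j - t (j - 1))) *\<^sub>R (U j - U (j - 1))
    + ((s - t (j - 1)) * (s - t j) / (t (j + 1) - t (j - 1))) *\<^sub>R
        ((1 / (t (j + 1) - t j)) *\<^sub>R (U (j + 1) - U j) - (1 / (t j - t (j - 1))) *\<^sub>R (U j - U (j - 1)))"
proof -
  obtain a b c where abc: "a = t (j - 1)" "b = t j" "c = t (j + 1)" by blast
  then have ne: "b - a \<noteq> 0" "c - b \<noteq> 0" "c - a \<noteq> 0" "a - b \<noteq> 0" "b - c \<noteq> 0" "a - c \<noteq> 0" using t by auto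
  define X where "X = (s - a) * (s - b) / (c - a)"
  define Y where "Y = (s - a) / (b - a)"
  define p where "p = 1 / (b - a)"
  define p' where "p' = 1 / (c - b)"
  have "lagrange t {j - 1, j, j + 1} U s =
      ((s - b) / (a - b) * ((s - c) / (a - c))) *\<^sub>R U (j - 1)
      + ((s - a) / (b - a) * ((s - c) / (b - c))) *\<^sub>R U j
      + ((s - a) / (c - a) * ((s - b) / (c - b))) *\<^sub>R U (j + 1)"
    unfolding abc using assms(1) by (intro lagrange_three) auto
  also have "(s - b) / (a - b) * ((s - c) / (a - c)) =
      1 - (s - a) / (b - a) + (s - a) * (s - b) / (c - a) * (1 / (b - a))"
    using ne by (simp add: divide_simps) (simp add: algebra_simps)
  also have "(s - a) / (b - a) * ((s - c) / (b - c)) =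
      (s - a) / (b - a) - (s - a) * (s - b) / (c - a) * (1 / (c - b) + 1 / (b - a))"
    using ne by (simp add: divide_simps) (simp add: algebra_simps)
  also have "(s - a) / (c - a) * ((s - b) / (c - b)) = (s - a) * (s - b) / (c - a) * (1 / (c - b))"
    by simp
  finally show ?thesis
    unfolding abc(1,2,3)[symmetric] X_def[symmetric] Y_def[symmetric] p_def[symmetric] p'_def[symmetric]
    by (simp add: algebra_simps)
qed

lemma lagrange_linear:
  fixes U :: "nat \<Rightarrow> 'b::real_vector"
  assumes "1 \<le> j" and t: "t (j - 1) < t j"
  shows "lagrange t {j - 1, j} U s = U (j - 1)
    + ((s - t (j - 1)) / (t j - t (j - 1))) *\<^sub>R (U j - U (j - 1))"
proof -
  have "lagrange t {j - 1, j} U s = ((s - t j) / (t (j - 1) - t j)) *\<^sub>R U (j - 1)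
      + ((s - t (j - 1)) / (t j - t (j - 1))) *\<^sub>R U j"
    using assms(1) by (intro lagrange_two) auto
  also have "(s - t j) / (t (j - 1) - t j) = 1 - (s - t (j - 1)) / (t j - t (j - 1))"
    using t by (simp add: field_simps)
  finally show ?thesis by (simp add: algebra_simps)
qed

context alikhanov_mesh
begin

lemma interp_eq:
  assumes "1 \<le> k" "k < m" "s \<in> {t (k - 1)<..t k}"
  shows "alikhanov_interp t m U s = lagrange t {k - 1, k, k + 1} U s"
proof -
  have "(LEAST j. 1 \<le> j \<and> s \<le> t j) = k"
  proof (rule Least_equality)
    show "1 \<le> k \<and> s \<le> t k" using assms by auto
    fix j assume "1 \<le> j \<and> s \<le> t j"
    then show "k \<le> j" using assms t_le[of j "k - 1"] by (force simp: not_le[symmetric])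
  qed
  moreover have "t k \<le> t (m - 1)" using assms by (intro t_le) auto
  then have "s \<le> t (m - 1)" using assms(3) by auto
  ultimately show ?thesis by (simp add: alikhanov_interp_def)
qed

lemma interp_has_vector_derivative:
  fixes U :: "nat \<Rightarrow> 'b::real_normed_vector"
  assumes "1 \<le> k" "k \<le> m" "s \<in> {t (k - 1)<..<hi k}"
  shows "(alikhanov_interp t m U has_vector_derivative
    ((1 - q k s) / \<tau> k) *\<^sub>R (U k - U (k - 1)) + (q k s / \<tau> (Suc k)) *\<^sub>R (U (Suc k) - U k)) (at s)"
proof (cases "k < m")
  case True
  define D1 where "D1 = (1 / \<tau> k) *\<^sub>R (U k - U (k - 1))"
  define D2 where "D2 = (1 / \<tau> (Suc k)) *\<^sub>R (U (Suc k) - U k)"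
  define c where "c = 1 / (t (k + 1) - t (k - 1))"
  have q: "q k s = (2 * s - t (k - 1) - t k) * c" using True by (simp add: q_def c_def)
  have "((\<lambda>s. U (k - 1) + (s - t (k - 1)) *\<^sub>R D1 + ((s - t (k - 1)) * (s - t k)) *\<^sub>R (c *\<^sub>R (D2 - D1)))
      has_vector_derivative D1 + (2 * s - t (k - 1) - t k) *\<^sub>R (c *\<^sub>R (D2 - D1))) (at s)"
    by (rule vector_derivative_quadratic)
  then have "(alikhanov_interp t m U has_vector_derivative
      D1 + (2 * s - t (k - 1) - t k) *\<^sub>R (c *\<^sub>R (D2 - D1))) (at s)"
  proof (rule has_vector_derivative_transform_within_open)
    show "open {t (k - 1)<..<t k}" by simp
    show "s \<in> {t (k - 1)<..<t k}" using assms True by (simp add: hi_def)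
    fix y assume "y \<in> {t (k - 1)<..<t k}"
    then have "alikhanov_interp t m U y = lagrange t {k - 1, k, k + 1} U y"
      using assms(1) True by (intro interp_eq) auto
    then show "U (k - 1) + (y - t (k - 1)) *\<^sub>R D1 + ((y - t (k - 1)) * (y - t k)) *\<^sub>R (c *\<^sub>R (D2 - D1))
        = alikhanov_interp t m U y"
      unfolding D1_def D2_def c_def \<tau>_def
      by (subst (asm) lagrange_quadratic) (use assms(1) t_less in auto)
  qed
  moreover have "D1 + (2 * s - t (k - 1) - t k) *\<^sub>R (c *\<^sub>R (D2 - D1)) = (1 - q k s) *\<^sub>R D1 + q k s *\<^sub>R D2"
    unfolding q by (simp add: algebra_simps)
  ultimately show ?thesis by (simp add: D1_def D2_def)
next
  case False
  then have k: "k = m" using assms by simp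
  have "((\<lambda>s. U (m - 1) + (s - t (m - 1)) *\<^sub>R ((1 / \<tau> m) *\<^sub>R (U m - U (m - 1)))
      + ((s - t (m - 1)) * (s - t m)) *\<^sub>R 0)
      has_vector_derivative (1 / \<tau> m) *\<^sub>R (U m - U (m - 1)) + (2 * s - t (m - 1) - t m) *\<^sub>R 0) (at s)"
    by (rule vector_derivative_quadratic)
  then have "(alikhanov_interp t m U has_vector_derivative
      (1 / \<tau> m) *\<^sub>R (U m - U (m - 1)) + (2 * s - t (m - 1) - t m) *\<^sub>R 0) (at s)"
  proof (rule has_vector_derivative_transform_within_open)
    show "open {t (m - 1)<..}" by simp
    show "s \<in> {t (m - 1)<..}" using assms k by auto
    fix y assume "y \<in> {t (m - 1)<..}"
    then have "alikhanov_interp t m U y = lagrange t {m - 1, m} U y"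
      by (simp add: alikhanov_interp_def)
    then show "U (m - 1) + (y - t (m - 1)) *\<^sub>R ((1 / \<tau> m) *\<^sub>R (U m - U (m - 1)))
      + ((y - t (m - 1)) * (y - t m)) *\<^sub>R 0 = alikhanov_interp t m U y"
      unfolding \<tau>_def by (subst (asm) lagrange_linear) (use m t_less in auto)
  qed
  then show ?thesis using k by (simp add: q_def)
qed

text \<open>\<open>W j s\<close> is the factor of \<open>U j - U (j - 1)\<close> in the derivative
  of the interpolant at \<open>s\<close>: step \<open>j\<close> contributes its own difference
  quotient, step \<open>j - 1\<close> that of its right neighbour. The guard
  \<open>2 \<le> j\<close> keeps the truncated index \<open>j - 1 - 1\<close> from being read at
  \<open>j = 1\<close>. The closed ranges overlap at mesh points, so \<open>W_sum\<close> speaks of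
  the interiors only.\<close>

definition W where
  "W j s = (if s \<in> {t (j - 1)..hi j} then (1 - q j s) / \<tau> j else 0)
     + (if 2 \<le> j \<and> s \<in> {t (j - 1 - 1)..hi (j - 1)} then q (j - 1) s / \<tau> j else 0)"

lemma W_sum:
  fixes V :: "nat \<Rightarrow> 'b::real_vector"
  assumes "1 \<le> k" "k \<le> m" "s \<in> {t (k - 1)<..<hi k}"
  shows "(\<Sum>j=1..m. W j s *\<^sub>R V j) = ((1 - q k s) / \<tau> k) *\<^sub>R V k + (q k s / \<tau> (Suc k)) *\<^sub>R V (Suc k)"
proof -
  have mem: "s \<in> {t (i - 1)..hi i} \<longleftrightarrow> i = k" if "1 \<le> i" "i \<le> m" for i
  proof (cases i k rule: linorder_cases)
    case less
    then have "t i \<le> t (k - 1)" by (intro t_le) auto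
    then have "hi i \<le> t (k - 1)"
      using that hi_bounds(3)[of i] by simp
    then show ?thesis using less assms by auto
  next
    case greater
    then have "t k \<le> t (i - 1)" by (intro t_le) auto
    then have "hi k \<le> t (i - 1)"
      using assms(2) hi_bounds(3)[of k] by simp
    then show ?thesis using greater assms by auto
  next
    case equal
    then show ?thesis using assms by auto
  qed
  have "W j s *\<^sub>R V j = (if j = k then ((1 - q k s) / \<tau> k) *\<^sub>R V k else 0)
      + (if j = Suc k then (q k s / \<tau> (Suc k)) *\<^sub>R V (Suc k) else 0)" if "j \<in> {1..m}" for j
  proof -
    have "s \<in> {t (j - 1 - 1)..hi (j - 1)} \<longleftrightarrow> j - 1 = k" if "2 \<le> j"
      using mem[of "j - 1"] that \<open>j \<in> {1..m}\<close> by auto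
    then show ?thesis
      using mem[of j] that assms(1) by (auto simp: W_def)
  qed
  then have "(\<Sum>j=1..m. W j s *\<^sub>R V j) = (\<Sum>j=1..m. if j = k then ((1 - q k s) / \<tau> k) *\<^sub>R V k else 0)
      + (\<Sum>j=1..m. if j = Suc k then (q k s / \<tau> (Suc k)) *\<^sub>R V (Suc k) else 0)"
    by (simp add: sum.distrib)
  then show ?thesis using assms by (auto simp: q_def)
qed

lemma W_integral:
  assumes "1 \<le> j" "j \<le> m"
  shows "((\<lambda>s. \<kappa> s * W j s) has_integral g j) {0..ts}"
proof -
  have sub: "{t (i - 1)..hi i} \<subseteq> {0..ts}" if "i \<le> m" for i
    using hi_bounds(2)[OF that] t_le[of 0 "i - 1"] t0 by auto
  have 1: "((\<lambda>s. if s \<in> {t (j - 1)..hi j} then \<kappa> s * ((1 - q j s) / \<tau> j) else 0)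
      has_integral (aa j - bb j) / \<tau> j) {0..ts}"
    unfolding has_integral_restrict[OF sub[OF assms(2)]]
    using has_integral_divide[OF has_integral_diff[OF aa_integral bb_integral], OF assms assms, of "\<tau> j"]
    by (simp add: algebra_simps)
  have 2: "((\<lambda>s. if 2 \<le> j \<and> s \<in> {t (j - 1 - 1)..hi (j - 1)} then \<kappa> s * (q (j - 1) s / \<tau> j) else 0)
      has_integral bb (j - 1) / \<tau> j) {0..ts}"
  proof (cases "2 \<le> j")
    case True
    then have j: "1 \<le> j - 1" "j - 1 \<le> m" using assms by auto
    have "((\<lambda>s. \<kappa> s * q (j - 1) s / \<tau> j) has_integral bb (j - 1) / \<tau> j) {t (j - 1 - 1)..hi (j - 1)}"
      by (rule has_integral_divide[OF bb_integral[OF j]])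
    then show ?thesis
      using True has_integral_restrict[OF sub[OF j(2)], of "\<lambda>s. \<kappa> s * (q (j - 1) s / \<tau> j)"] by simp
  next
    case False
    then have "j - 1 = 0" by simp
    then have "bb (j - 1) = 0" unfolding bb_def by simp
    then show ?thesis using False by simp
  qed
  have "(\<lambda>s. \<kappa> s * W j s) = (\<lambda>s. (if s \<in> {t (j - 1)..hi j} then \<kappa> s * ((1 - q j s) / \<tau> j) else 0)
     + (if 2 \<le> j \<and> s \<in> {t (j - 1 - 1)..hi (j - 1)} then \<kappa> s * (q (j - 1) s / \<tau> j) else 0))"
    by (auto simp: W_def fun_eq_iff distrib_left)
  then show ?thesis
    using has_integral_add[OF 1 2] by (simp add: g_def add_divide_distrib)
qed

lemma mesh_interval:
  assumes "s \<in> {0..ts}" "s \<notin> insert ts (t ` {..m})"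
  obtains k where "1 \<le> k" "k \<le> m" "s \<in> {t (k - 1)<..<hi k}"
proof -
  define k where "k = (LEAST k. s < t k)"
  have s: "0 < s" "s < ts" using assms t0 by (auto simp: order_le_less)
  then have "s < t m" using ts_bounds by simp
  then have k: "s < t k" "k \<le> m" unfolding k_def by (auto intro: LeastI Least_le)
  have "k \<noteq> 0" using k s t0 by (metis order_less_asym)
  then have "\<not> s < t (k - 1)" unfolding k_def by (metis diff_less not_less_Least zero_less_one neq0_conv)
  moreover have "s \<noteq> t (k - 1)" using assms k by auto
  ultimately have "t (k - 1) < s" by simp
  then show thesis
    using that[of k] k s \<open>k \<noteq> 0\<close> by (auto simp: hi_def)
qed

text \<open>Once the derivative is one finite sum over \<open>j\<close>, the integral is taken term
  by term. The mesh points and \<open>ts\<close>, where the pointwise formula may fail, form a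
  finite set that the integral ignores.\<close>

lemma interp_has_integral:
  fixes U :: "nat \<Rightarrow> 'b::real_normed_vector"
  shows "(caputo_integrand \<alpha> (alikhanov_interp t m U) ts has_integral
    (\<Sum>j=1..m. g j *\<^sub>R (U j - U (j - 1)))) {0..ts}"
proof (rule has_integral_spike_finite)
  show "finite (insert ts (t ` {..m}))" by simp
  show "((\<lambda>s. \<Sum>j=1..m. (\<kappa> s * W j s) *\<^sub>R (U j - U (j - 1))) has_integral
      (\<Sum>j=1..m. g j *\<^sub>R (U j - U (j - 1)))) {0..ts}"
    by (intro has_integral_sum has_integral_scaleR_left W_integral) auto
  fix s assume "s \<in> {0..ts} - insert ts (t ` {..m})"
  then obtain k where k: "1 \<le> k" "k \<le> m" "s \<in> {t (k - 1)<..<hi k}"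
    using mesh_interval[of s] by blast
  show "caputo_integrand \<alpha> (alikhanov_interp t m U) ts s = (\<Sum>j=1..m. (\<kappa> s * W j s) *\<^sub>R (U j - U (j - 1)))"
    unfolding caputo_integrand_def vector_derivative_at[OF interp_has_vector_derivative[OF k, of U]]
      scaleR_scaleR[symmetric] scaleR_sum_right[symmetric] W_sum[OF k, of "\<lambda>j. U j - U (j - 1)"]
    by (simp add: \<kappa>_def)
qed

lemma alikhanov_op_eq:
  fixes U :: "nat \<Rightarrow> 'b::real_normed_vector"
  shows "alikhanov_op \<alpha> t U m = (1 / Gamma (1 - \<alpha>)) *\<^sub>R (\<Sum>j=1..m. g j *\<^sub>R (U j - U (j - 1)))"
  unfolding alikhanov_op_def caputo_def ts_def[symmetric]
  using integral_unique[OF interp_has_integral[of U]] by simp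

end

section \<open>Truncation error\<close>

text \<open>Interpolation reproduces quadratics, so only the remainders at \<open>a\<close>,
  \<open>c\<close> and \<open>s\<close> survive; the one at \<open>b\<close> is zero. Their
  coefficients have modulus at most 1 because the second step is not shorter than the first, and the
  remainder at \<open>a\<close> enters twice, hence the factor 4. Apart from Taylor polynomials, the
  choice \<open>p = r = 0\<close> occurs later on the first step.\<close>

lemma quadratic_interpolation_remainder:
  fixes a b c s E :: real and f :: "real \<Rightarrow> real"
  assumes ab: "a < b" "b < c" and step: "b - a \<le> c - b" and s: "a \<le> s" "s \<le> b"
    and R: "\<And>x. x \<in> {a, s, c} \<Longrightarrow> \<bar>f x - f b - p * (x - b) - r * (x - b)\<^sup>2\<bar> \<le> E"
  shows "\<bar>f a + (s - a) * ((f b - f a) / (b - a))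
    + (s - a) * (s - b) / (c - a) * ((f c - f b) / (c - b) - (f b - f a) / (b - a)) - f s\<bar> \<le> 4 * E"
proof -
  define R where "R x = f x - f b - p * (x - b) - r * (x - b)\<^sup>2" for x
  define x where "x = b - a"
  define y where "y = c - b"
  define z where "z = s - b"
  have xy: "0 < x" "x \<le> y" "- x \<le> z" "z \<le> 0" using assms by (auto simp: x_def y_def z_def)
  then have ne: "x + y \<noteq> 0" by simp
  have fa: "f a = f b - p * x + r * x\<^sup>2 + R a" and fc: "f c = f b + p * y + r * y\<^sup>2 + R c"
    and fs: "f s = f b + p * z + r * z\<^sup>2 + R s"
    by (auto simp: R_def x_def y_def z_def power2_eq_square algebra_simps)
  have d1: "(f b - f a) / (b - a) = p - r * x - R a / x"
    using xy by (simp add: fa flip: x_def) (simp add: field_simps power2_eq_square)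
  have d2: "(f c - f b) / (c - b) = p + r * y + R c / y"
    using xy by (simp add: fc flip: y_def) (simp add: field_simps power2_eq_square)
  have "(s - a) * (s - b) / (c - a) * ((f c - f b) / (c - b) - (f b - f a) / (b - a))
      = (z + x) * z / (x + y) * (r * (x + y) + (R c / y + R a / x))"
    unfolding d1 d2 by (simp add: x_def y_def z_def algebra_simps)
  also have "\<dots> = (z + x) * z * r + (z + x) * z / (x + y) * (R c / y + R a / x)"
    using ne by (simp only: distrib_left[of _ "r * (x + y)"]) simp
  finally have "f a + (s - a) * ((f b - f a) / (b - a))
    + (s - a) * (s - b) / (c - a) * ((f c - f b) / (c - b) - (f b - f a) / (b - a)) - f s
    = R a + (z + x) * (p - r * x - R a / x) + ((z + x) * z * r + (z + x) * z / (x + y) * (R c / y + R a / x))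
      - p * x + r * x\<^sup>2 - p * z - r * z\<^sup>2 - R s"
    unfolding d1 fs by (simp add: fa z_def x_def)
  also have "(z + x) * (p - r * x - R a / x) = p * z - r * x * z - z / x * R a + p * x - r * x\<^sup>2 - R a"
    using xy by (simp add: add_divide_distrib algebra_simps power2_eq_square)
  also have "(z + x) * z / (x + y) * (R c / y + R a / x)
      = ((z + x) * z / ((x + y) * y)) * R c + ((z + x) * z / ((x + y) * x)) * R a"
    by (simp add: distrib_left)
  also have "R a + (p * z - r * x * z - z / x * R a + p * x - r * x\<^sup>2 - R a) + ((z + x) * z * r
      + (((z + x) * z / ((x + y) * y)) * R c + ((z + x) * z / ((x + y) * x)) * R a))
      - p * x + r * x\<^sup>2 - p * z - r * z\<^sup>2 - R s = - (z / x) * R a + ((z + x) * z / ((x + y) * y)) * R c + ((z + x) * z / ((x + y) * x)) * R a - R s"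
    by (simp add: algebra_simps power2_eq_square)
  finally have eq: "f a + (s - a) * ((f b - f a) / (b - a))
    + (s - a) * (s - b) / (c - a) * ((f c - f b) / (c - b) - (f b - f a) / (b - a)) - f s = \<dots>" .
  have E: "\<bar>R a\<bar> \<le> E" "\<bar>R c\<bar> \<le> E" "\<bar>R s\<bar> \<le> E" using R by (auto simp: R_def)
  have le1: "\<bar>w * v\<bar> \<le> E" if "\<bar>w\<bar> \<le> 1" "\<bar>v\<bar> \<le> E" for w v
    using mult_mono[OF that] by (simp add: abs_mult)
  have zz: "\<bar>(z + x) * z\<bar> \<le> x * x" unfolding abs_mult using xy by (intro mult_mono) auto
  have frac: "\<bar>w / v\<bar> \<le> 1" if "\<bar>w\<bar> \<le> v" "0 < v" for w v :: real
    using that by (simp add: abs_divide)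
  have "\<bar>- (z / x)\<bar> \<le> 1" using frac[of "- z" x] xy by simp
  moreover have "\<bar>(z + x) * z / ((x + y) * y)\<bar> \<le> 1"
  proof -
    have "x * x \<le> (x + y) * y" using xy by (intro mult_mono) auto
    from frac[OF order_trans[OF zz this]] xy show ?thesis by simp
  qed
  moreover have "\<bar>(z + x) * z / ((x + y) * x)\<bar> \<le> 1"
  proof -
    have "x * x \<le> (x + y) * x" using xy by (intro mult_mono) auto
    from frac[OF order_trans[OF zz this]] xy show ?thesis by simp
  qed
  moreover have "\<bar>a' + b' + c' - d'\<bar> \<le> 4 * E" if "\<bar>a'\<bar> \<le> E" "\<bar>b'\<bar> \<le> E" "\<bar>c'\<bar> \<le> E" "\<bar>d'\<bar> \<le> E" for a' b' c' d' :: real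
    using that by linarith
  ultimately show ?thesis
    unfolding eq using le1 E by presburger
qed

text \<open>Repeated use of the mean value bound, each integration adding a factor
  \<open>y - x\<close>. Derivatives are taken within the interval because its right end may be the
  final time, where only one-sided derivatives are available.\<close>

lemma third_order_taylor:
  fixes f :: "real \<Rightarrow> real"
  assumes d: "\<And>s. s \<in> {x..y} \<Longrightarrow> (f has_real_derivative f1 s) (at s within {x..y})"
      "\<And>s. s \<in> {x..y} \<Longrightarrow> (f1 has_real_derivative f2 s) (at s within {x..y})"
      "\<And>s. s \<in> {x..y} \<Longrightarrow> (f2 has_real_derivative f3 s) (at s within {x..y})"
    and B: "\<And>s. s \<in> {x..y} \<Longrightarrow> \<bar>f3 s\<bar> \<le> B" and cs: "c \<in> {x..y}" "s \<in> {x..y}"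
  shows "\<bar>f1 s - f1 c - f2 c * (s - c)\<bar> \<le> B * (y - x)\<^sup>2"
    and "\<bar>f s - f c - f1 c * (s - c) - f2 c / 2 * (s - c)\<^sup>2\<bar> \<le> B * (y - x) ^ 3"
proof -
  have B0: "0 \<le> B" using B[OF cs(1)] by simp
  have mult: "\<bar>z\<bar> \<le> b * (y - x)" if "\<bar>z\<bar> \<le> b * \<bar>w - c\<bar>" "w \<in> {x..y}" "0 \<le> b" for z b w
    by (rule order_trans[OF that(1) mult_left_mono]) (use that cs in auto)
  have 2: "\<bar>f2 w - f2 c\<bar> \<le> B * (y - x)" if "w \<in> {x..y}" for w
    using field_differentiable_bound[of "{x..y}" f2 f3 B w c] d(3) B cs that B0
    by (intro mult[of _ B w]) auto
  have 1: "\<bar>f1 w - f1 c - f2 c * (w - c)\<bar> \<le> B * (y - x)\<^sup>2" if w: "w \<in> {x..y}" for w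
  proof -
    have "norm ((f1 w - f2 c * (w - c)) - (f1 c - f2 c * (c - c))) \<le> B * (y - x) * norm (w - c)"
    proof (rule field_differentiable_bound[of "{x..y}"])
      show "((\<lambda>w. f1 w - f2 c * (w - c)) has_real_derivative f2 z - f2 c) (at z within {x..y})"
        if "z \<in> {x..y}" for z by (auto intro!: derivative_eq_intros d that)
    qed (use 2 w cs in auto)
    then have "\<bar>f1 w - f1 c - f2 c * (w - c)\<bar> \<le> B * (y - x) * \<bar>w - c\<bar>"
      by (simp add: diff_right_commute)
    from mult[OF this w] show ?thesis
      using B0 cs by (simp add: power2_eq_square mult.assoc)
  qed
  show "\<bar>f1 s - f1 c - f2 c * (s - c)\<bar> \<le> B * (y - x)\<^sup>2" by (rule 1[OF cs(2)])
  have "norm ((f s - f1 c * (s - c) - f2 c / 2 * (s - c)\<^sup>2) - (f c - f1 c * (c - c) - f2 c / 2 * (c - c)\<^sup>2))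
      \<le> B * (y - x)\<^sup>2 * norm (s - c)"
  proof (rule field_differentiable_bound[of "{x..y}"])
    show "((\<lambda>w. f w - f1 c * (w - c) - f2 c / 2 * (w - c)\<^sup>2) has_real_derivative
        f1 z - f1 c - f2 c * (z - c)) (at z within {x..y})"
      if "z \<in> {x..y}" for z by (auto intro!: derivative_eq_intros d that)
  qed (use 1 cs in auto)
  then have "norm ((f s - f1 c * (s - c) - f2 c / 2 * (s - c)\<^sup>2) - (f c - f1 c * (c - c) - f2 c / 2 * (c - c)\<^sup>2))
      \<le> B * (y - x)\<^sup>2 * (y - x)"
    using mult[of _ "B * (y - x)\<^sup>2" s] cs B0 by simp
  then show "\<bar>f s - f c - f1 c * (s - c) - f2 c / 2 * (s - c)\<^sup>2\<bar> \<le> B * (y - x) ^ 3"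
    by (simp add: power3_eq_cube power2_eq_square mult.assoc algebra_simps)
qed

section \<open>The truncation error tested against the kernel\<close>

context alikhanov_mesh
begin

text \<open>Since \<open>\<psi>\<close> vanishes at both ends, the integral is minus that of
  \<open>\<kappa>' * \<psi>\<close>, bounded by \<open>S\<close> times the increment of the
  increasing kernel. Only \<open>\<psi>\<close> itself has to be small, and integrability of
  \<open>\<kappa> * \<psi>'\<close> comes out of the fundamental theorem. The kernel blows up at
  \<open>ts\<close>, which excludes the last step.\<close>

lemma kernel_by_parts:
  assumes ab: "a < b" "b < ts"
    and cont: "continuous_on {a..b} \<psi>"
    and deriv: "\<And>s. a < s \<Longrightarrow> s < b \<Longrightarrow> (\<psi> has_real_derivative \<psi>' s) (at s)"
    and zero: "\<psi> a = 0" "\<psi> b = 0" and S: "\<And>s. s \<in> {a..b} \<Longrightarrow> \<bar>\<psi> s\<bar> \<le> S"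
  obtains I where "((\<lambda>s. \<kappa> s * \<psi>' s) has_integral I) {a..b}" "\<bar>I\<bar> \<le> S * (\<kappa> b - \<kappa> a)"
proof -
  define \<kappa>' where "\<kappa>' s = \<alpha> * (ts - s) powr (-\<alpha> - 1)" for s
  have k': "(\<kappa> has_real_derivative \<kappa>' s) (at s)" if "s < ts" for s
    using kappa_deriv[OF that] by (simp add: \<kappa>'_def)
  have k'cont: "continuous_on {a..b} \<kappa>'" unfolding \<kappa>'_def using ab by (intro continuous_intros) auto
  have 1: "((\<lambda>s. \<kappa>' s * \<psi> s + \<kappa> s * \<psi>' s) has_integral \<kappa> b * \<psi> b - \<kappa> a * \<psi> a) {a..b}"
  proof (rule fundamental_theorem_of_calculus_interior)
    show "continuous_on {a..b} (\<lambda>s. \<kappa> s * \<psi> s)"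
      by (intro continuous_intros kappa_continuous cont ab)
    show "((\<lambda>s. \<kappa> s * \<psi> s) has_vector_derivative \<kappa>' s * \<psi> s + \<kappa> s * \<psi>' s) (at s)"
      if "s \<in> {a<..<b}" for s
      unfolding has_real_derivative_iff_has_vector_derivative[symmetric]
      using that ab by (auto intro!: derivative_eq_intros k' deriv)
  qed (use ab in simp)
  have 2: "(\<lambda>s. \<kappa>' s * \<psi> s) integrable_on {a..b}"
    by (intro integrable_continuous_real continuous_intros k'cont cont)
  have 3: "(\<kappa>' has_integral \<kappa> b - \<kappa> a) {a..b}"
    by (rule fundamental_theorem_of_calculus)
       (use ab k' in \<open>auto simp: has_real_derivative_iff_has_vector_derivative
          intro: has_vector_derivative_at_within\<close>)
  have "\<bar>integral {a..b} (\<lambda>s. \<kappa>' s * \<psi> s)\<bar> \<le> integral {a..b} (\<lambda>s. \<kappa>' s * S)"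
    unfolding real_norm_def[symmetric]
  proof (rule integral_norm_bound_integral[OF 2])
    show "(\<lambda>s. \<kappa>' s * S) integrable_on {a..b}" using 3 by (intro integrable_on_mult_left) auto
    show "norm (\<kappa>' s * \<psi> s) \<le> \<kappa>' s * S" if "s \<in> {a..b}" for s
      using S[OF that] alpha by (auto simp: abs_mult \<kappa>'_def intro!: mult_left_mono)
  qed
  also have "integral {a..b} (\<lambda>s. \<kappa>' s * S) = (\<kappa> b - \<kappa> a) * S"
    by (intro integral_unique has_integral_mult_left 3)
  finally have "\<bar>- integral {a..b} (\<lambda>s. \<kappa>' s * \<psi> s)\<bar> \<le> S * (\<kappa> b - \<kappa> a)" by (simp add: mult.commute)
  moreover have "((\<lambda>s. \<kappa> s * \<psi>' s) has_integral - integral {a..b} (\<lambda>s. \<kappa>' s * \<psi> s)) {a..b}"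
    using has_integral_diff[OF 1 integrable_integral[OF 2]] by (simp add: zero)
  ultimately show thesis using that by blast
qed

text \<open>Here \<open>tstar\<close> is used: the error of linear interpolation is orthogonal to the kernel to leading order.\<close>

lemma kernel_orthogonality:
  "((\<lambda>s. \<kappa> s * (s - (t (m - 1) + t m) / 2)) has_integral 0) {t (m - 1)..ts}"
proof -
  define L where "L = ts - t (m - 1)"
  have L: "L > 0" "L = (1 - \<alpha> / 2) * \<tau> m" using ts_bounds ts_eq by (auto simp: L_def)
  have mid: "ts - (t (m - 1) + t m) / 2 = (1 - \<alpha>) * \<tau> m / 2"
    by (simp add: ts_def tstar_def \<tau>_def field_simps)
  have 1: "((\<lambda>s. (ts - s) powr (1 - \<alpha>)) has_integral L powr (2 - \<alpha>) / (2 - \<alpha>)) {t (m - 1)..ts}"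
    using has_integral_kernel[of "\<alpha> - 1" "t (m - 1)" ts ts] alpha ts_bounds by (simp add: L_def)
  have 2: "(\<kappa> has_integral L powr (1 - \<alpha>) / (1 - \<alpha>)) {t (m - 1)..ts}"
    using kappa_integral[of "t (m - 1)" ts] ts_bounds alpha by (simp add: L_def)
  \<comment> \<open>The distance of \<open>s\<close> from the midpoint is
    \<open>(ts - midpoint) - (ts - s)\<close>, which splits the integrand into two kernel powers
    with explicit integrals; by \<open>mid\<close> their difference vanishes.\<close>
  have "((\<lambda>s. ((1 - \<alpha>) * \<tau> m / 2) * \<kappa> s - (ts - s) powr (1 - \<alpha>)) has_integral
      ((1 - \<alpha>) * \<tau> m / 2) * (L powr (1 - \<alpha>) / (1 - \<alpha>)) - L powr (2 - \<alpha>) / (2 - \<alpha>)) {t (m - 1)..ts}"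
    by (intro has_integral_diff has_integral_mult_right 1 2)
  moreover have "((1 - \<alpha>) * \<tau> m / 2) * (L powr (1 - \<alpha>) / (1 - \<alpha>)) - L powr (2 - \<alpha>) / (2 - \<alpha>) = 0"
  proof -
    have "L powr (2 - \<alpha>) = L * L powr (1 - \<alpha>)"
      using L(1) powr_add[of L 1 "1 - \<alpha>"] by simp
    then have "L powr (2 - \<alpha>) / (2 - \<alpha>) = L / (2 - \<alpha>) * L powr (1 - \<alpha>)" by simp
    moreover have "L / (2 - \<alpha>) = \<tau> m / 2" using alpha by (simp add: L(2) field_simps)
    moreover have "b \<noteq> 0 \<Longrightarrow> b * c / 2 * (x / b) = c / 2 * x" for b c x :: real by simp
    then have "((1 - \<alpha>) * \<tau> m / 2) * (L powr (1 - \<alpha>) / (1 - \<alpha>)) = \<tau> m / 2 * L powr (1 - \<alpha>)"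
      using alpha by (metis diff_eq_eq add_0 less_irrefl)
    ultimately show ?thesis by (simp only:)
  qed
  moreover have "((1 - \<alpha>) * \<tau> m / 2) * \<kappa> s - (ts - s) powr (1 - \<alpha>) = \<kappa> s * (s - (t (m - 1) + t m) / 2)"
    if "s \<in> {t (m - 1)..ts}" for s
  proof -
    have "(ts - s) powr (1 - \<alpha>) = (ts - s) * \<kappa> s"
      using that powr_add[of "ts - s" 1 "-\<alpha>"] by (cases "s = ts") (auto simp: \<kappa>_def)
    then show ?thesis unfolding mid[symmetric] by (simp add: algebra_simps)
  qed
  ultimately show ?thesis by (metis (no_types, lifting) has_integral_eq)
qed

text \<open>By orthogonality a multiple \<open>p\<close> of the centred linear function can be added
  without changing the integral. With \<open>p\<close> the second derivative at \<open>t m\<close>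
  this removes the first-order part of the difference between slope and derivative.\<close>

lemma last_interval_error:
  assumes int: "(\<lambda>s. \<kappa> s * f s) integrable_on {t (m - 1)..ts}"
    and B: "\<And>s. s \<in> {t (m - 1)<..<ts} \<Longrightarrow> \<bar>f s + p * (s - (t (m - 1) + t m) / 2)\<bar> \<le> B"
  shows "\<bar>integral {t (m - 1)..ts} (\<lambda>s. \<kappa> s * f s)\<bar> \<le> B * (ts - t (m - 1)) powr (1 - \<alpha>) / (1 - \<alpha>)"
proof -
  let ?h = "\<lambda>s. \<kappa> s * (f s + p * (s - (t (m - 1) + t m) / 2))"
  have "((\<lambda>s. \<kappa> s * f s + p * (\<kappa> s * (s - (t (m - 1) + t m) / 2))) has_integral
      integral {t (m - 1)..ts} (\<lambda>s. \<kappa> s * f s) + p * 0) {t (m - 1)..ts}"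
    by (intro has_integral_add has_integral_mult_right kernel_orthogonality integrable_integral int)
  then have h: "(?h has_integral integral {t (m - 1)..ts} (\<lambda>s. \<kappa> s * f s)) {t (m - 1)..ts}"
    by (simp add: algebra_simps)
  let ?h' = "\<lambda>s. if s \<in> {t (m - 1)<..<ts} then ?h s else 0"
  have h': "(?h' has_integral integral {t (m - 1)..ts} (\<lambda>s. \<kappa> s * f s)) {t (m - 1)..ts}"
    by (rule has_integral_spike_finite[OF _ _ h, of "{t (m - 1), ts}"]) auto
  have k: "((\<lambda>s. B * \<kappa> s) has_integral B * ((ts - t (m - 1)) powr (1 - \<alpha>) / (1 - \<alpha>))) {t (m - 1)..ts}"
    using kappa_integral[of "t (m - 1)" ts] ts_bounds alpha by (intro has_integral_mult_right) simp
  have B0: "0 \<le> B"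
    using B[of "(t (m - 1) + ts) / 2"] ts_bounds by (simp add: field_simps)
  have "norm (integral {t (m - 1)..ts} ?h') \<le> integral {t (m - 1)..ts} (\<lambda>s. B * \<kappa> s)"
  proof (rule integral_norm_bound_integral)
    fix s assume "s \<in> {t (m - 1)..ts}"
    have "\<kappa> s \<ge> 0" by (simp add: \<kappa>_def)
    then show "norm (?h' s) \<le> B * \<kappa> s"
      using mult_left_mono[OF B[of s], of "\<kappa> s"] B0 by (auto simp: abs_mult mult.commute)
  qed (use h' k in auto)
  then show ?thesis
    unfolding integral_unique[OF h'] integral_unique[OF k] by simp
qed

definition slope where "slope \<phi> j = (\<phi> (t j) - \<phi> (t (j - 1))) / \<tau> j" for \<phi> :: "real \<Rightarrow> real"

text \<open>The quadratic interpolant of a scalar function on step \<open>j\<close>, in the Newton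
  form of \<open>lagrange_quadratic\<close>.\<close>

definition quad where "quad \<phi> j s = \<phi> (t (j - 1)) + (s - t (j - 1)) * slope \<phi> j
  + (s - t (j - 1)) * (s - t j) / (t (j + 1) - t (j - 1)) * (slope \<phi> (j + 1) - slope \<phi> j)"
  for \<phi> :: "real \<Rightarrow> real"

text \<open>\<open>E\<close> integrates the kernel against the derivative of the interpolation
  error: by parts on each step before the last, and through the given \<open>R\<close> on the last
  one. Subtracting it from the discrete sum recovers the integral of
  \<open>\<kappa> * \<phi>'\<close>, so the existence of that integral up to 0, where
  \<open>\<phi>'\<close> may be unbounded, is part of the conclusion.\<close>

lemma truncation_error:
  fixes \<phi> :: "real \<Rightarrow> real"
  assumes cont: "continuous_on {0..ts} \<phi>"
    and deriv: "\<And>s. 0 < s \<Longrightarrow> s < ts \<Longrightarrow> (\<phi> has_real_derivative \<phi>' s) (at s)"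
    and S: "\<And>j s. 1 \<le> j \<Longrightarrow> j < m \<Longrightarrow> s \<in> {t (j - 1)..t j} \<Longrightarrow> \<bar>quad \<phi> j s - \<phi> s\<bar> \<le> S j"
    and R: "((\<lambda>s. \<kappa> s * (slope \<phi> m - \<phi>' s)) has_integral R) {t (m - 1)..ts}"
  obtains E where "((\<lambda>s. \<kappa> s * \<phi>' s) has_integral (\<Sum>j=1..m. g j * (\<phi> (t j) - \<phi> (t (j - 1)))) - E) {0..ts}"
    "\<bar>E\<bar> \<le> (\<Sum>j\<in>{1..<m}. S j * (\<kappa> (t j) - \<kappa> (t (j - 1)))) + \<bar>R\<bar>"
proof -
  define D where "D s = vector_derivative (alikhanov_interp t m (\<lambda>j. \<phi> (t j))) (at s)" for s
  have Deq: "D s = (1 - q k s) * slope \<phi> k + q k s * slope \<phi> (Suc k)"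
    if "1 \<le> k" "k \<le> m" "s \<in> {t (k - 1)<..<hi k}" for k s
    unfolding D_def using vector_derivative_at[OF interp_has_vector_derivative[OF that, of "\<lambda>j. \<phi> (t j)"]]
    by (simp add: slope_def)
  have step: "\<exists>I. ((\<lambda>s. \<kappa> s * (D s - \<phi>' s)) has_integral I) {t (j - 1)..t j} \<and>
      \<bar>I\<bar> \<le> S j * (\<kappa> (t j) - \<kappa> (t (j - 1)))" if j: "1 \<le> j" "j < m" for j
  proof -
    have tj: "t (j - 1) < t j" "t j < t (j + 1)" "t j < ts" "0 \<le> t (j - 1)"
      using j t_less t_less_ts t_le[of 0 "j - 1"] t0 by auto
    define c where "c = 1 / (t (j + 1) - t (j - 1))"
    have "((\<lambda>s. quad \<phi> j s - \<phi> s) has_real_derivative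
        (1 - q j s) * slope \<phi> j + q j s * slope \<phi> (Suc j) - \<phi>' s) (at s)"
      if "t (j - 1) < s" "s < t j" for s
    proof -
      have 1: "(\<phi> has_real_derivative \<phi>' s) (at s)" using that tj by (intro deriv) auto
      have "quad \<phi> j = (\<lambda>s. \<phi> (t (j - 1)) + (s - t (j - 1)) * slope \<phi> j
          + (s - t (j - 1)) * (s - t j) * (c * (slope \<phi> (Suc j) - slope \<phi> j)))"
        by (simp add: quad_def c_def fun_eq_iff)
      then have 2: "(quad \<phi> j has_real_derivative
          slope \<phi> j + (2 * s - t (j - 1) - t j) * (c * (slope \<phi> (Suc j) - slope \<phi> j))) (at s)"
        by (auto intro!: derivative_eq_intros simp: algebra_simps)
      have q: "q j s = (2 * s - t (j - 1) - t j) * c" using j by (simp add: q_def c_def)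
      have "slope \<phi> j + (2 * s - t (j - 1) - t j) * (c * (slope \<phi> (Suc j) - slope \<phi> j))
          = (1 - q j s) * slope \<phi> j + q j s * slope \<phi> (Suc j)"
        unfolding q by (simp add: algebra_simps)
      then show ?thesis using DERIV_diff[OF 2 1] by simp
    qed
    moreover have "continuous_on {t (j - 1)..t j} (\<lambda>s. quad \<phi> j s - \<phi> s)"
      unfolding quad_def using tj
      by (intro continuous_intros continuous_on_subset[OF cont]) auto
    moreover have "quad \<phi> j (t (j - 1)) - \<phi> (t (j - 1)) = 0" "quad \<phi> j (t j) - \<phi> (t j) = 0"
      using tj by (auto simp: quad_def slope_def \<tau>_def)
    ultimately obtain I where I: "((\<lambda>s. \<kappa> s * ((1 - q j s) * slope \<phi> j + q j s * slope \<phi> (Suc j) - \<phi>' s))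
        has_integral I) {t (j - 1)..t j}" "\<bar>I\<bar> \<le> S j * (\<kappa> (t j) - \<kappa> (t (j - 1)))"
      using kernel_by_parts[OF tj(1,3), where \<psi> = "\<lambda>s. quad \<phi> j s - \<phi> s" and S = "S j"
        and \<psi>' = "\<lambda>s. (1 - q j s) * slope \<phi> j + q j s * slope \<phi> (Suc j) - \<phi>' s"] S[OF j] by blast
    have "((\<lambda>s. \<kappa> s * (D s - \<phi>' s)) has_integral I) {t (j - 1)..t j}"
      by (rule has_integral_spike_finite[OF _ _ I(1), of "{t (j - 1), t j}"])
         (use j in \<open>auto simp: Deq hi_def\<close>)
    then show ?thesis using I(2) by blast
  qed
  have sum: "\<exists>E. ((\<lambda>s. \<kappa> s * (D s - \<phi>' s)) has_integral E) {0..t n} \<and>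
      \<bar>E\<bar> \<le> (\<Sum>j\<in>{1..<Suc n}. S j * (\<kappa> (t j) - \<kappa> (t (j - 1))))" if "n < m" for n
    using that
  proof (induction n)
    case 0
    show ?case by (intro exI[of _ 0]) (use has_integral_refl(2)[of _ 0] in \<open>simp add: t0\<close>)
  next
    case (Suc n)
    then obtain E where E: "((\<lambda>s. \<kappa> s * (D s - \<phi>' s)) has_integral E) {0..t n}"
      "\<bar>E\<bar> \<le> (\<Sum>j\<in>{1..<Suc n}. S j * (\<kappa> (t j) - \<kappa> (t (j - 1))))" by auto
    obtain I where I: "((\<lambda>s. \<kappa> s * (D s - \<phi>' s)) has_integral I) {t n..t (Suc n)}"
      "\<bar>I\<bar> \<le> S (Suc n) * (\<kappa> (t (Suc n)) - \<kappa> (t n))" using step[of "Suc n"] Suc.prems by auto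
    have "((\<lambda>s. \<kappa> s * (D s - \<phi>' s)) has_integral E + I) {0..t (Suc n)}"
      using t_le[of 0 n] t_le[of n "Suc n"] t0 by (intro has_integral_combine[OF _ _ E(1) I(1)]) auto
    moreover have "\<bar>E + I\<bar> \<le> (\<Sum>j\<in>{1..<Suc (Suc n)}. S j * (\<kappa> (t j) - \<kappa> (t (j - 1))))"
      using E(2) I(2) by simp
    ultimately show ?case by blast
  qed
  obtain E where E: "((\<lambda>s. \<kappa> s * (D s - \<phi>' s)) has_integral E) {0..t (m - 1)}"
    "\<bar>E\<bar> \<le> (\<Sum>j\<in>{1..<m}. S j * (\<kappa> (t j) - \<kappa> (t (j - 1))))" using sum[of "m - 1"] m by auto
  have "((\<lambda>s. \<kappa> s * (D s - \<phi>' s)) has_integral R) {t (m - 1)..ts}"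
    by (rule has_integral_spike_finite[OF _ _ R, of "{t (m - 1), ts}"])
       (use m in \<open>auto simp: Deq hi_def q_def\<close>)
  then have "((\<lambda>s. \<kappa> s * (D s - \<phi>' s)) has_integral E + R) {0..ts}"
    using ts_bounds t_le[of 0 "m - 1"] t0 by (intro has_integral_combine[OF _ _ E(1)]) auto
  moreover have "((\<lambda>s. \<kappa> s * D s) has_integral (\<Sum>j=1..m. g j * (\<phi> (t j) - \<phi> (t (j - 1))))) {0..ts}"
    using interp_has_integral[of "\<lambda>j. \<phi> (t j)"] unfolding caputo_integrand_def[abs_def] by (simp add: D_def \<kappa>_def)
  ultimately have "((\<lambda>s. \<kappa> s * D s - \<kappa> s * (D s - \<phi>' s)) has_integral
      (\<Sum>j=1..m. g j * (\<phi> (t j) - \<phi> (t (j - 1)))) - (E + R)) {0..ts}"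
    by (intro has_integral_diff)
  then have "((\<lambda>s. \<kappa> s * \<phi>' s) has_integral (\<Sum>j=1..m. g j * (\<phi> (t j) - \<phi> (t (j - 1)))) - (E + R)) {0..ts}"
    by (simp add: algebra_simps)
  then show thesis using that[of "E + R"] E(2) by force
qed

lemma quad_error:
  assumes "1 \<le> j" and s: "s \<in> {t (j - 1)..t j}"
    and R: "\<And>x. x \<in> {t (j - 1)..t (j + 1)} \<Longrightarrow> \<bar>\<phi> x - \<phi> (t j) - p * (x - t j) - r * (x - t j)\<^sup>2\<bar> \<le> E"
  shows "\<bar>quad \<phi> j s - \<phi> s\<bar> \<le> 4 * E"
proof -
  have "t (j - 1) < t j" "t j < t (j + 1)" using assms(1) t_less by auto
  moreover have "quad \<phi> j s = \<phi> (t (j - 1)) + (s - t (j - 1)) * ((\<phi> (t j) - \<phi> (t (j - 1))) / (t j - t (j - 1)))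
    + (s - t (j - 1)) * (s - t j) / (t (j + 1) - t (j - 1)) * ((\<phi> (t (j + 1)) - \<phi> (t j)) / (t (j + 1) - t j)
    - (\<phi> (t j) - \<phi> (t (j - 1))) / (t j - t (j - 1)))"
    by (simp add: quad_def slope_def \<tau>_def)
  moreover have "\<bar>\<phi> x - \<phi> (t j) - p * (x - t j) - r * (x - t j)\<^sup>2\<bar> \<le> E"
    if "x \<in> {t (j - 1), s, t (j + 1)}" for x
    using that s calculation by (intro R) auto
  ultimately show ?thesis
    using step_mono[OF assms(1)] s
    by (simp only:) (rule quadratic_interpolation_remainder, auto)
qed

text \<open>Expanding both at \<open>t m\<close>, the difference quotient equals the linearised
  derivative at the midpoint of the step, so the difference from \<open>d\<close> is linear in the
  distance to the midpoint up to two remainders, each at most \<open>B\<close> times the squared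
  step.\<close>

lemma slope_error:
  assumes R: "\<bar>\<phi> (t (m - 1)) - \<phi> (t m) - p * (t (m - 1) - t m) - r / 2 * (t (m - 1) - t m)\<^sup>2\<bar> \<le> B * \<tau> m ^ 3"
    and R': "\<bar>d - p - r * (s - t m)\<bar> \<le> B * (\<tau> m)\<^sup>2"
  shows "\<bar>slope \<phi> m - d + r * (s - (t (m - 1) + t m) / 2)\<bar> \<le> 2 * B * (\<tau> m)\<^sup>2"
proof -
  define x where "x = \<phi> (t (m - 1)) - \<phi> (t m) - p * (t (m - 1) - t m) - r / 2 * (t (m - 1) - t m)\<^sup>2"
  define y where "y = d - p - r * (s - t m)"
  have tm: "t (m - 1) - t m = - \<tau> m" "t (m - 1) = t m - \<tau> m" by (auto simp: \<tau>_def)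
  have tau: "0 < \<tau> m" using tau_pos m by blast
  have "\<phi> (t (m - 1)) = \<phi> (t m) - p * \<tau> m + r / 2 * (\<tau> m)\<^sup>2 + x"
    unfolding x_def tm by (simp add: algebra_simps)
  then have "slope \<phi> m = (p * \<tau> m - r / 2 * (\<tau> m)\<^sup>2 - x) / \<tau> m"
    unfolding slope_def by simp
  then have "slope \<phi> m = p - r / 2 * \<tau> m - x / \<tau> m"
    using tau by (simp add: diff_divide_distrib power2_eq_square)
  moreover have "d = p + r * (s - t m) + y" by (simp add: y_def)
  moreover have "s - (t (m - 1) + t m) / 2 = s - t m + \<tau> m / 2"
    by (simp add: \<tau>_def field_simps)
  ultimately have "slope \<phi> m - d + r * (s - (t (m - 1) + t m) / 2) = - (x / \<tau> m) - y"
    by (simp only:) (simp add: algebra_simps)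
  moreover have "\<bar>x / \<tau> m\<bar> \<le> B * (\<tau> m)\<^sup>2"
  proof -
    have "\<bar>x\<bar> \<le> B * (\<tau> m)\<^sup>2 * \<tau> m"
      using R by (simp only: x_def[symmetric]) (simp add: power3_eq_cube power2_eq_square mult.assoc)
    then show ?thesis using tau by (simp add: abs_divide pos_divide_le_eq)
  qed
  ultimately show ?thesis using R' unfolding y_def[symmetric] by linarith
qed

end

section \<open>Graded meshes\<close>

lemma powr_step_mvt:
  fixes r :: real
  assumes "1 \<le> r" "1 \<le> j"
  obtains \<xi> where "real (j - 1) < \<xi>" "\<xi> < real j" "real j powr r - real (j - 1) powr r = r * \<xi> powr (r - 1)"
proof -
  have j: "real j - real (j - 1) = 1" "real (j - 1) < real j" using assms by auto
  have "continuous_on {real (j - 1)..real j} (\<lambda>x. x powr r)"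
    using assms by (intro continuous_on_powr' continuous_intros) auto
  moreover have "(\<lambda>x. x powr r) differentiable (at x)" if "real (j - 1) < x" for x
    using that has_real_derivative_powr[of x r] by (auto simp: real_differentiable_def)
  ultimately obtain l \<xi> where "real (j - 1) < \<xi>" "\<xi> < real j" "((\<lambda>x. x powr r) has_real_derivative l) (at \<xi>)"
     "real j powr r - real (j - 1) powr r = (real j - real (j - 1)) * l"
    using MVT[OF j(2), of "\<lambda>x. x powr r"] by blast
  moreover from this have "l = r * \<xi> powr (r - 1)"
    by (intro DERIV_unique[OF _ has_real_derivative_powr]) auto
  ultimately show thesis using that[of \<xi>] j by simp
qed

lemma powr_near:
  fixes x y e :: real
  assumes "0 < y" "y / 2 \<le> x" "x \<le> y"
  shows "x powr e \<le> 2 powr \<bar>e\<bar> * y powr e"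
proof (cases "0 \<le> e")
  case True
  then have "x powr e \<le> 1 * y powr e" using assms by (auto intro!: powr_mono2)
  also have "\<dots> \<le> 2 powr \<bar>e\<bar> * y powr e" by (intro mult_right_mono) (auto intro: ge_one_powr_ge_zero)
  finally show ?thesis .
next
  case False
  then have "x powr e \<le> (y / 2) powr e" using assms by (intro powr_mono2') auto
  also have "\<dots> = 2 powr \<bar>e\<bar> * y powr e" using False by (simp add: powr_divide powr_minus field_simps)
  finally show ?thesis .
qed

text \<open>The mesh enters through its first point \<open>t1\<close> only, which is
  \<open>T * real M powr (-r)\<close> in the application. The constants defined in this locale
  depend on \<alpha> and \<open>r\<close>, not on \<open>t1\<close> or \<open>m\<close>; this is the
  source of uniformity in the number of steps.\<close>

locale alikhanov_graded =
  fixes \<alpha> r t1 :: real and t :: "nat \<Rightarrow> real" and m :: nat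
  assumes alpha_range: "0 < \<alpha>" "\<alpha> < 1" and r: "1 \<le> r" and t1: "0 < t1"
    and t_eq: "\<And>j. t j = t1 * real j powr r" and m1: "1 \<le> m"
begin

text \<open>Mean value theorem for \<open>x powr r\<close>; the lower bound with \<open>j\<close>
  itself rests on \<open>real (j - 1) powr r \<le> real (j - 1) * real j powr (r - 1)\<close>. The
  second bound at \<open>j\<close> and the third at \<open>j + 1\<close> together show that steps do
  not decrease.\<close>

lemma step_bounds:
  assumes "1 \<le> j"
  shows "t1 * real j powr (r - 1) \<le> t j - t (j - 1)" "t j - t (j - 1) \<le> r * (t1 * real j powr (r - 1))"
    "r * (t1 * real (j - 1) powr (r - 1)) \<le> t j - t (j - 1)"
proof -
  obtain \<xi> where \<xi>: "real (j - 1) < \<xi>" "\<xi> < real j" "real j powr r - real (j - 1) powr r = r * \<xi> powr (r - 1)"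
    using powr_step_mvt r assms by blast
  have eq: "t j - t (j - 1) = t1 * (r * \<xi> powr (r - 1))"
    unfolding t_eq \<xi>(3)[symmetric] by (simp add: algebra_simps)
  have "\<xi> powr (r - 1) \<le> real j powr (r - 1)" "real (j - 1) powr (r - 1) \<le> \<xi> powr (r - 1)"
    using \<xi> r by (auto intro!: powr_mono2)
  then show "t j - t (j - 1) \<le> r * (t1 * real j powr (r - 1))"
    "r * (t1 * real (j - 1) powr (r - 1)) \<le> t j - t (j - 1)"
    unfolding eq using r t1 by auto
  have rj: "real (j - 1) = real j - 1" using assms by simp
  have "real (j - 1) powr r = real (j - 1) * real (j - 1) powr (r - 1)"
    using powr_add[of "real (j - 1)" 1 "r - 1"] r by (cases "j = 1") auto
  also have "\<dots> \<le> real (j - 1) * real j powr (r - 1)"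
    using r by (intro mult_left_mono powr_mono2) auto
  also have "\<dots> = real j powr r - real j powr (r - 1)"
    unfolding rj using powr_add[of "real j" 1 "r - 1"] assms by (simp add: algebra_simps)
  finally have "real j powr (r - 1) \<le> real j powr r - real (j - 1) powr r" by linarith
  then show "t1 * real j powr (r - 1) \<le> t j - t (j - 1)"
    unfolding t_eq using t1 by (simp add: right_diff_distrib[symmetric])
qed

sublocale alikhanov_mesh \<alpha> t m
proof
  show "0 < \<alpha>" "\<alpha> < 1" "1 \<le> m" by (rule alpha_range m1)+
  show "t 0 = 0" by (simp add: t_eq)
  show "strict_mono t"
    unfolding strict_mono_def t_eq using t1 r by (auto intro!: mult_strict_left_mono powr_less_mono2)
  show "t j - t (j - 1) \<le> t (j + 1) - t j" if "1 \<le> j" for j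
    using step_bounds(2)[OF that] step_bounds(3)[of "j + 1"] by simp
qed

lemma t_pos: "1 \<le> j \<Longrightarrow> 0 < t j"
  using t_less[of 0 j] t0 by simp

lemma t_1: "t 1 = t1"
  by (simp add: t_eq)

lemma t1_le: "1 \<le> j \<Longrightarrow> t1 \<le> t j"
  using t_le[of 1 j] by (simp add: t_1[unfolded One_nat_def])

lemma tau_upper: "1 \<le> j \<Longrightarrow> \<tau> j \<le> r * t1 powr (1 / r) * t j powr (1 - 1 / r)"
proof -
  assume j: "1 \<le> j"
  have "t1 powr (1 / r) * t j powr (1 - 1 / r) = t1 powr (1 / r) * t1 powr (1 - 1 / r) * real j powr (r * (1 - 1 / r))"
    using t1 by (simp add: t_eq powr_mult powr_powr)
  also have "t1 powr (1 / r) * t1 powr (1 - 1 / r) = t1"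
    using t1 by (simp flip: powr_add)
  also have "r * (1 - 1 / r) = r - 1" using r by (simp add: right_diff_distrib)
  finally show ?thesis using step_bounds(2)[OF j] by (simp add: \<tau>_def mult.assoc)
qed

lemma tau_next: "1 \<le> j \<Longrightarrow> \<tau> (Suc j) \<le> r * 2 powr (r - 1) * \<tau> j"
proof -
  assume j: "1 \<le> j"
  have "\<tau> (Suc j) \<le> r * (t1 * real (Suc j) powr (r - 1))"
    using step_bounds(2)[of "Suc j"] by (simp add: \<tau>_def)
  also have "\<dots> \<le> r * (t1 * (2 * real j) powr (r - 1))"
    using j r t1 by (intro mult_left_mono powr_mono2) auto
  also have "\<dots> = r * 2 powr (r - 1) * (t1 * real j powr (r - 1))"
    by (simp add: powr_mult)
  also have "\<dots> \<le> r * 2 powr (r - 1) * \<tau> j"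
    using step_bounds(1)[OF j] r by (intro mult_left_mono) (auto simp: \<tau>_def)
  finally show ?thesis .
qed

lemma t_prev: "2 \<le> j \<Longrightarrow> t j \<le> 2 powr r * t (j - 1)"
proof -
  assume j: "2 \<le> j"
  then have "real j powr r \<le> (2 * real (j - 1)) powr r" using r by (intro powr_mono2) auto
  then show ?thesis using t1 by (simp add: t_eq powr_mult mult.left_commute)
qed

lemma tau_lower: "1 \<le> j \<Longrightarrow> \<tau> j powr (-\<alpha>) \<le> t j powr (-\<alpha>) * (t j / t1) powr (\<alpha> / r)"
proof -
  assume j: "1 \<le> j"
  have "t j * (t j / t1) powr (- (1 / r)) = t1 * real j powr (r - 1)"
    using t1 j r by (simp add: t_eq powr_powr powr_diff powr_minus field_simps)
  also have "\<dots> \<le> \<tau> j" using step_bounds(1)[OF j] by (simp add: \<tau>_def)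
  finally have "\<tau> j powr (-\<alpha>) \<le> (t j * (t j / t1) powr (- (1 / r))) powr (-\<alpha>)"
    using t_pos[OF j] t1 alpha_range by (intro powr_mono2') auto
  also have "\<dots> = t j powr (-\<alpha>) * (t j / t1) powr (\<alpha> / r)"
    using t_pos[OF j] t1 by (simp add: powr_mult powr_powr)
  finally show ?thesis .
qed

lemma ts_diff: "j < m \<Longrightarrow> (t m - t j) / 2 \<le> ts - t j"
proof -
  assume j: "j < m"
  have "t j \<le> t (m - 1)" using j by (intro t_le) auto
  moreover have "\<tau> m / 2 \<le> (1 - \<alpha> / 2) * \<tau> m"
    using alpha_range tau_pos[OF m1] by (simp add: field_simps)
  ultimately show ?thesis using ts_eq by (simp add: \<tau>_def field_simps)
qed

text \<open>A cubed step yields \<open>t1 powr (3 / r)\<close>, which is of third order in the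
  reciprocal number of steps, at the price of changing the weight exponent from \<sigma> - 3 to
  \<sigma> - 3 / r.\<close>

lemma tau_cubed:
  assumes "1 \<le> j" "0 \<le> a"
  shows "\<tau> j ^ 3 * (t j + a) powr (\<sigma> - 3) \<le> r ^ 3 * t1 powr (3 / r) * (t j + a) powr (\<sigma> - 3 / r)"
proof -
  have tj: "0 < t j" "0 < t j + a" using t_pos assms by (auto intro: add_pos_nonneg)
  have "\<tau> j ^ 3 \<le> (r * t1 powr (1 / r) * (t j + a) powr (1 - 1 / r)) ^ 3"
  proof (rule power_mono)
    have "\<tau> j \<le> r * t1 powr (1 / r) * t j powr (1 - 1 / r)" by (rule tau_upper[OF assms(1)])
    also have "\<dots> \<le> r * t1 powr (1 / r) * (t j + a) powr (1 - 1 / r)"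
      using r tj assms by (intro mult_left_mono powr_mono2) auto
    finally show "\<tau> j \<le> r * t1 powr (1 / r) * (t j + a) powr (1 - 1 / r)" .
  qed (use tau_pos assms in \<open>auto intro: less_imp_le\<close>)
  also have "\<dots> = r ^ 3 * t1 powr (3 / r) * (t j + a) powr (3 - 3 / r)"
    using tj t1 by (simp add: power_mult_distrib powr_power[symmetric] powr_realpow[symmetric] powr_powr algebra_simps)
  finally have "\<tau> j ^ 3 * (t j + a) powr (\<sigma> - 3)
      \<le> r ^ 3 * t1 powr (3 / r) * (t j + a) powr (3 - 3 / r) * (t j + a) powr (\<sigma> - 3)"
    by (rule mult_right_mono) simp
  also have "\<dots> = r ^ 3 * t1 powr (3 / r) * (t j + a) powr (\<sigma> - 3 / r)"
    by (simp add: mult.assoc flip: powr_add)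
  finally show ?thesis .
qed

lemma kappa_last: "\<kappa> (t (m - 1)) \<le> 2 * \<tau> m powr (-\<alpha>)"
proof -
  have tau: "0 < \<tau> m" using tau_pos m1 by blast
  have "\<tau> m / 2 \<le> ts - t (m - 1)"
    using alpha_range tau unfolding ts_eq by (simp add: field_simps)
  then have "\<kappa> (t (m - 1)) \<le> (\<tau> m / 2) powr (-\<alpha>)"
    unfolding \<kappa>_def using tau alpha_range by (intro powr_mono2') auto
  also have "\<dots> = 2 powr \<alpha> * \<tau> m powr (-\<alpha>)"
    using tau by (simp add: powr_divide powr_minus field_simps)
  also have "\<dots> \<le> 2 powr 1 * \<tau> m powr (-\<alpha>)"
    using alpha_range by (intro mult_right_mono powr_mono) auto
  finally show ?thesis by simp
qed

text \<open>Split at \<open>t j = t m / 2\<close>. On the far half \<open>ts - t j\<close> is at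
  least \<open>t m / 4\<close>, so the kernel increment is at most
  \<open>16 * t m powr (-\<alpha> - 1) * \<tau> j\<close>, where 16 dominates 4 to the power
  \<alpha> + 1. On the near half \<open>t j + a\<close> is comparable with \<open>t m + a\<close>,
  and the kernel increments telescope to at most
  \<open>2 * \<tau> m powr (-\<alpha>)\<close>.\<close>

lemma truncation_sum_bound:
  assumes "0 \<le> a"
  shows "(\<Sum>j\<in>{1..<m}. \<tau> j ^ 3 * (t j + a) powr (\<sigma> - 3) * (\<kappa> (t j) - \<kappa> (t (j - 1))))
      + \<tau> m powr (3 - \<alpha>) * (t m + a) powr (\<sigma> - 3)
    \<le> 16 * r ^ 3 * 2 powr \<bar>\<sigma> - 3 / r\<bar> * t1 powr (3 / r) *
      ((t m + a) powr (\<sigma> - 3 / r) * \<tau> m powr (-\<alpha>)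
        + t m powr (-\<alpha> - 1) * (\<Sum>j\<in>{1..<m}. \<tau> j * (t j + a) powr (\<sigma> - 3 / r)))"
proof -
  define c where "c = 2 powr \<bar>\<sigma> - 3 / r\<bar>"
  define h where "h = r ^ 3 * t1 powr (3 / r)"
  define N where "N = c * (t m + a) powr (\<sigma> - 3 / r)"
  have c: "1 \<le> c" unfolding c_def by (rule ge_one_powr_ge_zero) auto
  have h: "0 \<le> h" unfolding h_def using r by simp
  have tm: "0 < t m" "0 < \<tau> m" using t_pos tau_pos m1 by auto
  have each: "\<tau> j ^ 3 * (t j + a) powr (\<sigma> - 3) * (\<kappa> (t j) - \<kappa> (t (j - 1)))
      \<le> h * N * (\<kappa> (t j) - \<kappa> (t (j - 1)))
        + h * (16 * t m powr (-\<alpha> - 1)) * (\<tau> j * (t j + a) powr (\<sigma> - 3 / r))" if j: "j \<in> {1..<m}" for j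
  proof -
    have j': "1 \<le> j" "j < m" using j by auto
    have D: "0 \<le> \<kappa> (t j) - \<kappa> (t (j - 1))"
      using kappa_mono[of "t (j - 1)" "t j"] t_le[of "j - 1" j] t_less_ts[OF j'(2)] by simp
    have S: "\<tau> j ^ 3 * (t j + a) powr (\<sigma> - 3) \<le> h * (t j + a) powr (\<sigma> - 3 / r)"
      unfolding h_def by (rule tau_cubed[OF j'(1) assms])
    have *: "0 \<le> h * N * (\<kappa> (t j) - \<kappa> (t (j - 1)))"
      "0 \<le> h * (16 * t m powr (-\<alpha> - 1)) * (\<tau> j * (t j + a) powr (\<sigma> - 3 / r))"
      using D h c tau_pos[OF j'(1)] by (auto simp: N_def)
    show ?thesis
    proof (cases "t j \<le> t m / 2")
      case True
      have q4: "(t m / 4) powr e = 4 powr (-e) * t m powr e" for e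
        using tm by (simp add: powr_divide powr_minus_divide)
      have q5: "(t m / 4) powr (-\<alpha> - 1) = 4 powr (\<alpha> + 1) * t m powr (-\<alpha> - 1)"
        using q4[of "-\<alpha> - 1"] by (simp only: minus_diff_eq minus_minus diff_minus_eq_add add.commute)
      have "\<kappa> (t j) - \<kappa> (t (j - 1)) \<le> \<alpha> * (ts - t j) powr (-\<alpha> - 1) * (t j - t (j - 1))"
        using t_le[of "j - 1" j] t_less_ts[OF j'(2)] by (intro kappa_diff(2)) auto
      also have "\<dots> \<le> 1 * (t m / 4) powr (-\<alpha> - 1) * (t j - t (j - 1))"
        using ts_diff[OF j'(2)] True tm alpha_range t_le[of "j - 1" j]
        by (intro mult_right_mono mult_mono powr_mono2') auto
      also note q5
      also have "1 * (4 powr (\<alpha> + 1) * t m powr (-\<alpha> - 1)) * (t j - t (j - 1))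
          \<le> 1 * (4 powr 2 * t m powr (-\<alpha> - 1)) * (t j - t (j - 1))"
        using alpha_range t_le[of "j - 1" j] by (intro mult_right_mono mult_left_mono powr_mono) auto
      finally have "\<kappa> (t j) - \<kappa> (t (j - 1)) \<le> 16 * t m powr (-\<alpha> - 1) * \<tau> j" by (simp add: \<tau>_def)
      then have "\<tau> j ^ 3 * (t j + a) powr (\<sigma> - 3) * (\<kappa> (t j) - \<kappa> (t (j - 1)))
          \<le> h * (t j + a) powr (\<sigma> - 3 / r) * (16 * t m powr (-\<alpha> - 1) * \<tau> j)"
        using D h by (intro mult_mono[OF S]) auto
      then show ?thesis using *(1) by (simp add: mult_ac)
    next
      case False
      have "(t j + a) powr (\<sigma> - 3 / r) \<le> N"
        unfolding N_def c_def using False tm assms t_le[of j m] j' by (intro powr_near) auto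
      then have "\<tau> j ^ 3 * (t j + a) powr (\<sigma> - 3) \<le> h * N"
        using S h by (meson mult_left_mono order_trans)
      then have "\<tau> j ^ 3 * (t j + a) powr (\<sigma> - 3) * (\<kappa> (t j) - \<kappa> (t (j - 1))) \<le> h * N * (\<kappa> (t j) - \<kappa> (t (j - 1)))"
        using D by (rule mult_right_mono)
      then show ?thesis using *(2) by linarith
    qed
  qed
  have tele: "(\<Sum>j\<in>{1..<m}. \<kappa> (t j) - \<kappa> (t (j - 1))) = \<kappa> (t (m - 1)) - \<kappa> (t 0)"
    using sum_Suc_diff'[of 0 "m - 1" "\<lambda>j. \<kappa> (t j)"] m1
      sum.shift_bounds_Suc_ivl[of "\<lambda>j. \<kappa> (t j) - \<kappa> (t (j - 1))" 0 "m - 1"] by simp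
  have "(\<Sum>j\<in>{1..<m}. \<tau> j ^ 3 * (t j + a) powr (\<sigma> - 3) * (\<kappa> (t j) - \<kappa> (t (j - 1))))
      \<le> h * N * (\<Sum>j\<in>{1..<m}. \<kappa> (t j) - \<kappa> (t (j - 1)))
        + h * (16 * t m powr (-\<alpha> - 1)) * (\<Sum>j\<in>{1..<m}. \<tau> j * (t j + a) powr (\<sigma> - 3 / r))"
    unfolding sum_distrib_left sum.distrib[symmetric] by (rule sum_mono) (rule each)
  also have "h * N * (\<Sum>j\<in>{1..<m}. \<kappa> (t j) - \<kappa> (t (j - 1))) \<le> h * N * (2 * \<tau> m powr (-\<alpha>))"
    unfolding tele using kappa_last kappa_pos[of "t 0"] t_less_ts[of 0] m1 h c
    by (intro mult_left_mono) (auto simp: N_def)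
  finally have 1: "(\<Sum>j\<in>{1..<m}. \<tau> j ^ 3 * (t j + a) powr (\<sigma> - 3) * (\<kappa> (t j) - \<kappa> (t (j - 1))))
      \<le> h * N * (2 * \<tau> m powr (-\<alpha>))
        + h * (16 * t m powr (-\<alpha> - 1)) * (\<Sum>j\<in>{1..<m}. \<tau> j * (t j + a) powr (\<sigma> - 3 / r))" by simp
  have "\<tau> m powr (3 - \<alpha>) * (t m + a) powr (\<sigma> - 3) = \<tau> m ^ 3 * (t m + a) powr (\<sigma> - 3) * \<tau> m powr (-\<alpha>)"
    using tm powr_add[of "\<tau> m" 3 "-\<alpha>"] by (simp add: powr_realpow)
  also have "\<dots> \<le> h * (t m + a) powr (\<sigma> - 3 / r) * \<tau> m powr (-\<alpha>)"
    unfolding h_def by (intro mult_right_mono tau_cubed m1 assms) auto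
  also have "\<dots> \<le> h * N * \<tau> m powr (-\<alpha>)"
    unfolding N_def using c h by (intro mult_right_mono mult_left_mono) (auto simp: mult_le_cancel_right1)
  finally have 2: "\<tau> m powr (3 - \<alpha>) * (t m + a) powr (\<sigma> - 3) \<le> h * N * \<tau> m powr (-\<alpha>)" .
  have pos: "0 \<le> h * N * \<tau> m powr (-\<alpha>)"
    "0 \<le> h * (16 * t m powr (-\<alpha> - 1)) * (\<Sum>j\<in>{1..<m}. \<tau> j * (t j + a) powr (\<sigma> - 3 / r))"
    using h c by (auto simp: N_def intro!: mult_nonneg_nonneg sum_nonneg less_imp_le[OF tau_pos])
  have 3: "h * (16 * t m powr (-\<alpha> - 1)) * (\<Sum>j\<in>{1..<m}. \<tau> j * (t j + a) powr (\<sigma> - 3 / r))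
      \<le> c * (h * (16 * t m powr (-\<alpha> - 1)) * (\<Sum>j\<in>{1..<m}. \<tau> j * (t j + a) powr (\<sigma> - 3 / r)))"
    using mult_right_mono[OF c pos(2)] by simp
  have "16 * r ^ 3 * 2 powr \<bar>\<sigma> - 3 / r\<bar> * t1 powr (3 / r) *
      ((t m + a) powr (\<sigma> - 3 / r) * \<tau> m powr (-\<alpha>)
        + t m powr (-\<alpha> - 1) * (\<Sum>j\<in>{1..<m}. \<tau> j * (t j + a) powr (\<sigma> - 3 / r)))
    = 16 * (h * N * \<tau> m powr (-\<alpha>))
      + c * (h * (16 * t m powr (-\<alpha> - 1)) * (\<Sum>j\<in>{1..<m}. \<tau> j * (t j + a) powr (\<sigma> - 3 / r)))"
    unfolding c_def[symmetric] by (simp add: N_def h_def algebra_simps)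
  then show ?thesis using 1 2 3 pos by linarith
qed

end

section \<open>Truncation estimate under third-derivative bounds by shifted powers\<close>

context alikhanov_graded
begin

definition step_const where "step_const = r * 2 powr (r - 1)"

lemma step_const: "1 \<le> step_const"
  using r mult_mono[of 1 r 1 "2 powr (r - 1)"] by (simp add: step_const_def ge_one_powr_ge_zero)

text \<open>The weight \<open>s + a\<close> varies by a bounded factor within a step. On the first
  step, where \<open>s\<close> reaches 0, this takes a shift of at least \<open>t1\<close>; without
  a shift it holds from the second step on.\<close>

lemma shifted_lower_bound:
  assumes "1 \<le> j" "0 \<le> a" "t1 \<le> a \<or> 2 \<le> j" "t (j - 1) \<le> s"
  shows "2 powr (-r) * (t j + a) \<le> s + a"
proof -
  have r2: "2 powr (-r) \<le> 1 / 2" using r powr_mono[of "-r" "-1" "2::real"] by (simp add: powr_minus)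
  show ?thesis
  proof (cases "2 \<le> j")
    case True
    have "2 powr (-r) * t j \<le> t (j - 1)"
      using mult_left_mono[OF t_prev[OF True], of "2 powr (-r)"] by (simp add: mult.assoc[symmetric] flip: powr_add)
    moreover have "2 powr (-r) * a \<le> a" using mult_right_mono[of "2 powr (-r)" 1 a] r2 assms(2) by simp
    ultimately show ?thesis using assms(4) by (simp add: distrib_left)
  next
    case False
    then have j: "j = 1" "t1 \<le> a" using assms by auto
    have "2 powr (-r) * (t j + a) \<le> 1 / 2 * (2 * a)"
      using r2 j t1 by (intro mult_mono) (auto simp: t_1[unfolded One_nat_def])
    then show ?thesis using assms(4) j t0 by simp
  qed
qed

lemma shifted_powr_bound:
  assumes "1 \<le> j" "0 \<le> a" "t1 \<le> a \<or> 2 \<le> j" "t (j - 1) \<le> s" "\<sigma> \<le> 3"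
  shows "(s + a) powr (\<sigma> - 3) \<le> 2 powr (r * (3 - \<sigma>)) * (t j + a) powr (\<sigma> - 3)"
proof -
  have pos: "0 < t j + a" using t_pos[OF assms(1)] assms(2) by simp
  have "(s + a) powr (\<sigma> - 3) \<le> (2 powr (-r) * (t j + a)) powr (\<sigma> - 3)"
    using shifted_lower_bound[OF assms(1-4)] pos assms(5) by (intro powr_mono2') auto
  also have "\<dots> = 2 powr (r * (3 - \<sigma>)) * (t j + a) powr (\<sigma> - 3)"
  proof -
    have "-r * (\<sigma> - 3) = r * (3 - \<sigma>)" by (simp add: algebra_simps)
    then show ?thesis using pos by (simp only: powr_mult powr_powr)
  qed
  finally show ?thesis .
qed

lemma quad_error_graded:
  fixes \<phi> :: "real \<Rightarrow> real"
  assumes j: "1 \<le> j" and a: "0 \<le> a" "t1 \<le> a \<or> 2 \<le> j" and \<sigma>: "\<sigma> \<le> 3" and K: "0 \<le> K"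
    and Z: "{t (j - 1)..t (j + 1)} \<subseteq> Z"
    and d: "\<And>s. s \<in> Z \<Longrightarrow> (\<phi> has_real_derivative \<phi>1 s) (at s within Z)"
      "\<And>s. s \<in> Z \<Longrightarrow> (\<phi>1 has_real_derivative \<phi>2 s) (at s within Z)"
      "\<And>s. s \<in> Z \<Longrightarrow> (\<phi>2 has_real_derivative \<phi>3 s) (at s within Z)"
    and b: "\<And>s. s \<in> Z \<Longrightarrow> \<bar>\<phi>3 s\<bar> \<le> K * (s + a) powr (\<sigma> - 3)"
    and s: "s \<in> {t (j - 1)..t j}"
  shows "\<bar>quad \<phi> j s - \<phi> s\<bar> \<le> 32 * step_const ^ 3 * 2 powr (r * (3 - \<sigma>)) * (K * (\<tau> j ^ 3 * (t j + a) powr (\<sigma> - 3)))"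
proof -
  let ?I = "{t (j - 1)..t (j + 1)}"
  define B where "B = K * (2 powr (r * (3 - \<sigma>)) * (t j + a) powr (\<sigma> - 3))"
  have B: "\<bar>\<phi>3 x\<bar> \<le> B" if "x \<in> ?I" for x
  proof -
    have "\<bar>\<phi>3 x\<bar> \<le> K * (x + a) powr (\<sigma> - 3)" using b that Z by blast
    also have "\<dots> \<le> B" unfolding B_def
      using that K shifted_powr_bound[OF j a _ \<sigma>, of x] by (intro mult_left_mono) auto
    finally show ?thesis .
  qed
  have tj: "t j \<in> ?I" using t_le[of "j - 1" j] t_le[of j "j + 1"] by simp
  have sub: "(\<phi> has_real_derivative \<phi>1 x) (at x within ?I)" "(\<phi>1 has_real_derivative \<phi>2 x) (at x within ?I)"
    "(\<phi>2 has_real_derivative \<phi>3 x) (at x within ?I)" if "x \<in> ?I" for x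
    using that Z by (meson DERIV_subset d subsetD)+
  have *: "\<bar>\<phi> x - \<phi> (t j) - \<phi>1 (t j) * (x - t j) - \<phi>2 (t j) / 2 * (x - t j)\<^sup>2\<bar> \<le> B * (t (j + 1) - t (j - 1)) ^ 3"
    if "x \<in> ?I" for x
    by (rule third_order_taylor(2)[OF sub B tj that])
  have "\<bar>quad \<phi> j s - \<phi> s\<bar> \<le> 4 * (B * (t (j + 1) - t (j - 1)) ^ 3)"
    by (rule quad_error[OF j s *])
  also have "\<dots> \<le> 4 * (B * (2 * (step_const * \<tau> j)) ^ 3)"
  proof -
    have "t (j + 1) - t (j - 1) = \<tau> (Suc j) + \<tau> j" by (simp add: \<tau>_def)
    also have "\<dots> \<le> step_const * \<tau> j + 1 * \<tau> j" using tau_next[OF j] by (simp add: step_const_def)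
    also have "\<dots> \<le> 2 * (step_const * \<tau> j)"
      using mult_right_mono[OF step_const less_imp_le[OF tau_pos[OF j]]] by simp
    finally show ?thesis
      using K t_le[of "j - 1" "j + 1"] by (intro mult_left_mono power_mono) (auto simp: B_def)
  qed
  finally show ?thesis by (simp add: B_def power_mult_distrib mult_ac)
qed

lemma last_interval_graded:
  fixes \<phi> :: "real \<Rightarrow> real"
  assumes a: "0 \<le> a" "t1 \<le> a \<or> 2 \<le> m" and \<sigma>: "\<sigma> \<le> 3" and K: "0 \<le> K"
    and Z: "{t (m - 1)..t m} \<subseteq> Z"
    and d: "\<And>s. s \<in> Z \<Longrightarrow> (\<phi> has_real_derivative \<phi>1 s) (at s within Z)"
      "\<And>s. s \<in> Z \<Longrightarrow> (\<phi>1 has_real_derivative \<phi>2 s) (at s within Z)"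
      "\<And>s. s \<in> Z \<Longrightarrow> (\<phi>2 has_real_derivative \<phi>3 s) (at s within Z)"
    and b: "\<And>s. s \<in> Z \<Longrightarrow> \<bar>\<phi>3 s\<bar> \<le> K * (s + a) powr (\<sigma> - 3)"
    and int: "(\<lambda>s. \<kappa> s * \<phi>1 s) integrable_on {t (m - 1)..ts}"
  obtains R where "((\<lambda>s. \<kappa> s * (slope \<phi> m - \<phi>1 s)) has_integral R) {t (m - 1)..ts}"
    "\<bar>R\<bar> \<le> 2 * 2 powr (r * (3 - \<sigma>)) / (1 - \<alpha>) * (K * (\<tau> m powr (3 - \<alpha>) * (t m + a) powr (\<sigma> - 3)))"
proof -
  let ?I = "{t (m - 1)..t m}"
  define B where "B = K * (2 powr (r * (3 - \<sigma>)) * (t m + a) powr (\<sigma> - 3))"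
  have B0: "0 \<le> B" using K by (simp add: B_def)
  have B: "\<bar>\<phi>3 x\<bar> \<le> B" if "x \<in> ?I" for x
  proof -
    have "\<bar>\<phi>3 x\<bar> \<le> K * (x + a) powr (\<sigma> - 3)" using b that Z by blast
    also have "\<dots> \<le> B" unfolding B_def
      using that K shifted_powr_bound[OF m1 a _ \<sigma>, of x] by (intro mult_left_mono) auto
    finally show ?thesis .
  qed
  have tm: "t m \<in> ?I" "t (m - 1) \<in> ?I" using t_le[of "m - 1" m] by auto
  have tau: "t m - t (m - 1) = \<tau> m" "0 < \<tau> m" using tau_pos m1 by (auto simp: \<tau>_def)
  have sub: "(\<phi> has_real_derivative \<phi>1 x) (at x within ?I)" "(\<phi>1 has_real_derivative \<phi>2 x) (at x within ?I)"
    "(\<phi>2 has_real_derivative \<phi>3 x) (at x within ?I)" if "x \<in> ?I" for x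
    using that Z by (meson DERIV_subset d subsetD)+
  have e1: "\<bar>\<phi> (t (m - 1)) - \<phi> (t m) - \<phi>1 (t m) * (t (m - 1) - t m) - \<phi>2 (t m) / 2 * (t (m - 1) - t m)\<^sup>2\<bar>
      \<le> B * \<tau> m ^ 3"
    unfolding tau(1)[symmetric]
    by (rule third_order_taylor(2)[OF sub B tm])
  have e2: "\<bar>\<phi>1 s - \<phi>1 (t m) - \<phi>2 (t m) * (s - t m)\<bar> \<le> B * (\<tau> m)\<^sup>2" if "s \<in> ?I" for s
    unfolding tau(1)[symmetric]
    by (rule third_order_taylor(1)[OF sub B tm(1) that])
  have "(\<lambda>s. \<kappa> s * slope \<phi> m) integrable_on {t (m - 1)..ts}"
    using kappa_integral[of "t (m - 1)" ts] ts_bounds by (intro integrable_on_mult_left) auto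
  then have int': "(\<lambda>s. \<kappa> s * (slope \<phi> m - \<phi>1 s)) integrable_on {t (m - 1)..ts}"
    using integrable_diff[OF _ int] by (simp add: right_diff_distrib)
  have "\<bar>integral {t (m - 1)..ts} (\<lambda>s. \<kappa> s * (slope \<phi> m - \<phi>1 s))\<bar>
      \<le> 2 * B * (\<tau> m)\<^sup>2 * (ts - t (m - 1)) powr (1 - \<alpha>) / (1 - \<alpha>)"
  proof (rule last_interval_error[OF int', where p = "\<phi>2 (t m)"])
    fix s assume "s \<in> {t (m - 1)<..<ts}"
    then have "s \<in> ?I" using ts_bounds by auto
    then show "\<bar>slope \<phi> m - \<phi>1 s + \<phi>2 (t m) * (s - (t (m - 1) + t m) / 2)\<bar> \<le> 2 * B * (\<tau> m)\<^sup>2"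
      by (rule slope_error[OF e1 e2])
  qed
  also have "\<dots> \<le> 2 * B * (\<tau> m)\<^sup>2 * \<tau> m powr (1 - \<alpha>) / (1 - \<alpha>)"
    using alpha_range B0 ts_bounds tau by (intro divide_right_mono mult_left_mono powr_mono2) auto
  also have "(\<tau> m)\<^sup>2 * \<tau> m powr (1 - \<alpha>) = \<tau> m powr (3 - \<alpha>)"
    using tau powr_add[of "\<tau> m" 2 "1 - \<alpha>"] by (simp add: powr_realpow)
  then have "2 * B * (\<tau> m)\<^sup>2 * \<tau> m powr (1 - \<alpha>) / (1 - \<alpha>)
      = 2 * 2 powr (r * (3 - \<sigma>)) / (1 - \<alpha>) * (K * (\<tau> m powr (3 - \<alpha>) * (t m + a) powr (\<sigma> - 3)))"
    unfolding B_def by (simp add: mult_ac)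
  finally show thesis using that[OF integrable_integral[OF int']] by simp
qed

text \<open>Covers inner steps and the last step alike: 4 from interpolation times
  \<open>(2 * step_const) ^ 3\<close> for the length of two adjacent steps, a power of 2 for moving
  the weight to the mesh point, and \<open>1 / (1 - \<alpha>)\<close> from the kernel integral over
  the last step.\<close>

definition trunc_const where
  "trunc_const \<sigma> = 32 * step_const ^ 3 * 2 powr (r * (3 - \<sigma>)) / (1 - \<alpha>)"

definition sum_const where
  "sum_const \<sigma> = 16 * r ^ 3 * 2 powr \<bar>\<sigma> - 3 / r\<bar>"

text \<open>Serves two purposes: barriers, with a shift of at least \<open>t1\<close> and smoothness
  up to 0, and the exact solution, with \<open>a = 0\<close>, smoothness on a half-open interval and
  the first step supplied by \<open>first\<close>. The constant \<open>C\<close> is left free so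
  that it can dominate that first-step bound too.\<close>

lemma truncation_graded:
  fixes \<phi> :: "real \<Rightarrow> real"
  assumes a: "0 \<le> a" "t1 \<le> a \<or> 2 \<le> m" and \<sigma>: "\<sigma> \<le> 3" and K: "0 \<le> K" and C: "trunc_const \<sigma> \<le> C"
    and cont: "continuous_on {0..t m} \<phi>"
    and Z: "Z = (if t1 \<le> a then {0..t m} else {0<..t m})"
    and d: "\<And>s. s \<in> Z \<Longrightarrow> (\<phi> has_real_derivative \<phi>1 s) (at s within Z)"
      "\<And>s. s \<in> Z \<Longrightarrow> (\<phi>1 has_real_derivative \<phi>2 s) (at s within Z)"
      "\<And>s. s \<in> Z \<Longrightarrow> (\<phi>2 has_real_derivative \<phi>3 s) (at s within Z)"
    and b: "\<And>s. s \<in> Z \<Longrightarrow> \<bar>\<phi>3 s\<bar> \<le> K * (s + a) powr (\<sigma> - 3)"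
    and int: "(\<lambda>s. \<kappa> s * \<phi>1 s) integrable_on {t (m - 1)..ts}"
    and first: "\<And>s. \<not> t1 \<le> a \<Longrightarrow> s \<in> {0..t 1} \<Longrightarrow>
      \<bar>quad \<phi> 1 s - \<phi> s\<bar> \<le> C * (K * (\<tau> 1 ^ 3 * (t 1 + a) powr (\<sigma> - 3)))"
  obtains E where
    "((\<lambda>s. \<kappa> s * \<phi>1 s) has_integral (\<Sum>j=1..m. g j * (\<phi> (t j) - \<phi> (t (j - 1)))) - E) {0..ts}"
    "\<bar>E\<bar> \<le> C * K * (sum_const \<sigma> * t1 powr (3 / r) *
      ((t m + a) powr (\<sigma> - 3 / r) * \<tau> m powr (-\<alpha>)
        + t m powr (-\<alpha> - 1) * (\<Sum>j\<in>{1..<m}. \<tau> j * (t j + a) powr (\<sigma> - 3 / r))))"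
proof -
  have tZ: "{t (j - 1)..t k} \<subseteq> Z" if "t1 \<le> a \<or> 2 \<le> j" "k \<le> m" for j k
  proof -
    have "2 \<le> j \<Longrightarrow> 0 < t (j - 1)" by (intro t_pos) auto
    then show ?thesis
      using t_le[OF that(2)] t_le[of 0 "j - 1"] t0 that(1) by (auto simp: Z split: if_splits)
  qed
  have sc: "1 \<le> step_const ^ 3" using step_const by (rule one_le_power)
  have sc0: "0 \<le> 32 * step_const ^ 3 * 2 powr (r * (3 - \<sigma>))"
    using step_const by (intro mult_nonneg_nonneg) auto
  have c1: "32 * step_const ^ 3 * 2 powr (r * (3 - \<sigma>)) \<le> C"
  proof -
    have "32 * step_const ^ 3 * 2 powr (r * (3 - \<sigma>)) * 1
        \<le> 32 * step_const ^ 3 * 2 powr (r * (3 - \<sigma>)) * (1 / (1 - \<alpha>))"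
      using alpha_range by (intro mult_left_mono sc0) auto
    then show ?thesis using C by (simp add: trunc_const_def)
  qed
  have c2: "2 * 2 powr (r * (3 - \<sigma>)) / (1 - \<alpha>) \<le> C"
  proof -
    have "2 * 2 powr (r * (3 - \<sigma>)) / (1 - \<alpha>) \<le> 32 * step_const ^ 3 * 2 powr (r * (3 - \<sigma>)) / (1 - \<alpha>)"
      using alpha_range sc by (intro divide_right_mono mult_right_mono) auto
    then show ?thesis using C by (simp add: trunc_const_def)
  qed
  have w: "0 \<le> K * (\<tau> j ^ 3 * (t j + a) powr (\<sigma> - 3))" if "1 \<le> j" for j
    using K tau_pos[OF that] by simp
  have S: "\<bar>quad \<phi> j s - \<phi> s\<bar> \<le> C * (K * (\<tau> j ^ 3 * (t j + a) powr (\<sigma> - 3)))"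
    if j: "1 \<le> j" "j < m" "s \<in> {t (j - 1)..t j}" for j s
  proof (cases "t1 \<le> a \<or> 2 \<le> j")
    case True
    have "\<bar>quad \<phi> j s - \<phi> s\<bar> \<le> 32 * step_const ^ 3 * 2 powr (r * (3 - \<sigma>)) * (K * (\<tau> j ^ 3 * (t j + a) powr (\<sigma> - 3)))"
      using quad_error_graded[OF j(1) a(1) True \<sigma> K tZ[OF True] d b j(3)] j(2) by simp
    also have "\<dots> \<le> C * (K * (\<tau> j ^ 3 * (t j + a) powr (\<sigma> - 3)))"
      by (rule mult_right_mono[OF c1 w[OF j(1)]])
    finally show ?thesis .
  next
    case False
    then have "j = 1" using j by auto
    then show ?thesis using first[of s] False j t0 by auto
  qed
  obtain R where R: "((\<lambda>s. \<kappa> s * (slope \<phi> m - \<phi>1 s)) has_integral R) {t (m - 1)..ts}"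
    "\<bar>R\<bar> \<le> 2 * 2 powr (r * (3 - \<sigma>)) / (1 - \<alpha>) * (K * (\<tau> m powr (3 - \<alpha>) * (t m + a) powr (\<sigma> - 3)))"
    using last_interval_graded[OF a \<sigma> K tZ[OF a(2) order_refl] d b int] by blast
  have R': "\<bar>R\<bar> \<le> C * (K * (\<tau> m powr (3 - \<alpha>) * (t m + a) powr (\<sigma> - 3)))"
    by (rule order_trans[OF R(2)]) (rule mult_right_mono[OF c2], use K in simp)
  have cont': "continuous_on {0..ts} \<phi>" using ts_bounds by (intro continuous_on_subset[OF cont]) auto
  have deriv: "(\<phi> has_real_derivative \<phi>1 s) (at s)" if "0 < s" "s < ts" for s
  proof -
    have s: "s \<in> {0<..<t m}" "{0<..<t m} \<subseteq> Z" using that ts_bounds by (auto simp: Z)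
    have "(\<phi> has_real_derivative \<phi>1 s) (at s within {0<..<t m})"
      using s d(1) by (meson DERIV_subset subsetD)
    then show ?thesis using s(1) at_within_open[of s "{0<..<t m}"] by simp
  qed
  obtain E where E: "((\<lambda>s. \<kappa> s * \<phi>1 s) has_integral (\<Sum>j=1..m. g j * (\<phi> (t j) - \<phi> (t (j - 1)))) - E) {0..ts}"
    "\<bar>E\<bar> \<le> (\<Sum>j\<in>{1..<m}. C * (K * (\<tau> j ^ 3 * (t j + a) powr (\<sigma> - 3))) * (\<kappa> (t j) - \<kappa> (t (j - 1)))) + \<bar>R\<bar>"
    using truncation_error[OF cont' deriv S R(1)] by blast
  have "\<bar>E\<bar> \<le> C * K * ((\<Sum>j\<in>{1..<m}. \<tau> j ^ 3 * (t j + a) powr (\<sigma> - 3) * (\<kappa> (t j) - \<kappa> (t (j - 1))))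
      + \<tau> m powr (3 - \<alpha>) * (t m + a) powr (\<sigma> - 3))"
    using E(2) R' by (simp add: distrib_left sum_distrib_left mult.assoc)
  also have "\<dots> \<le> C * K * (sum_const \<sigma> * t1 powr (3 / r) *
      ((t m + a) powr (\<sigma> - 3 / r) * \<tau> m powr (-\<alpha>)
        + t m powr (-\<alpha> - 1) * (\<Sum>j\<in>{1..<m}. \<tau> j * (t j + a) powr (\<sigma> - 3 / r))))"
  proof (rule mult_left_mono)
    show "0 \<le> C * K" using c1 sc0 K by simp
  qed (unfold sum_const_def, rule truncation_sum_bound[OF a(1)])
  finally show thesis using that E(1) by blast
qed

end

section \<open>Barriers\<close>

text \<open>On one step the right-endpoint rule for a nonincreasing power stays below its integral;
  the three claims correspond to the three shapes of the antiderivative.\<close>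

lemma powr_step_sum:
  fixes x y \<rho> :: real
  assumes "0 \<le> x" "x < y" "\<rho> \<le> 0"
  shows "-1 < \<rho> \<Longrightarrow> (y - x) * y powr \<rho> \<le> (y powr (\<rho> + 1) - x powr (\<rho> + 1)) / (\<rho> + 1)"
    and "\<rho> < -1 \<Longrightarrow> 0 < x \<Longrightarrow> (y - x) * y powr \<rho> \<le> (x powr (\<rho> + 1) - y powr (\<rho> + 1)) / (-\<rho> - 1)"
    and "0 < x \<Longrightarrow> (y - x) / y \<le> ln y - ln x"
proof -
  have main: "\<exists>z. (y - x) * y powr \<rho> \<le> (y - x) * z powr \<rho> \<and>
      y powr (\<rho> + 1) - x powr (\<rho> + 1) = (y - x) * ((\<rho> + 1) * z powr \<rho>)"
    if "-1 < \<rho> \<or> 0 < x"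
  proof -
    have "continuous_on {x..y} (\<lambda>x. x powr (\<rho> + 1))"
      using assms that by (intro continuous_on_powr' continuous_intros) auto
    moreover have "(\<lambda>x. x powr (\<rho> + 1)) differentiable (at z)" if "x < z" for z
      using that assms(1) has_real_derivative_powr[of z "\<rho> + 1"] by (auto simp: real_differentiable_def)
    ultimately obtain l z where z: "x < z" "z < y" "((\<lambda>x. x powr (\<rho> + 1)) has_real_derivative l) (at z)"
       "y powr (\<rho> + 1) - x powr (\<rho> + 1) = (y - x) * l"
      using MVT[OF assms(2), of "\<lambda>x. x powr (\<rho> + 1)"] by blast
    have "l = (\<rho> + 1) * z powr (\<rho> + 1 - 1)"
      using z assms(1) by (intro DERIV_unique[OF z(3) has_real_derivative_powr]) auto
    moreover have "y powr \<rho> \<le> z powr \<rho>" using z assms by (intro powr_mono2') auto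
    ultimately show ?thesis using z(4) assms(2) by (intro exI[of _ z]) auto
  qed
  show "(y - x) * y powr \<rho> \<le> (y powr (\<rho> + 1) - x powr (\<rho> + 1)) / (\<rho> + 1)" if c: "-1 < \<rho>"
  proof -
    obtain z where z: "(y - x) * y powr \<rho> \<le> (y - x) * z powr \<rho>"
      "y powr (\<rho> + 1) - x powr (\<rho> + 1) = (y - x) * ((\<rho> + 1) * z powr \<rho>)" using main[OF disjI1[OF c]] by blast
    then show ?thesis using c by simp
  qed
  show "(y - x) * y powr \<rho> \<le> (x powr (\<rho> + 1) - y powr (\<rho> + 1)) / (-\<rho> - 1)" if c: "\<rho> < -1" "0 < x"
  proof -
    obtain z where z: "(y - x) * y powr \<rho> \<le> (y - x) * z powr \<rho>"
      "y powr (\<rho> + 1) - x powr (\<rho> + 1) = (y - x) * ((\<rho> + 1) * z powr \<rho>)" using main[OF disjI2[OF c(2)]] by blast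
    have "x powr (\<rho> + 1) - y powr (\<rho> + 1) = (- \<rho> - 1) * ((y - x) * z powr \<rho>)"
      using z(2) by (simp add: algebra_simps)
    then have "(x powr (\<rho> + 1) - y powr (\<rho> + 1)) / (-\<rho> - 1) = (y - x) * z powr \<rho>"
      using c by simp
    then show ?thesis using z(1) by simp
  qed
  show "(y - x) / y \<le> ln y - ln x" if "0 < x"
    using ln_le_minus_one[of "x / y"] assms that by (simp add: ln_div diff_divide_distrib)
qed

text \<open>
  The left-hand side is, up to the factor \<open>\<Gamma>(1 - \<alpha>)\<close>, the Riemann--Liouville derivative at \<open>x\<close> of the
  shifted power \<open>(s + a)\<^sup>\<sigma>\<close>. For \<open>\<sigma> = \<alpha> - 1\<close> the bound is an equality.
\<close>

lemma shifted_power_derivative: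
  fixes \<alpha> \<sigma> a x :: real
  assumes \<alpha>: "0 < \<alpha>" "\<alpha> < 1" and pos: "0 < a" "0 < x" and \<sigma>: "\<alpha> - 1 \<le> \<sigma>" "\<sigma> < 0"
  defines "\<mu> \<equiv> - \<sigma> / (1 - \<alpha>)"
  shows "(\<lambda>s. (x - s) powr (-\<alpha>) * (\<sigma> * (s + a) powr (\<sigma> - 1))) integrable_on {0..x}"
    and "(1 - \<mu>) * x powr (-\<alpha>) * (x + a) powr \<sigma> + \<mu> * (a powr (\<sigma> + 1) * x powr (-\<alpha>) / (x + a))
      \<le> a powr \<sigma> * x powr (-\<alpha>)
        + integral {0..x} (\<lambda>s. (x - s) powr (-\<alpha>) * (\<sigma> * (s + a) powr (\<sigma> - 1)))"
proof -
  define X where "X = x + a"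
  define p where "p = - \<sigma>"
  define \<eta> where "\<eta> = \<sigma> + 1 - \<alpha>"
  have X: "0 < X" "x < X" and p: "0 < p" "p + \<eta> = 1 - \<alpha>" "0 \<le> \<eta>" "\<sigma> = -p"
    using pos \<sigma> by (auto simp: X_def p_def \<eta>_def)
  have \<mu>: "\<mu> = p / (1 - \<alpha>)" "1 - \<mu> = \<eta> / (1 - \<alpha>)" "0 \<le> 1 - \<mu>"
  proof -
    show 1: "\<mu> = p / (1 - \<alpha>)" by (simp add: \<mu>_def p_def)
    have "\<eta> = (1 - \<alpha>) - p" using p(2) by linarith
    then show 2: "1 - \<mu> = \<eta> / (1 - \<alpha>)" unfolding 1 using \<alpha> by (simp add: diff_divide_distrib)
    show "0 \<le> 1 - \<mu>" unfolding 2 using p(3) \<alpha> by simp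
  qed
  have k: "((\<lambda>s. (x - s) powr (-\<alpha>)) has_integral x powr (1 - \<alpha>) / (1 - \<alpha>)) {0..x}"
    using has_integral_kernel[of \<alpha> 0 x x] \<alpha> pos by simp
  have int0: "(\<lambda>s. f s * (x - s) powr (-\<alpha>)) integrable_on {0..x}" if "continuous_on {0..x} f" for f :: "real \<Rightarrow> real"
  proof -
    have "(\<lambda>s. f s * (x - s) powr (-\<alpha>)) absolutely_integrable_on {0..x}"
    proof (rule absolutely_integrable_bounded_measurable_product_real)
      show "f \<in> borel_measurable (lebesgue_on {0..x})"
        by (intro continuous_imp_measurable_on_sets_lebesgue that) auto
      show "bounded (f ` {0..x})" using that by (intro compact_imp_bounded compact_continuous_image) auto
      show "(\<lambda>s. (x - s) powr (-\<alpha>)) absolutely_integrable_on {0..x}"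
        using k by (intro nonnegative_absolutely_integrable_1) auto
    qed auto
    then show ?thesis by (rule set_lebesgue_integral_eq_integral)
  qed
  have "continuous_on {0..x} (\<lambda>s. \<sigma> * (s + a) powr (\<sigma> - 1))"
    using pos by (intro continuous_intros) auto
  from int0[OF this] show int: "(\<lambda>s. (x - s) powr (-\<alpha>) * (\<sigma> * (s + a) powr (\<sigma> - 1))) integrable_on {0..x}"
    by (simp add: mult_ac)
  \<comment> \<open>For \<sigma> = \<alpha> - 1, where \<open>\<eta> = 0\<close>, the multiple
    \<open>p / (1 - \<alpha>)\<close> of \<open>G'\<close> is the integrand itself for
    \<open>s < x\<close>. In general the integrand is split by
    \<open>(s + a) / X + (x - s) / X = 1\<close>; of the factor
    \<open>1 - \<alpha> = p + \<eta>\<close> in the second part, the share \<open>p\<close>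
    completes the derivative of the product in \<open>G\<close>, and the share \<open>\<eta>\<close>
    is estimated by a multiple of \<open>(s + a) powr (\<sigma> - 1)\<close>, which the second term
    of \<open>G\<close> integrates.\<close>
  define G where "G s = (x - s) powr (1 - \<alpha>) * (s + a) powr \<sigma> / X + \<eta> / p * X powr (-\<alpha>) * ((s + a) powr \<sigma> - X powr \<sigma>)" for s
  define G' where "G' s = - ((1 - \<alpha>) * (x - s) powr (-\<alpha>) * (s + a) powr \<sigma> / X
      + p * (x - s) powr (1 - \<alpha>) * (s + a) powr (\<sigma> - 1) / X + \<eta> * X powr (-\<alpha>) * (s + a) powr (\<sigma> - 1))" for s
  have G: "(G' has_integral G x - G 0) {0..x}"
  proof (rule fundamental_theorem_of_calculus_interior)
    show "continuous_on {0..x} G"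
      unfolding G_def using pos \<alpha> X by (intro continuous_intros continuous_on_powr') auto
    fix s assume s: "s \<in> {0<..<x}"
    have 1: "((\<lambda>s. (x - s) powr (1 - \<alpha>)) has_real_derivative - ((1 - \<alpha>) * (x - s) powr (-\<alpha>))) (at s)"
      using s by (auto intro!: derivative_eq_intros)
    have 2: "((\<lambda>s. (s + a) powr \<sigma>) has_real_derivative - (p * (s + a) powr (\<sigma> - 1))) (at s)"
      using s pos p by (auto intro!: derivative_eq_intros)
    have "(G has_real_derivative ((- ((1 - \<alpha>) * (x - s) powr (-\<alpha>))) * (s + a) powr \<sigma>
        + (- (p * (s + a) powr (\<sigma> - 1))) * (x - s) powr (1 - \<alpha>)) / X
        + \<eta> / p * X powr (-\<alpha>) * (- (p * (s + a) powr (\<sigma> - 1)))) (at s)"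
      unfolding G_def
      by (rule DERIV_add[OF DERIV_cdivide[OF DERIV_mult[OF 1 2]] DERIV_cmult[OF DERIV_diff[OF 2 DERIV_const, simplified]]])
    also have "((- ((1 - \<alpha>) * (x - s) powr (-\<alpha>))) * (s + a) powr \<sigma>
        + (- (p * (s + a) powr (\<sigma> - 1))) * (x - s) powr (1 - \<alpha>)) / X
        + \<eta> / p * X powr (-\<alpha>) * (- (p * (s + a) powr (\<sigma> - 1))) = G' s"
      using p by (simp add: G'_def add_divide_distrib diff_divide_distrib mult_ac)
    finally show "(G has_vector_derivative G' s) (at s)"
      by (simp add: has_real_derivative_iff_has_vector_derivative)
  qed (use pos in simp)
  have G0: "G x - G 0 = - (x powr (1 - \<alpha>) * a powr \<sigma> / X + \<eta> / p * X powr (-\<alpha>) * (a powr \<sigma> - X powr \<sigma>))"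
    by (simp add: G_def X_def)
  have ineq: "G' s * (p / (1 - \<alpha>)) \<le> (x - s) powr (-\<alpha>) * (\<sigma> * (s + a) powr (\<sigma> - 1))" if s: "s \<in> {0..x}" for s
  proof (cases "s = x")
    \<comment> \<open>The kernel at \<open>s = x\<close> is \<open>0 powr (-\<alpha>) = 0\<close>,
      so the right-hand side is 0 and only the sign of \<open>G'\<close> counts.\<close>
    case True
    have "G' s \<le> 0"
      unfolding G'_def neg_le_0_iff_le using p(1,3) \<alpha> X
      by (intro add_nonneg_nonneg mult_nonneg_nonneg divide_nonneg_nonneg) auto
    then have "G' s * (p / (1 - \<alpha>)) \<le> 0" using p \<alpha> by (intro mult_nonpos_nonneg) auto
    then show ?thesis using True \<alpha> by simp
  next
    case False
    then have s': "0 \<le> s" "s < x" using s by auto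
    define u where "u = (x - s) powr (-\<alpha>)"
    define w where "w = (s + a) powr (\<sigma> - 1)"
    have uw: "0 \<le> u" "0 \<le> w" by (auto simp: u_def w_def)
    have 1: "(s + a) powr \<sigma> = (s + a) * w"
      using s' pos powr_add[of "s + a" 1 "\<sigma> - 1"] by (simp add: w_def)
    have 2: "(x - s) powr (1 - \<alpha>) = (x - s) * u"
      using s' powr_add[of "x - s" 1 "-\<alpha>"] by (simp add: u_def)
    have 3: "(x - s) / X * u \<le> X powr (-\<alpha>)"
    proof -
      have "(x - s) * u \<le> X powr (1 - \<alpha>)"
        unfolding 2[symmetric] using s' X \<alpha> by (intro powr_mono2) auto
      also have "\<dots> = X * X powr (-\<alpha>)" using X powr_add[of X 1 "-\<alpha>"] by simp
      finally show ?thesis using X by (simp add: pos_divide_le_eq mult.commute)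
    qed
    have "(s + a) / X + (x - s) / X = 1"
      using X by (simp add: X_def add.commute flip: add_divide_distrib)
    then have "(1 - \<alpha>) * (u * w) = (1 - \<alpha>) * ((s + a) / X + (x - s) / X) * (u * w)"
      by simp
    also have "\<dots> = (1 - \<alpha>) * u * ((s + a) * w) / X + p * ((x - s) * u) * w / X + \<eta> * ((x - s) / X * u) * w"
      unfolding p(2)[symmetric] by (simp add: algebra_simps add_divide_distrib diff_divide_distrib)
    also have "\<dots> \<le> (1 - \<alpha>) * u * ((s + a) * w) / X + p * ((x - s) * u) * w / X + \<eta> * X powr (-\<alpha>) * w"
      using 3 uw p by (intro add_left_mono mult_right_mono mult_left_mono) auto
    also have "\<dots> = - G' s" unfolding G'_def 1 2 u_def[symmetric] w_def[symmetric] by simp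
    finally have "(1 - \<alpha>) * (u * w) * (p / (1 - \<alpha>)) \<le> - G' s * (p / (1 - \<alpha>))"
      using p \<alpha> by (intro mult_right_mono) auto
    moreover have "(1 - \<alpha>) * (u * w) * (p / (1 - \<alpha>)) = p * (u * w)" using \<alpha> by simp
    ultimately have "G' s * (p / (1 - \<alpha>)) \<le> - (p * (u * w))"
      unfolding mult_minus_left by linarith
    moreover have "u * (\<sigma> * w) = - (p * (u * w))" by (simp add: p_def)
    ultimately show ?thesis unfolding u_def[symmetric] w_def[symmetric] by linarith
  qed
  have "(G x - G 0) * (p / (1 - \<alpha>)) \<le> integral {0..x} (\<lambda>s. (x - s) powr (-\<alpha>) * (\<sigma> * (s + a) powr (\<sigma> - 1)))"
    using has_integral_le[OF has_integral_mult_left[OF G] integrable_integral[OF int] ineq] by simp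
  moreover have "(G x - G 0) * (p / (1 - \<alpha>)) =
      - (\<mu> * (x / X) * x powr (-\<alpha>) * a powr \<sigma>) - (1 - \<mu>) * X powr (-\<alpha>) * (a powr \<sigma> - X powr \<sigma>)"
  proof -
    have "x powr (1 - \<alpha>) = x * x powr (-\<alpha>)" using pos powr_add[of x 1 "-\<alpha>"] by simp
    moreover have "- (A + e / p * Y * Z) * (p / b) = - (p / b * A) - e / b * Y * Z" if "b \<noteq> 0" for A e Y Z b :: real
      using p(1) that by (simp add: field_simps)
    moreover have "1 - \<alpha> \<noteq> 0" using \<alpha> by simp
    ultimately show ?thesis unfolding G0 \<mu>(2) unfolding \<mu>(1) by (simp only:) (simp add: mult_ac)
  qed
  moreover have "(1 - \<mu>) * X powr (-\<alpha>) * (a powr \<sigma> - X powr \<sigma>) \<le> (1 - \<mu>) * x powr (-\<alpha>) * (a powr \<sigma> - X powr \<sigma>)"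
  proof -
    have "X powr \<sigma> \<le> a powr \<sigma>" using pos \<sigma> by (intro powr_mono2') (auto simp: X_def)
    moreover have "X powr (-\<alpha>) \<le> x powr (-\<alpha>)" using pos X \<alpha> by (intro powr_mono2') auto
    ultimately show ?thesis using \<mu>(3) by (intro mult_right_mono mult_left_mono) auto
  qed
  moreover have "a powr \<sigma> * x powr (-\<alpha>) - \<mu> * (x / X) * x powr (-\<alpha>) * a powr \<sigma>
      - (1 - \<mu>) * x powr (-\<alpha>) * (a powr \<sigma> - X powr \<sigma>)
      = (1 - \<mu>) * x powr (-\<alpha>) * X powr \<sigma> + \<mu> * (a powr (\<sigma> + 1) * x powr (-\<alpha>) / X)"
  proof -
    have "x / X = 1 - a / X" using X by (simp add: X_def field_simps)
    moreover have "a powr (\<sigma> + 1) = a * a powr \<sigma>" using pos by (simp add: powr_add)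
    ultimately show ?thesis by (simp only:) (simp add: algebra_simps)
  qed
  ultimately show "(1 - \<mu>) * x powr (-\<alpha>) * (x + a) powr \<sigma> + \<mu> * (a powr (\<sigma> + 1) * x powr (-\<alpha>) / (x + a))
      \<le> a powr \<sigma> * x powr (-\<alpha>)
        + integral {0..x} (\<lambda>s. (x - s) powr (-\<alpha>) * (\<sigma> * (s + a) powr (\<sigma> - 1)))"
    unfolding X_def[symmetric] by linarith
qed

section \<open>The discrete operator on scalar sequences\<close>

context alikhanov_mesh
begin

definition disc_op :: "(nat \<Rightarrow> real) \<Rightarrow> real" where
  "disc_op B = (\<Sum>j=1..m. g j * (B j - B (j - 1)))"

lemma disc_op_sum: "disc_op (\<lambda>j. \<Sum>p\<in>P. w p * B p j) = (\<Sum>p\<in>P. w p * disc_op (B p))"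
proof -
  have "disc_op (\<lambda>j. \<Sum>p\<in>P. w p * B p j) = (\<Sum>j=1..m. \<Sum>p\<in>P. w p * (g j * (B p j - B p (j - 1))))"
    by (simp add: disc_op_def sum_subtractf[symmetric] sum_distrib_left algebra_simps)
  also have "\<dots> = (\<Sum>p\<in>P. w p * disc_op (B p))"
    unfolding disc_op_def sum_distrib_left by (rule sum.swap)
  finally show ?thesis .
qed

text \<open>The added \<open>g 1 * B 0\<close> is the discrete form of the term by which
  Riemann-Liouville and Caputo derivatives differ. It is what makes a decreasing sequence usable as
  a barrier, since the sum of its weighted increments is negative.\<close>

lemma disc_op_jump:
  "disc_op (\<lambda>j. if j = 0 then 0 else B j) = (\<Sum>j=1..m. g j * (B j - B (j - 1))) + g 1 * B 0"
proof -
  have "g j * ((if j = 0 then 0 else B j) - (if j - 1 = 0 then 0 else B (j - 1)))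
      = g j * (B j - B (j - 1)) + (if j = 1 then g 1 * B 0 else 0)" if "j \<in> {1..m}" for j
    using that by (cases "j = 1") (auto simp: algebra_simps)
  then have "disc_op (\<lambda>j. if j = 0 then 0 else B j) =
      (\<Sum>j=1..m. g j * (B j - B (j - 1))) + (\<Sum>j=1..m. if j = 1 then g 1 * B 0 else 0)"
    unfolding disc_op_def sum.distrib[symmetric] by (intro sum.cong) auto
  then show ?thesis using m by simp
qed

end

section \<open>Weighted sums of powers over the graded mesh\<close>

lemma sum_telescope_le:
  fixes F :: "nat \<Rightarrow> real"
  assumes "\<And>j. j \<in> {1..n} \<Longrightarrow> f j \<le> F j - F (j - 1)"
  shows "(\<Sum>j=1..n. f j) \<le> F n - F 0"
proof -
  have "(\<Sum>j=1..n. f j) \<le> (\<Sum>j=1..n. F j - F (j - 1))" using assms by (rule sum_mono)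
  also have "\<dots> = F n - F 0" by (induction n) auto
  finally show ?thesis .
qed

context alikhanov_graded
begin

lemma sum_tau: "(\<Sum>j=1..n. \<tau> j) = t n"
  using sum_Suc_diff'[of 0 n t] sum.shift_bounds_Suc_ivl[of "\<lambda>j. t j - t (j - 1)" 0 n] t0
  by (simp add: \<tau>_def atLeastLessThanSuc_atLeastAtMost)

lemma sum_power_nonneg:
  assumes "0 \<le> \<rho>"
  shows "(\<Sum>j=1..n. \<tau> j * t j powr \<rho>) \<le> t n powr (\<rho> + 1)"
proof -
  have "\<tau> j * t j powr \<rho> \<le> \<tau> j * t n powr \<rho>" if "j \<in> {1..n}" for j
    using that tau_pos[of j] t_pos[of j] t_le[of j n] assms by (intro mult_left_mono powr_mono2) auto
  then have "(\<Sum>j=1..n. \<tau> j * t j powr \<rho>) \<le> (\<Sum>j=1..n. \<tau> j * t n powr \<rho>)" by (rule sum_mono)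
  also have "\<dots> = t n * t n powr \<rho>" by (simp add: sum_distrib_right[symmetric] sum_tau[unfolded One_nat_def])
  also have "\<dots> = t n powr (\<rho> + 1)"
    using t_le[of 0 n] t0 powr_add[of "t n" \<rho> 1] by (cases "t n = 0") auto
  finally show ?thesis .
qed

lemma sum_power_gt:
  assumes "-1 < \<rho>"
  shows "(\<Sum>j=1..n. \<tau> j * t j powr \<rho>) \<le> (1 + 1 / (\<rho> + 1)) * t n powr (\<rho> + 1)"
proof (cases "0 \<le> \<rho>")
  case True
  have "1 * t n powr (\<rho> + 1) \<le> (1 + 1 / (\<rho> + 1)) * t n powr (\<rho> + 1)"
    using True by (intro mult_right_mono) auto
  then show ?thesis using sum_power_nonneg[OF True, of n] by simp
next
  case False
  have "(\<Sum>j=1..n. \<tau> j * t j powr \<rho>) \<le> t n powr (\<rho> + 1) / (\<rho> + 1) - t 0 powr (\<rho> + 1) / (\<rho> + 1)"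
  proof (rule sum_telescope_le)
    fix j assume "j \<in> {1..n}"
    then show "\<tau> j * t j powr \<rho> \<le> t j powr (\<rho> + 1) / (\<rho> + 1) - t (j - 1) powr (\<rho> + 1) / (\<rho> + 1)"
      using powr_step_sum(1)[of "t (j - 1)" "t j" \<rho>] t_le[of 0 "j - 1"] t_less[of "j - 1" j] t0 False assms
      by (simp add: \<tau>_def diff_divide_distrib)
  qed
  also have "\<dots> \<le> (1 + 1 / (\<rho> + 1)) * t n powr (\<rho> + 1)"
    using assms t0 by (simp add: distrib_right)
  finally show ?thesis .
qed

lemma sum_power_lt:
  assumes "\<rho> < -1" "1 \<le> n"
  shows "(\<Sum>j=1..n. \<tau> j * t j powr \<rho>) \<le> (1 + 1 / (-\<rho> - 1)) * t1 powr (\<rho> + 1)"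
proof -
  \<comment> \<open>\<open>max 1 j\<close> avoids the default value of a power at
    \<open>t 0 = 0\<close>, and the extra term at \<open>j = 0\<close> makes the first difference of
    \<open>F\<close> equal to the first summand.\<close>
  define F where "F j = (if j = 0 then - (t1 powr (\<rho> + 1)) else 0) - (t (max 1 j) powr (\<rho> + 1)) / (-\<rho> - 1)" for j
  have "(\<Sum>j=1..n. \<tau> j * t j powr \<rho>) \<le> F n - F 0"
  proof (rule sum_telescope_le)
    fix j assume j: "j \<in> {1..n}"
    show "\<tau> j * t j powr \<rho> \<le> F j - F (j - 1)"
    proof (cases "j = 1")
      case True
      have "t1 * t1 powr \<rho> = t1 powr (\<rho> + 1)" using t1 by (simp add: powr_add)
      then show ?thesis using True t0 by (simp add: F_def \<tau>_def t_1[unfolded One_nat_def])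
    next
      case False
      then have "0 < t (j - 1)" using j by (intro t_pos) auto
      moreover have "max 1 j = j" "max 1 (j - 1) = j - 1" "j \<noteq> 0" "j - 1 \<noteq> 0" using False j by auto
      ultimately show ?thesis
        using powr_step_sum(2)[of "t (j - 1)" "t j" \<rho>] t_less[of "j - 1" j] j assms
        by (simp add: F_def \<tau>_def diff_divide_distrib)
    qed
  qed
  also have "F n - F 0 \<le> t1 powr (\<rho> + 1) + t1 powr (\<rho> + 1) / (-\<rho> - 1)"
    using assms by (simp add: F_def t_1[unfolded One_nat_def])
  finally show ?thesis by (simp add: distrib_right)
qed

lemma sum_power_eq:
  assumes "1 \<le> n"
  shows "(\<Sum>j=1..n. \<tau> j * t j powr (-1)) \<le> 1 + ln (t n / t1)"
proof -
  define F where "F j = (if j = 0 then -1 else 0) + ln (t (max 1 j))" for j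
  have "(\<Sum>j=1..n. \<tau> j * t j powr (-1)) \<le> F n - F 0"
  proof (rule sum_telescope_le)
    fix j assume j: "j \<in> {1..n}"
    then have tj: "0 < t j" by (intro t_pos) auto
    show "\<tau> j * t j powr (-1) \<le> F j - F (j - 1)"
    proof (cases "j = 1")
      case True
      then show ?thesis using t0 t1 by (simp add: F_def \<tau>_def t_1[unfolded One_nat_def] powr_minus)
    next
      case False
      then have "0 < t (j - 1)" using j by (intro t_pos) auto
      moreover have "max 1 j = j" "max 1 (j - 1) = j - 1" "j \<noteq> 0" "j - 1 \<noteq> 0" using False j by auto
      ultimately show ?thesis
        using powr_step_sum(3)[of "t (j - 1)" "t j" 0] t_less[of "j - 1" j] j tj
        by (simp add: F_def \<tau>_def powr_minus divide_inverse)
    qed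
  qed
  also have "F n - F 0 = 1 + ln (t n / t1)"
    using assms t_pos[of n] t1 by (simp add: F_def t_1[unfolded One_nat_def] ln_div max_def)
  finally show ?thesis .
qed

text \<open>Dropping the subtracted power at \<open>t m + a\<close> would lose the factor
  \<open>t m / (t m + a)\<close>. It is kept by comparing \<open>x\<close> with
  \<open>x powr (1 - \<alpha>)\<close> for \<open>x = a / (t m + a)\<close>;
  \<open>critical_barrier\<close> needs it to cancel one power of \<open>t m\<close>.\<close>

lemma sum_shifted_power:
  assumes "0 < a"
  shows "(\<Sum>j\<in>{1..<m}. \<tau> j * (t j + a) powr (\<alpha> - 2)) \<le> a powr (\<alpha> - 1) * (t m / (t m + a)) / (1 - \<alpha>)"
proof -
  let ?F = "\<lambda>j. - ((t j + a) powr (\<alpha> - 1) / (1 - \<alpha>))"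
  have "(\<Sum>j=1..m - 1. \<tau> j * (t j + a) powr (\<alpha> - 2)) \<le> ?F (m - 1) - ?F 0"
  proof (rule sum_telescope_le)
    fix j assume "j \<in> {1..m - 1}"
    then have j: "0 \<le> t (j - 1)" "t (j - 1) < t j" using t_le[of 0 "j - 1"] t0 t_less[of "j - 1" j] by auto
    have e: "\<alpha> - 2 + 1 = \<alpha> - 1" "- (\<alpha> - 2) - 1 = 1 - \<alpha>" by auto
    show "\<tau> j * (t j + a) powr (\<alpha> - 2) \<le> ?F j - ?F (j - 1)"
      using powr_step_sum(2)[of "t (j - 1) + a" "t j + a" "\<alpha> - 2", unfolded e] j assms alpha_range
      by (simp add: \<tau>_def diff_divide_distrib)
  qed
  also have "{1..m - 1} = {1..<m}" using m1 by auto
  also have "?F (m - 1) - ?F 0 = (a powr (\<alpha> - 1) - (t (m - 1) + a) powr (\<alpha> - 1)) / (1 - \<alpha>)"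
    by (simp add: t0 diff_divide_distrib)
  also have "\<dots> \<le> (a powr (\<alpha> - 1) - (t m + a) powr (\<alpha> - 1)) / (1 - \<alpha>)"
    using t_le[of "m - 1" m] t_le[of 0 "m - 1"] t0 alpha_range assms
    by (intro divide_right_mono diff_left_mono powr_mono2') auto
  also have "\<dots> \<le> a powr (\<alpha> - 1) * (t m / (t m + a)) / (1 - \<alpha>)"
  proof (rule divide_right_mono)
    define x where "x = a / (t m + a)"
    have x: "0 < x" "x \<le> 1" "t m / (t m + a) = 1 - x" using assms t_pos[OF m1] by (auto simp: x_def field_simps)
    have "x powr 1 \<le> x powr (1 - \<alpha>)" using x alpha_range by (intro powr_mono') auto
    moreover have "(t m + a) powr (\<alpha> - 1) = a powr (\<alpha> - 1) * x powr (1 - \<alpha>)"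
    proof -
      have "t m + a = a / x" using x assms by (simp add: x_def)
      moreover have "(a / x) powr (\<alpha> - 1) = a powr (\<alpha> - 1) * x powr (- (\<alpha> - 1))"
        using x assms by (simp only: powr_divide powr_minus_divide) simp
      ultimately show ?thesis by simp
    qed
    ultimately have "a powr (\<alpha> - 1) * x \<le> (t m + a) powr (\<alpha> - 1)"
      using x by (simp add: mult_left_mono)
    then show "a powr (\<alpha> - 1) - (t m + a) powr (\<alpha> - 1) \<le> a powr (\<alpha> - 1) * (t m / (t m + a))"
      unfolding x(3) by (simp add: algebra_simps)
  qed (use alpha_range in simp)
  finally show ?thesis .
qed

section \<open>Shifted powers as barriers and the absorption of their truncation error\<close>

lemma near_term:
  assumes "0 \<le> a"
  shows "t1 powr (3 / r) * ((t m + a) powr (\<sigma> - 3 / r) * \<tau> m powr (-\<alpha>))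
    \<le> t m powr (-\<alpha>) * ((t m + a) powr \<sigma> * (t1 / (t m + a)) powr ((3 - \<alpha>) / r))"
proof -
  have tm: "0 < t m" "0 < t m + a" using t_pos[OF m1] assms by auto
  have "\<tau> m powr (-\<alpha>) \<le> t m powr (-\<alpha>) * ((t m + a) / t1) powr (\<alpha> / r)"
    using tm t1 assms alpha_range r
    by (intro order_trans[OF tau_lower[OF m1]] mult_left_mono powr_mono2 divide_right_mono) auto
  then have "t1 powr (3 / r) * ((t m + a) powr (\<sigma> - 3 / r) * \<tau> m powr (-\<alpha>))
      \<le> t1 powr (3 / r) * ((t m + a) powr (\<sigma> - 3 / r) * (t m powr (-\<alpha>) * ((t m + a) / t1) powr (\<alpha> / r)))"
    by (intro mult_left_mono) auto
  also have "\<dots> = t m powr (-\<alpha>) * ((t m + a) powr \<sigma> * (t1 / (t m + a)) powr ((3 - \<alpha>) / r))"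
    using tm t1 by (simp add: powr_divide powr_diff diff_divide_distrib field_simps)
  finally show ?thesis .
qed

lemma far_term:
  assumes "0 \<le> a"
  shows "t1 powr (3 / r) * (\<Sum>j\<in>{1..<m}. \<tau> j * (t j + a) powr (\<sigma> - 3 / r))
    = (\<Sum>j\<in>{1..<m}. \<tau> j * ((t j + a) powr \<sigma> * (t1 / (t j + a)) powr (3 / r)))"
  unfolding sum_distrib_left
proof (rule sum.cong)
  fix j assume "j \<in> {1..<m}"
  then have "0 < t j + a" using t_pos[of j] assms by auto
  then show "t1 powr (3 / r) * (\<tau> j * (t j + a) powr (\<sigma> - 3 / r)) = \<tau> j * ((t j + a) powr \<sigma> * (t1 / (t j + a)) powr (3 / r))"
    using t1 by (simp add: powr_divide powr_diff)
qed simp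

text \<open>The truncation bound in terms of the ratios \<open>t1 / (t j + a)\<close>, which a large
  shift makes small. The first exponent is 3 / r lowered by \<alpha> / r, the price of
  \<open>\<tau> m powr (-\<alpha>)\<close>; the second keeps 3 / r.\<close>

definition trunc_bound where
  "trunc_bound a \<sigma> = t m powr (-\<alpha>) * ((t m + a) powr \<sigma> * (t1 / (t m + a)) powr ((3 - \<alpha>) / r))
    + t m powr (-\<alpha> - 1) * (\<Sum>j\<in>{1..<m}. \<tau> j * ((t j + a) powr \<sigma> * (t1 / (t j + a)) powr (3 / r)))"

lemma trunc_bound:
  assumes "0 \<le> a"
  shows "t1 powr (3 / r) * ((t m + a) powr (\<sigma> - 3 / r) * \<tau> m powr (-\<alpha>)
        + t m powr (-\<alpha> - 1) * (\<Sum>j\<in>{1..<m}. \<tau> j * (t j + a) powr (\<sigma> - 3 / r))) \<le> trunc_bound a \<sigma>"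
  using near_term[OF assms, of \<sigma>] far_term[OF assms, of \<sigma>]
  unfolding trunc_bound_def distrib_left mult.left_commute[of "t1 powr (3 / r)" "t m powr (-\<alpha> - 1)"] by simp

text \<open>The factor 6 bounds the coefficient
  \<open>\<sigma> * (\<sigma> - 1) * (\<sigma> - 2)\<close> of the third derivative for -1 <
  \<sigma> < 0.\<close>

definition barrier_const where "barrier_const \<sigma> = 6 * trunc_const \<sigma> * sum_const \<sigma>"

text \<open>By \<open>g_first\<close> the jump at 0 contributes at least
  \<open>ts powr (-\<alpha>) * a powr \<sigma>\<close>, the initial term of
  \<open>shifted_power_derivative\<close> at \<open>x = ts\<close>. The lower bounds obtained there
  decrease in time, so \<open>ts\<close> may be replaced by the later \<open>t m\<close>.\<close>

lemma power_barrier: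
  assumes a: "t1 \<le> a" and \<sigma>: "\<alpha> - 1 \<le> \<sigma>" "\<sigma> < 0"
  defines "\<mu> \<equiv> - \<sigma> / (1 - \<alpha>)"
  shows "(1 - \<mu>) * t m powr (-\<alpha>) * (t m + a) powr \<sigma> + \<mu> * (a powr (\<sigma> + 1) * t m powr (-\<alpha>) / (t m + a))
      - barrier_const \<sigma> * trunc_bound a \<sigma>
    \<le> disc_op (\<lambda>j. if j = 0 then 0 else (t j + a) powr \<sigma>)"
proof -
  have a0: "0 < a" using a t1 by simp
  have tm: "0 < t m" "0 < ts" using t_pos[OF m1] ts_bounds t_le[of 0 "m - 1"] t0 by auto
  have \<mu>: "0 < \<mu>" "\<mu> \<le> 1" using \<sigma> alpha_range by (auto simp: \<mu>_def field_simps)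
  let ?\<phi> = "\<lambda>s. (s + a) powr \<sigma>" and ?\<phi>1 = "\<lambda>s. \<sigma> * (s + a) powr (\<sigma> - 1)"
    and ?\<phi>2 = "\<lambda>s. \<sigma> * ((\<sigma> - 1) * (s + a) powr (\<sigma> - 2))"
    and ?\<phi>3 = "\<lambda>s. \<sigma> * ((\<sigma> - 1) * ((\<sigma> - 2) * (s + a) powr (\<sigma> - 3)))"
  have deriv: "((\<lambda>s. (s + a) powr e) has_real_derivative e * (s + a) powr (e - 1)) (at s within S)"
    if "0 \<le> s" for s e S
    by (rule has_field_derivative_at_within) (use that a0 in \<open>auto intro!: derivative_eq_intros\<close>)
  note sh = shifted_power_derivative[OF alpha_range a0 tm(2) \<sigma>]
  have int: "(\<lambda>s. \<kappa> s * ?\<phi>1 s) integrable_on {0..ts}" unfolding \<kappa>_def by (rule sh(1))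
  obtain E where E: "((\<lambda>s. \<kappa> s * ?\<phi>1 s) has_integral (\<Sum>j=1..m. g j * (?\<phi> (t j) - ?\<phi> (t (j - 1)))) - E) {0..ts}"
    "\<bar>E\<bar> \<le> trunc_const \<sigma> * 6 * (sum_const \<sigma> * t1 powr (3 / r) *
      ((t m + a) powr (\<sigma> - 3 / r) * \<tau> m powr (-\<alpha>)
        + t m powr (-\<alpha> - 1) * (\<Sum>j\<in>{1..<m}. \<tau> j * (t j + a) powr (\<sigma> - 3 / r))))"
  proof (rule truncation_graded[where \<phi> = ?\<phi> and a = a and \<sigma> = \<sigma> and K = 6 and C = "trunc_const \<sigma>" and Z = "{0..t m}"
        and ?\<phi>1.0 = ?\<phi>1 and ?\<phi>2.0 = ?\<phi>2 and ?\<phi>3.0 = ?\<phi>3])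
    show "continuous_on {0..t m} ?\<phi>" using a0 by (intro continuous_intros) auto
    show "(?\<phi> has_real_derivative ?\<phi>1 s) (at s within {0..t m})" if "s \<in> {0..t m}" for s
      using that by (intro deriv) auto
    show "(?\<phi>1 has_real_derivative ?\<phi>2 s) (at s within {0..t m})" if "s \<in> {0..t m}" for s
      using that DERIV_cmult[OF deriv[of s "\<sigma> - 1"], of \<sigma>] by (simp add: mult.assoc)
    show "(?\<phi>2 has_real_derivative ?\<phi>3 s) (at s within {0..t m})" if "s \<in> {0..t m}" for s
      using that DERIV_cmult[OF DERIV_cmult[OF deriv[of s "\<sigma> - 2"], of "\<sigma> - 1"], of \<sigma>] by (simp add: mult.assoc)
    show "\<bar>?\<phi>3 s\<bar> \<le> 6 * (s + a) powr (\<sigma> - 3)" for s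
    proof -
      have "\<bar>\<sigma>\<bar> * (\<bar>\<sigma> - 1\<bar> * (\<bar>\<sigma> - 2\<bar> * (s + a) powr (\<sigma> - 3))) \<le> 1 * (2 * (3 * (s + a) powr (\<sigma> - 3)))"
        using \<sigma> alpha_range by (intro mult_mono) auto
      then show ?thesis by (simp add: abs_mult)
    qed
    show "(\<lambda>s. \<kappa> s * ?\<phi>1 s) integrable_on {t (m - 1)..ts}"
      by (rule integrable_subinterval_real[OF int]) (use t_le[of 0 "m - 1"] t0 in auto)
  qed (use a a0 \<sigma> in \<open>auto simp del: One_nat_def\<close>)
  have "\<bar>E\<bar> \<le> barrier_const \<sigma> * (t1 powr (3 / r) *
      ((t m + a) powr (\<sigma> - 3 / r) * \<tau> m powr (-\<alpha>)
        + t m powr (-\<alpha> - 1) * (\<Sum>j\<in>{1..<m}. \<tau> j * (t j + a) powr (\<sigma> - 3 / r))))"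
    using E(2) by (simp add: barrier_const_def mult_ac)
  also have "\<dots> \<le> barrier_const \<sigma> * trunc_bound a \<sigma>"
  proof (rule mult_left_mono[OF trunc_bound])
    have "0 \<le> step_const" using step_const by simp
    then show "0 \<le> barrier_const \<sigma>"
      unfolding barrier_const_def trunc_const_def sum_const_def
      using r alpha_range by (intro mult_nonneg_nonneg divide_nonneg_nonneg) auto
  qed (use a0 in simp)
  finally have E': "- (barrier_const \<sigma> * trunc_bound a \<sigma>) \<le> E" by simp
  have k0: "\<kappa> 0 = ts powr (-\<alpha>)" by (simp add: \<kappa>_def)
  have "disc_op (\<lambda>j. if j = 0 then 0 else ?\<phi> (t j)) = integral {0..ts} (\<lambda>s. \<kappa> s * ?\<phi>1 s) + E + g 1 * a powr \<sigma>"
    unfolding integral_unique[OF E(1)] by (subst disc_op_jump) (simp add: t0)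
  also have "\<dots> \<ge> integral {0..ts} (\<lambda>s. \<kappa> s * ?\<phi>1 s) + E + ts powr (-\<alpha>) * a powr \<sigma>"
    using mult_right_mono[OF g_first, of "a powr \<sigma>"] k0 by simp
  finally have 1: "integral {0..ts} (\<lambda>s. \<kappa> s * ?\<phi>1 s) + E + ts powr (-\<alpha>) * a powr \<sigma>
      \<le> disc_op (\<lambda>j. if j = 0 then 0 else ?\<phi> (t j))" .
  have 2: "(1 - \<mu>) * ts powr (-\<alpha>) * (ts + a) powr \<sigma> + \<mu> * (a powr (\<sigma> + 1) * ts powr (-\<alpha>) / (ts + a))
      \<le> a powr \<sigma> * ts powr (-\<alpha>) + integral {0..ts} (\<lambda>s. \<kappa> s * ?\<phi>1 s)"
    using sh(2) unfolding \<mu>_def[symmetric] \<kappa>_def .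
  have 3: "(1 - \<mu>) * t m powr (-\<alpha>) * (t m + a) powr \<sigma> \<le> (1 - \<mu>) * ts powr (-\<alpha>) * (ts + a) powr \<sigma>"
    using \<mu> ts_bounds(2) tm a0 \<sigma> alpha_range by (intro mult_mono mult_left_mono powr_mono2') auto
  have 4: "\<mu> * (a powr (\<sigma> + 1) * t m powr (-\<alpha>) / (t m + a)) \<le> \<mu> * (a powr (\<sigma> + 1) * ts powr (-\<alpha>) / (ts + a))"
    using \<mu> ts_bounds(2) tm a0 alpha_range by (intro mult_left_mono frac_le powr_mono2') auto
  show ?thesis using 1 2 3 4 E' by (simp add: mult.commute)
qed

text \<open>At \<sigma> = \<alpha> - 1 only the term
  \<open>a powr \<alpha> * t m powr (-\<alpha>) / (t m + a)\<close> is left, so the truncation error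
  has to show the same decay. The restriction on \<open>r\<close> makes both exponents (3 -
  \<alpha>) / r and 3 / r at least 1: the near part retains the power \<alpha> of
  \<open>t1 / (t m + a)\<close>, the far part one full power of \<open>t1 / (t j + a)\<close>, and
  both gain a negative power of \<open>N\<close>.\<close>

lemma critical_barrier:
  assumes r3: "r \<le> 3 - \<alpha>" and N: "1 \<le> N" "N * t1 \<le> a"
    and small: "barrier_const (\<alpha> - 1) * (N powr (-\<alpha>) + 1 / (N * (1 - \<alpha>))) \<le> 1 / 2"
  shows "a powr \<alpha> * t m powr (-\<alpha>) / (t m + a) / 2 \<le> disc_op (\<lambda>j. if j = 0 then 0 else (t j + a) powr (\<alpha> - 1))"
proof -
  have "t1 \<le> N * t1" using N(1) t1 by simp
  then have a: "t1 \<le> a" "0 < a" using N(2) t1 by linarith+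
  have tm: "0 < t m" "0 < t m + a" using t_pos[OF m1] a by auto
  have ra: "t1 / a \<le> 1 / N" using N a t1 by (simp add: field_simps)
  define D where "D = a powr \<alpha> * t m powr (-\<alpha>) / (t m + a)"
  have D0: "0 \<le> D" using tm by (simp add: D_def)
  have q: "1 \<le> (3 - \<alpha>) / r" using r3 r by simp
  have near: "t m powr (-\<alpha>) * ((t m + a) powr (\<alpha> - 1) * (t1 / (t m + a)) powr ((3 - \<alpha>) / r)) \<le> N powr (-\<alpha>) * D"
  proof -
    have "(t1 / (t m + a)) powr ((3 - \<alpha>) / r) \<le> (t1 / (t m + a)) powr \<alpha>"
      using tm a t1 q alpha_range by (intro powr_mono') (auto simp: field_simps)
    also have "\<dots> = (t1 / a) powr \<alpha> * (a / (t m + a)) powr \<alpha>"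
      using tm a t1 by (simp flip: powr_mult)
    also have "\<dots> \<le> (1 / N) powr \<alpha> * (a / (t m + a)) powr \<alpha>"
      using ra a t1 alpha_range by (intro mult_right_mono powr_mono2) auto
    finally have "t m powr (-\<alpha>) * ((t m + a) powr (\<alpha> - 1) * (t1 / (t m + a)) powr ((3 - \<alpha>) / r))
        \<le> t m powr (-\<alpha>) * ((t m + a) powr (\<alpha> - 1) * ((1 / N) powr \<alpha> * (a / (t m + a)) powr \<alpha>))"
      by (intro mult_left_mono) auto
    also have "\<dots> = N powr (-\<alpha>) * D"
      using tm a N by (simp add: D_def powr_divide powr_diff powr_minus_divide)
    finally show ?thesis .
  qed
  have far: "t m powr (-\<alpha> - 1) * (\<Sum>j\<in>{1..<m}. \<tau> j * ((t j + a) powr (\<alpha> - 1) * (t1 / (t j + a)) powr (3 / r)))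
      \<le> 1 / (N * (1 - \<alpha>)) * D"
  proof -
    have each: "\<tau> j * ((t j + a) powr (\<alpha> - 1) * (t1 / (t j + a)) powr (3 / r)) \<le> t1 * (\<tau> j * (t j + a) powr (\<alpha> - 2))"
      if "j \<in> {1..<m}" for j
    proof -
      have j: "0 < t j" "0 < \<tau> j" using that t_pos[of j] tau_pos[of j] by auto
      have "1 \<le> 3 / r" using r3 r alpha_range by simp
      then have "(t1 / (t j + a)) powr (3 / r) \<le> (t1 / (t j + a)) powr 1"
        using j a t1 by (intro powr_mono') (auto simp: field_simps)
      then have "\<tau> j * ((t j + a) powr (\<alpha> - 1) * (t1 / (t j + a)) powr (3 / r)) \<le> \<tau> j * ((t j + a) powr (\<alpha> - 1) * (t1 / (t j + a)))"
        using j a t1 by (intro mult_left_mono) auto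
      also have "\<dots> = t1 * (\<tau> j * (t j + a) powr (\<alpha> - 2))"
        using j a powr_add[of "t j + a" "\<alpha> - 2" 1] by simp
      finally show ?thesis .
    qed
    have "(\<Sum>j\<in>{1..<m}. \<tau> j * ((t j + a) powr (\<alpha> - 1) * (t1 / (t j + a)) powr (3 / r)))
        \<le> t1 * (\<Sum>j\<in>{1..<m}. \<tau> j * (t j + a) powr (\<alpha> - 2))"
      unfolding sum_distrib_left by (rule sum_mono) (rule each)
    also have "\<dots> \<le> t1 * (a powr (\<alpha> - 1) * (t m / (t m + a)) / (1 - \<alpha>))"
      using t1 sum_shifted_power[OF a(2)] by (intro mult_left_mono) auto
    finally have "t m powr (-\<alpha> - 1) * (\<Sum>j\<in>{1..<m}. \<tau> j * ((t j + a) powr (\<alpha> - 1) * (t1 / (t j + a)) powr (3 / r)))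
        \<le> t m powr (-\<alpha> - 1) * (t1 * (a powr (\<alpha> - 1) * (t m / (t m + a)) / (1 - \<alpha>)))"
      by (intro mult_left_mono) auto
    also have "\<dots> = (t1 / a) * (1 / (1 - \<alpha>) * D)"
    proof -
      have "t m powr (-\<alpha>) = t m powr (-\<alpha> - 1) * t m" using tm powr_add[of "t m" "-\<alpha> - 1" 1] by simp
      moreover have "a powr \<alpha> = a powr (\<alpha> - 1) * a" using a powr_add[of a "\<alpha> - 1" 1] by simp
      ultimately show ?thesis using a by (simp add: D_def mult_ac)
    qed
    also have "\<dots> \<le> (1 / N) * (1 / (1 - \<alpha>) * D)"
      using ra D0 alpha_range by (intro mult_right_mono) auto
    finally show ?thesis by simp
  qed
  have c0: "0 \<le> barrier_const (\<alpha> - 1)"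
    unfolding barrier_const_def trunc_const_def sum_const_def
    using r alpha_range step_const by (intro mult_nonneg_nonneg divide_nonneg_nonneg) auto
  have "barrier_const (\<alpha> - 1) * trunc_bound a (\<alpha> - 1)
      \<le> barrier_const (\<alpha> - 1) * (N powr (-\<alpha>) * D + 1 / (N * (1 - \<alpha>)) * D)"
    unfolding trunc_bound_def using near far c0 by (intro mult_left_mono add_mono) auto
  also have "\<dots> = barrier_const (\<alpha> - 1) * (N powr (-\<alpha>) + 1 / (N * (1 - \<alpha>))) * D" by (simp add: algebra_simps)
  also have "\<dots> \<le> 1 / 2 * D" by (rule mult_right_mono[OF small D0])
  finally have "barrier_const (\<alpha> - 1) * trunc_bound a (\<alpha> - 1) \<le> D / 2" by simp
  moreover have "D - barrier_const (\<alpha> - 1) * trunc_bound a (\<alpha> - 1)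
      \<le> disc_op (\<lambda>j. if j = 0 then 0 else (t j + a) powr (\<alpha> - 1))"
    using power_barrier[OF a(1), of "\<alpha> - 1"] alpha_range by (simp add: D_def)
  ultimately show ?thesis unfolding D_def[symmetric] by linarith
qed

text \<open>Above the critical exponent the factor \<open>1 + \<sigma> / (1 - \<alpha>)\<close> is
  positive, so the first term of \<open>power_barrier\<close> has the full size
  \<open>t m powr (-\<alpha>) * (t m + a) powr \<sigma>\<close>. Half of it pays for the truncation
  error, for every grading; the second, nonnegative term is dropped.\<close>

lemma subcritical_barrier:
  assumes \<sigma>: "\<alpha> - 1 < \<sigma>" "\<sigma> < 0" and N: "1 \<le> N"
    and small: "barrier_const \<sigma> * (N powr (-(3 - \<alpha>) / r) + N powr (-3 / r) / (\<sigma> + 1))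
      \<le> (1 + \<sigma> / (1 - \<alpha>)) / 2"
  shows "(1 + \<sigma> / (1 - \<alpha>)) / 2 * (t m powr (-\<alpha>) * (t m + N * t1) powr \<sigma>)
    \<le> disc_op (\<lambda>j. if j = 0 then 0 else (t j + N * t1) powr \<sigma>)"
proof -
  define a where "a = N * t1"
  have a: "t1 \<le> a" "0 < a" using N t1 mult_right_mono[of 1 N t1] by (auto simp: a_def)
  have tm: "0 < t m" "0 < t m + a" using t_pos[OF m1] a by auto
  define D where "D = t m powr (-\<alpha>) * (t m + a) powr \<sigma>"
  have D0: "0 \<le> D" by (simp add: D_def)
  have frac: "(t1 / (x + a)) powr e \<le> N powr (- e)" if "0 \<le> x" "0 \<le> e" for x e
  proof -
    have "t1 / (x + a) \<le> t1 / a" using that a t1 by (intro divide_left_mono) auto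
    also have "t1 / a = 1 / N" using N t1 by (simp add: a_def)
    finally have "t1 / (x + a) \<le> 1 / N" .
    then have "(t1 / (x + a)) powr e \<le> (1 / N) powr e" using that a t1 by (intro powr_mono2) auto
    then show ?thesis using N by (simp add: powr_divide powr_minus_divide)
  qed
  have near: "t m powr (-\<alpha>) * ((t m + a) powr \<sigma> * (t1 / (t m + a)) powr ((3 - \<alpha>) / r)) \<le> N powr (-(3 - \<alpha>) / r) * D"
  proof -
    have "t m powr (-\<alpha>) * ((t m + a) powr \<sigma> * (t1 / (t m + a)) powr ((3 - \<alpha>) / r))
        \<le> t m powr (-\<alpha>) * ((t m + a) powr \<sigma> * N powr (- ((3 - \<alpha>) / r)))"
      using frac[of "t m" "(3 - \<alpha>) / r"] tm r alpha_range by (intro mult_left_mono) auto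
    also have "\<dots> = N powr (- ((3 - \<alpha>) / r)) * D" by (simp only: D_def mult_ac)
    also have "- ((3 - \<alpha>) / r) = -(3 - \<alpha>) / r" by (rule minus_divide_left)
    finally show ?thesis .
  qed
  have far: "t m powr (-\<alpha> - 1) * (\<Sum>j\<in>{1..<m}. \<tau> j * ((t j + a) powr \<sigma> * (t1 / (t j + a)) powr (3 / r)))
      \<le> N powr (-3 / r) / (\<sigma> + 1) * D"
  proof -
    have each: "\<tau> j * ((t j + a) powr \<sigma> * (t1 / (t j + a)) powr (3 / r))
        \<le> N powr (-3 / r) * (t m + a) powr \<sigma> * t m powr (-\<sigma>) * (\<tau> j * t j powr \<sigma>)"
      if "j \<in> {1..m}" for j
    proof -
      have j: "0 < t j" "0 < \<tau> j" "t j \<le> t m" using that t_pos[of j] tau_pos[of j] t_le[of j m] by auto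
      \<comment> \<open>This transfers the shift from \<open>t j\<close> to \<open>t m\<close> and
        leaves the plain power \<open>t j powr \<sigma>\<close>, whose weighted sum is controlled
        since \<sigma> > -1.\<close>
      have "(t m + a) * (t j / t m) \<le> t j + a"
        using j tm a mult_left_mono[OF j(3) less_imp_le[OF a(2)]] by (simp add: field_simps)
      then have "(t j + a) powr \<sigma> \<le> ((t m + a) * (t j / t m)) powr \<sigma>"
        using j tm a \<sigma> by (intro powr_mono2') auto
      also have "\<dots> = (t m + a) powr \<sigma> * t m powr (-\<sigma>) * t j powr \<sigma>"
        using j tm by (simp add: powr_mult powr_divide powr_minus_divide)
      finally have "\<tau> j * ((t j + a) powr \<sigma> * (t1 / (t j + a)) powr (3 / r))
          \<le> \<tau> j * ((t m + a) powr \<sigma> * t m powr (-\<sigma>) * t j powr \<sigma> * N powr (- (3 / r)))"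
        using frac[of "t j" "3 / r"] j r by (intro mult_left_mono mult_mono) auto
      then show ?thesis by (simp add: mult_ac)
    qed
    have "(\<Sum>j\<in>{1..<m}. \<tau> j * ((t j + a) powr \<sigma> * (t1 / (t j + a)) powr (3 / r)))
        \<le> (\<Sum>j=1..m. \<tau> j * ((t j + a) powr \<sigma> * (t1 / (t j + a)) powr (3 / r)))"
      by (rule sum_mono2) (auto intro!: mult_nonneg_nonneg less_imp_le[OF tau_pos])
    also have "\<dots> \<le> N powr (-3 / r) * (t m + a) powr \<sigma> * t m powr (-\<sigma>) * (\<Sum>j=1..m. \<tau> j * t j powr \<sigma>)"
      unfolding sum_distrib_left by (rule sum_mono) (rule each)
    also have "(\<Sum>j=1..m. \<tau> j * t j powr \<sigma>) \<le> t m powr (\<sigma> + 1) / (\<sigma> + 1) - t 0 powr (\<sigma> + 1) / (\<sigma> + 1)"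
    proof (rule sum_telescope_le)
      fix j assume "j \<in> {1..m}"
      then show "\<tau> j * t j powr \<sigma> \<le> t j powr (\<sigma> + 1) / (\<sigma> + 1) - t (j - 1) powr (\<sigma> + 1) / (\<sigma> + 1)"
        using powr_step_sum(1)[of "t (j - 1)" "t j" \<sigma>] t_le[of 0 "j - 1"] t_less[of "j - 1" j] t0 \<sigma> alpha_range
        by (simp add: \<tau>_def diff_divide_distrib)
    qed
    finally have "(\<Sum>j\<in>{1..<m}. \<tau> j * ((t j + a) powr \<sigma> * (t1 / (t j + a)) powr (3 / r)))
        \<le> N powr (-3 / r) * (t m + a) powr \<sigma> * t m powr (-\<sigma>) * (t m powr (\<sigma> + 1) / (\<sigma> + 1))"
      using t0 by (simp add: mult_left_mono)
    then have "t m powr (-\<alpha> - 1) * (\<Sum>j\<in>{1..<m}. \<tau> j * ((t j + a) powr \<sigma> * (t1 / (t j + a)) powr (3 / r)))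
        \<le> t m powr (-\<alpha> - 1) * (N powr (-3 / r) * (t m + a) powr \<sigma> * t m powr (-\<sigma>) * (t m powr (\<sigma> + 1) / (\<sigma> + 1)))"
      by (intro mult_left_mono) auto
    also have "\<dots> = N powr (-3 / r) / (\<sigma> + 1) * (t m + a) powr \<sigma> * (t m powr (-\<alpha> - 1) * (t m powr (-\<sigma>) * t m powr (\<sigma> + 1)))"
      by simp
    also have "t m powr (-\<alpha> - 1) * (t m powr (-\<sigma>) * t m powr (\<sigma> + 1)) = t m powr (-\<alpha>)"
    proof -
      have "-\<alpha> - 1 + (-\<sigma> + (\<sigma> + 1)) = -\<alpha>" by simp
      then show ?thesis by (simp only: powr_add[symmetric])
    qed
    finally show ?thesis by (simp add: D_def mult_ac)
  qed
  have c0: "0 \<le> barrier_const \<sigma>"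
    unfolding barrier_const_def trunc_const_def sum_const_def
    using r alpha_range step_const by (intro mult_nonneg_nonneg divide_nonneg_nonneg) auto
  have "barrier_const \<sigma> * trunc_bound a \<sigma>
      \<le> barrier_const \<sigma> * (N powr (-(3 - \<alpha>) / r) * D + N powr (-3 / r) / (\<sigma> + 1) * D)"
    unfolding trunc_bound_def using near far c0 by (intro mult_left_mono add_mono) auto
  also have "\<dots> = barrier_const \<sigma> * (N powr (-(3 - \<alpha>) / r) + N powr (-3 / r) / (\<sigma> + 1)) * D" by (simp add: algebra_simps)
  also have "\<dots> \<le> (1 + \<sigma> / (1 - \<alpha>)) / 2 * D" by (rule mult_right_mono[OF small D0])
  finally have 1: "barrier_const \<sigma> * trunc_bound a \<sigma> \<le> (1 + \<sigma> / (1 - \<alpha>)) / 2 * D" .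
  have "0 \<le> - \<sigma> / (1 - \<alpha>) * (a powr (\<sigma> + 1) * t m powr (-\<alpha>) / (t m + a))"
    using \<sigma> alpha_range tm a by (intro mult_nonneg_nonneg divide_nonneg_nonneg) auto
  then have "(1 + \<sigma> / (1 - \<alpha>)) * D - barrier_const \<sigma> * trunc_bound a \<sigma>
      \<le> disc_op (\<lambda>j. if j = 0 then 0 else (t j + a) powr \<sigma>)"
    using power_barrier[OF a(1), of \<sigma>] \<sigma> by (simp add: D_def mult.assoc)
  moreover have "(1 + \<sigma> / (1 - \<alpha>)) / 2 * D = (1 + \<sigma> / (1 - \<alpha>)) * D / 2" by simp
  ultimately show ?thesis using 1 unfolding a_def[symmetric] D_def[symmetric] by linarith
qed

lemma constant_barrier: "t m powr (-\<alpha>) \<le> disc_op (\<lambda>j. if j = 0 then 0 else 1)"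
proof -
  have "t m powr (-\<alpha>) \<le> ts powr (-\<alpha>)"
    using ts_bounds t_le[of 0 "m - 1"] t0 alpha_range by (intro powr_mono2') auto
  also have "\<dots> \<le> g 1" using g_first by (simp add: \<kappa>_def)
  finally show ?thesis by (subst disc_op_jump) simp
qed

end

section \<open>Discrete stability\<close>

lemma ex_large:
  fixes f :: "real \<Rightarrow> real"
  assumes "(f \<longlongrightarrow> 0) at_top" "0 < e"
  obtains N where "1 \<le> N" "C * f N \<le> e"
proof -
  have "((\<lambda>N. C * f N) \<longlongrightarrow> C * 0) at_top" by (intro tendsto_intros assms)
  then have "\<forall>\<^sub>F N in at_top. C * f N < e" using assms(2) by (intro order_tendstoD(2)) auto
  then have "\<forall>\<^sub>F N in at_top. 1 \<le> N \<and> C * f N < e" using eventually_ge_at_top[of 1] by eventually_elim auto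
  then show thesis using that by (force simp: eventually_at_top_linorder)
qed

lemma summation_by_parts:
  fixes E :: "nat \<Rightarrow> 'b::real_vector"
  assumes "1 \<le> m"
  shows "(\<Sum>j=1..m. g j *\<^sub>R (E j - E (j - 1)))
    = g m *\<^sub>R E m - (\<Sum>j\<in>{1..<m}. (g (Suc j) - g j) *\<^sub>R E j) - g 1 *\<^sub>R E 0"
  using assms
proof (induction m rule: dec_induct)
  case (step n)
  then show ?case by (simp add: algebra_simps)
qed (simp add: algebra_simps)

lemma sum_split_last: "Suc k = m \<Longrightarrow> 1 \<le> k \<Longrightarrow> (\<Sum>j\<in>{1..<m}. f j) = (\<Sum>j\<in>{1..<k}. f j) + f k"
  by auto

text \<open>\<open>X\<close> and \<open>W\<close> are the errors at the last two levels and
  \<open>Z\<close> collects the rest. The condition on \<open>p\<close>, \<open>q\<close> and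
  \<open>\<theta>\<close> makes the coefficient of \<open>inner X W\<close> nonnegative, so
  Cauchy-Schwarz may be applied to it; the resulting quadratic expression in the norms then factors,
  with \<open>v\<close> as one nonnegative factor.\<close>

lemma energy_estimate:
  fixes X W Z :: "'b::real_inner"
  assumes \<theta>: "0 \<le> \<theta>" "\<theta> < 1" and pq: "0 \<le> q" "p * \<theta> \<le> q * (1 - \<theta>)"
    and nonneg: "0 \<le> inner (q *\<^sub>R W + Z - p *\<^sub>R X) (\<theta> *\<^sub>R W + (1 - \<theta>) *\<^sub>R X)"
  shows "p * norm X \<le> q * norm W + norm Z"
proof -
  define v where "v = \<theta> * norm W + (1 - \<theta>) * norm X"
  have v: "0 \<le> v" unfolding v_def using \<theta> by simp
  have "inner Z (\<theta> *\<^sub>R W + (1 - \<theta>) *\<^sub>R X) \<le> norm Z * norm (\<theta> *\<^sub>R W + (1 - \<theta>) *\<^sub>R X)"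
    by (rule norm_cauchy_schwarz)
  also have "\<dots> \<le> norm Z * v"
    unfolding v_def using norm_triangle_ineq[of "\<theta> *\<^sub>R W" "(1 - \<theta>) *\<^sub>R X"] \<theta> by (intro mult_left_mono) auto
  finally have 1: "inner Z (\<theta> *\<^sub>R W + (1 - \<theta>) *\<^sub>R X) \<le> norm Z * v" .
  have 2: "(q * (1 - \<theta>) - p * \<theta>) * inner X W \<le> (q * (1 - \<theta>) - p * \<theta>) * (norm X * norm W)"
    using pq norm_cauchy_schwarz by (intro mult_left_mono) auto
  have "inner (q *\<^sub>R W + Z - p *\<^sub>R X) (\<theta> *\<^sub>R W + (1 - \<theta>) *\<^sub>R X) =
      inner Z (\<theta> *\<^sub>R W + (1 - \<theta>) *\<^sub>R X) + q * \<theta> * (norm W * norm W)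
      + (q * (1 - \<theta>) - p * \<theta>) * inner X W - p * (1 - \<theta>) * (norm X * norm X)"
    by (simp add: inner_add_left inner_add_right inner_diff_left inner_commute[of W X]
        dot_square_norm power2_eq_square algebra_simps)
  also have "\<dots> \<le> norm Z * v + q * \<theta> * (norm W * norm W)
      + (q * (1 - \<theta>) - p * \<theta>) * (norm X * norm W) - p * (1 - \<theta>) * (norm X * norm X)"
    using 1 2 by linarith
  also have "\<dots> = (norm Z + q * norm W - p * norm X) * v"
    unfolding v_def by (simp add: algebra_simps)
  finally have *: "0 \<le> (norm Z + q * norm W - p * norm X) * v" using nonneg by linarith
  show ?thesis
  proof (cases "v = 0")
    case True
    then have "(1 - \<theta>) * norm X = 0" using \<theta> unfolding v_def by (smt (verit) mult_nonneg_nonneg norm_ge_zero)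
    then have "norm X = 0" using \<theta> by simp
    then show ?thesis using pq(1) by simp
  next
    case False
    then have "0 \<le> norm Z + q * norm W - p * norm X" using * v by (simp add: zero_le_mult_iff)
    then show ?thesis by simp
  qed
qed

text \<open>Counterpart for the first level: the error at time 0 is zero, but the pairing is
  available only with a perturbation \<open>d n\<close> that tends to 0. A uniform bound on
  \<open>\<rho> n\<close> takes the place of convergence.\<close>

lemma energy_estimate_limit:
  fixes X :: "'b::real_inner"
  assumes \<theta>: "\<theta> < 1" and p: "0 \<le> p" and d: "d \<longlonglongrightarrow> 0" and R: "\<And>n. norm (\<rho> n) \<le> R"
    and nonneg: "\<And>n::nat. 0 \<le> inner (\<rho> n - p *\<^sub>R X) (\<theta> *\<^sub>R d n + (1 - \<theta>) *\<^sub>R X)"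
  shows "p * norm X \<le> R"
proof -
  have R0: "0 \<le> R" using R[of 0] norm_ge_zero order_trans by blast
  have "p * (1 - \<theta>) * (norm X * norm X) \<le> R * ((1 - \<theta>) * norm X) + (R + p * norm X) * norm (\<theta> *\<^sub>R d n)" for n
  proof -
    have "p * (1 - \<theta>) * (norm X * norm X) = inner (p *\<^sub>R X) ((1 - \<theta>) *\<^sub>R X)"
      by (simp add: dot_square_norm power2_eq_square)
    moreover have "0 \<le> inner (\<rho> n) (\<theta> *\<^sub>R d n + (1 - \<theta>) *\<^sub>R X)
        - (inner (p *\<^sub>R X) (\<theta> *\<^sub>R d n) + inner (p *\<^sub>R X) ((1 - \<theta>) *\<^sub>R X))"
      using nonneg[of n] by (simp only: inner_diff_left inner_add_right)
    moreover have "inner (\<rho> n) (\<theta> *\<^sub>R d n + (1 - \<theta>) *\<^sub>R X) \<le> R * (norm (\<theta> *\<^sub>R d n) + (1 - \<theta>) * norm X)"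
    proof -
      have "norm (\<theta> *\<^sub>R d n + (1 - \<theta>) *\<^sub>R X) \<le> norm (\<theta> *\<^sub>R d n) + (1 - \<theta>) * norm X"
        using norm_triangle_ineq[of "\<theta> *\<^sub>R d n" "(1 - \<theta>) *\<^sub>R X"] \<theta> by simp
      then have "norm (\<rho> n) * norm (\<theta> *\<^sub>R d n + (1 - \<theta>) *\<^sub>R X) \<le> R * (norm (\<theta> *\<^sub>R d n) + (1 - \<theta>) * norm X)"
        by (intro mult_mono R R0) auto
      then show ?thesis using norm_cauchy_schwarz order_trans by blast
    qed
    moreover have "- inner (p *\<^sub>R X) (\<theta> *\<^sub>R d n) \<le> norm (p *\<^sub>R X) * norm (\<theta> *\<^sub>R d n)"
      using Cauchy_Schwarz_ineq2[of "p *\<^sub>R X" "\<theta> *\<^sub>R d n"] by linarith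
    ultimately have "p * (1 - \<theta>) * (norm X * norm X)
        \<le> R * (norm (\<theta> *\<^sub>R d n) + (1 - \<theta>) * norm X) + norm (p *\<^sub>R X) * norm (\<theta> *\<^sub>R d n)" by linarith
    also have "norm (p *\<^sub>R X) = p * norm X" using p by simp
    finally show ?thesis by (simp only: distrib_left distrib_right add_ac)
  qed
  moreover have "(\<lambda>n. R * ((1 - \<theta>) * norm X) + (R + p * norm X) * norm (\<theta> *\<^sub>R d n))
      \<longlonglongrightarrow> R * ((1 - \<theta>) * norm X) + (R + p * norm X) * norm (\<theta> *\<^sub>R (0::'b))"
    by (intro tendsto_intros d)
  ultimately have "p * (1 - \<theta>) * (norm X * norm X) \<le> R * ((1 - \<theta>) * norm X) + (R + p * norm X) * norm (\<theta> *\<^sub>R (0::'b))"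
    by (intro LIMSEQ_le_const) auto
  then have *: "((1 - \<theta>) * norm X) * (p * norm X) \<le> ((1 - \<theta>) * norm X) * R" by (simp add: mult_ac)
  show ?thesis
  proof (cases "X = 0")
    case False
    then have "0 < (1 - \<theta>) * norm X" using \<theta> by simp
    then show ?thesis using * mult_le_cancel_left_pos by blast
  qed (use R0 in simp)
qed

context alikhanov_mesh
begin

lemma disc_op_eq:
  "disc_op E = g m * E m - (\<Sum>j\<in>{1..<m}. (g (Suc j) - g j) * E j) - g 1 * E 0"
  using summation_by_parts[OF m, of g E] by (simp add: disc_op_def)

text \<open>After summation by parts the errors at earlier levels carry nonnegative coefficients, as
  the weights increase, so the triangle inequality yields exactly the scalar operator applied to the
  norms.\<close>

lemma norm_disc_op:
  fixes E :: "nat \<Rightarrow> 'b::real_inner"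
  assumes m2: "2 \<le> m" and eq: "(\<Sum>j=1..m. g j *\<^sub>R (E j - E (j - 1))) + w = \<rho>"
    and w: "0 \<le> inner w ((\<alpha> / 2) *\<^sub>R E (m - 1) + (1 - \<alpha> / 2) *\<^sub>R E m)"
  shows "disc_op (\<lambda>j. norm (E j)) \<le> norm \<rho>"
proof -
  define k where "k = m - 1"
  have k: "Suc k = m" "1 \<le> k" "k < m" using m2 by (auto simp: k_def)
  have w: "0 \<le> inner w ((\<alpha> / 2) *\<^sub>R E k + (1 - \<alpha> / 2) *\<^sub>R E m)"
    using w by (simp only: k_def)
  define Z where "Z = (\<Sum>j\<in>{1..<k}. (g (Suc j) - g j) *\<^sub>R E j) + g 1 *\<^sub>R E 0 + \<rho>"
  have "w = (g m - g k) *\<^sub>R E k + Z - g m *\<^sub>R E m"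
    using eq unfolding summation_by_parts[OF m, of g E] sum_split_last[OF k(1,2)] k(1) Z_def
    by (simp add: algebra_simps)
  note w' = w[unfolded this]
  have "g m * norm (E m) \<le> (g m - g k) * norm (E k) + norm Z"
  proof (rule energy_estimate[OF _ _ _ _ w'])
    show "0 \<le> g m - g k" using g_mono[OF k(2,3), unfolded k(1)] by simp
    show "g m * (\<alpha> / 2) \<le> (g m - g k) * (1 - \<alpha> / 2)"
      using g_ratio[OF k(2,3) k(1)[symmetric]] by (simp only: mult.commute)
  qed (use alpha in auto)
  also have "norm Z \<le> (\<Sum>j\<in>{1..<k}. (g (Suc j) - g j) * norm (E j)) + g 1 * norm (E 0) + norm \<rho>"
  proof -
    let ?S = "\<Sum>j\<in>{1..<k}. (g (Suc j) - g j) *\<^sub>R E j"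
    have "norm ?S \<le> (\<Sum>j\<in>{1..<k}. (g (Suc j) - g j) * norm (E j))"
      using k g_mono by (intro sum_norm_le) auto
    moreover have "norm (g 1 *\<^sub>R E 0) = g 1 * norm (E 0)" using g_pos[of 1] m by simp
    ultimately show ?thesis
      unfolding Z_def
      using norm_triangle_ineq[of "?S + g 1 *\<^sub>R E 0" \<rho>] norm_triangle_ineq[of ?S "g 1 *\<^sub>R E 0"] by linarith
  qed
  finally show ?thesis unfolding disc_op_eq sum_split_last[OF k(1,2)] k(1) by linarith
qed

end

text \<open>\<open>disc_op_eq\<close> expresses \<open>g k * e k\<close> as \<open>disc_op e\<close>
  plus a combination of earlier values with nonnegative coefficients, so the ordering passes from
  level to level.\<close>

lemma discrete_comparison:
  assumes mesh: "\<And>m. m \<in> {1..n} \<Longrightarrow> alikhanov_mesh \<alpha> t m"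
    and le: "\<And>m. m \<in> {1..n} \<Longrightarrow> alikhanov_mesh.disc_op \<alpha> t m e \<le> alikhanov_mesh.disc_op \<alpha> t m B"
    and e0: "e 0 \<le> B 0" and k: "k \<le> n"
  shows "e k \<le> B k"
  using k
proof (induction k rule: less_induct)
  case (less k)
  show ?case
  proof (cases "k = 0")
    case True
    then show ?thesis using e0 by simp
  next
    case False
    then have k: "k \<in> {1..n}" using less.prems by auto
    interpret alikhanov_mesh \<alpha> t k by (rule mesh[OF k])
    have "(\<Sum>j\<in>{1..<k}. (g (Suc j) - g j) * e j) \<le> (\<Sum>j\<in>{1..<k}. (g (Suc j) - g j) * B j)"
      using less g_mono by (intro sum_mono mult_left_mono) auto
    moreover have "g 1 * e 0 \<le> g 1 * B 0" using e0 g_pos[of 1] m by (intro mult_left_mono) auto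
    ultimately have "g k * e k \<le> g k * B k" using le[OF k] unfolding disc_op_eq by linarith
    then show ?thesis using g_pos[of k] m by simp
  qed
qed

context alikhanov_graded
begin

text \<open>
  A single shifted power has the right decay only for \<open>t m\<close> near the shift, so the barriers with
  shifts \<open>N * t p\<close> are superposed; a large \<open>N\<close> makes their truncation errors absorbable.
\<close>

lemma superposed_barrier:
  assumes r3: "r \<le> 3 - \<alpha>" and N: "1 \<le> N" and \<mu>: "\<alpha> \<le> \<mu>" and mn: "m \<le> n"
    and small: "barrier_const (\<alpha> - 1) * (N powr (-\<alpha>) + 1 / (N * (1 - \<alpha>))) \<le> 1 / 2"
  shows "N powr \<alpha> / (2 * (1 + N)) * t m powr (-\<mu>)
    \<le> disc_op (\<lambda>j. \<Sum>p=1..n. (\<tau> p * t p powr (-\<mu>)) * (if j = 0 then 0 else (t j + N * t p) powr (\<alpha> - 1)))"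
proof -
  have tm: "0 < t m" using t_pos m1 by blast
  have pos: "0 < t p" "0 < \<tau> p" if "1 \<le> p" for p using that t_pos tau_pos by auto
  let ?c = "\<lambda>p. (N * t p) powr \<alpha> * t m powr (-\<alpha>) / (t m + N * t p) / 2"
  have crit: "?c p \<le> disc_op (\<lambda>j. if j = 0 then 0 else (t j + N * t p) powr (\<alpha> - 1))" if "1 \<le> p" for p
    using t1_le[OF that] N by (intro critical_barrier[OF r3 N _ small] mult_left_mono) auto
  \<comment> \<open>Writing one factor \<open>t m\<close> as a sum of steps distributes the target
    over the shifts with \<open>p \<le> m\<close>. For these,
    \<open>t m + N * t p \<le> (1 + N) * t m\<close> and \<open>t m powr (\<alpha> - \<mu>) \<le> t
    p powr (\<alpha> - \<mu>)\<close>; the shifts beyond \<open>m\<close> only add nonnegative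
    amounts.\<close>
  have "N powr \<alpha> / (2 * (1 + N)) * t m powr (-\<mu>) = (\<Sum>p=1..m. \<tau> p) * (N powr \<alpha> / (2 * (1 + N)) * t m powr (-\<mu> - 1))"
    unfolding sum_tau using tm powr_add[of "t m" "-\<mu> - 1" 1] by simp
  also have "\<dots> \<le> (\<Sum>p=1..m. (\<tau> p * t p powr (-\<mu>)) * ?c p)"
    unfolding sum_distrib_right
  proof (rule sum_mono)
    fix p assume "p \<in> {1..m}"
    then have p: "0 < t p" "0 < \<tau> p" "t p \<le> t m" using pos t_le[of p m] by auto
    have "t m powr (-\<mu> - 1) = t m powr (\<alpha> - \<mu>) * t m powr (-\<alpha>) / t m"
      using tm by (simp add: powr_diff powr_minus_divide)
    also have "\<dots> \<le> t p powr (\<alpha> - \<mu>) * t m powr (-\<alpha>) / t m"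
      using p \<mu> tm by (intro divide_right_mono mult_right_mono powr_mono2') auto
    finally have "N powr \<alpha> / (2 * (1 + N)) * t m powr (-\<mu> - 1)
        \<le> N powr \<alpha> / (2 * (1 + N)) * (t p powr (\<alpha> - \<mu>) * t m powr (-\<alpha>) / t m)"
      using N by (intro mult_left_mono) auto
    also have "\<dots> = t p powr (-\<mu>) * ((N * t p) powr \<alpha> * t m powr (-\<alpha>) / ((1 + N) * t m) / 2)"
      using p by (simp add: powr_mult powr_diff powr_minus_divide)
    also have "\<dots> \<le> t p powr (-\<mu>) * ?c p"
    proof -
      have "t m + N * t p \<le> (1 + N) * t m" using p N by (simp add: distrib_right)
      moreover have "0 < t m + N * t p" using tm p N by (intro add_pos_pos mult_pos_pos) auto
      ultimately show ?thesis by (intro mult_left_mono divide_right_mono frac_le) auto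
    qed
    finally have "\<tau> p * (N powr \<alpha> / (2 * (1 + N)) * t m powr (-\<mu> - 1)) \<le> \<tau> p * (t p powr (-\<mu>) * ?c p)"
      using p(2) by (intro mult_left_mono) auto
    then show "\<tau> p * (N powr \<alpha> / (2 * (1 + N)) * t m powr (-\<mu> - 1)) \<le> (\<tau> p * t p powr (-\<mu>)) * ?c p"
      by (simp only: mult.assoc)
  qed
  also have "\<dots> \<le> (\<Sum>p=1..n. (\<tau> p * t p powr (-\<mu>)) * ?c p)"
  proof (rule sum_mono2)
    show "0 \<le> (\<tau> p * t p powr (-\<mu>)) * ?c p" if "p \<in> {1..n} - {1..m}" for p
    proof -
      have "0 < t m + N * t p" using tm pos[of p] that N by (intro add_pos_pos mult_pos_pos) auto
      then show ?thesis using pos[of p] that by (intro mult_nonneg_nonneg divide_nonneg_nonneg) auto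
    qed
  qed (use mn in auto)
  also have "\<dots> \<le> (\<Sum>p=1..n. (\<tau> p * t p powr (-\<mu>)) * disc_op (\<lambda>j. if j = 0 then 0 else (t j + N * t p) powr (\<alpha> - 1)))"
    using pos crit by (intro sum_mono mult_left_mono) (auto intro!: mult_nonneg_nonneg intro: less_imp_le)
  finally show ?thesis unfolding disc_op_sum .
qed

end

text \<open>\<open>N\<close>, and with it \<open>C\<close>, is fixed before \<open>t1\<close>,
  \<open>t\<close> and \<open>n\<close>, because \<open>barrier_const\<close> depends on \<alpha>,
  \<open>r\<close> and the exponent only. The barrier may depend on \<open>n\<close>; at level
  \<open>n\<close> each shifted power is at most \<open>t n powr (\<alpha> - 1)\<close>, which
  leaves the sum of the weights.\<close>

lemma critical_stability:
  assumes \<alpha>: "0 < \<alpha>" "\<alpha> < 1" and rr: "1 \<le> r" "r \<le> 3 - \<alpha>" and \<mu>: "\<alpha> \<le> \<mu>"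
  obtains C where "0 < C"
    "\<And>t1 t n. 0 < t1 \<Longrightarrow> (\<And>j. t j = t1 * real j powr r) \<Longrightarrow> 1 \<le> n \<Longrightarrow>
      \<exists>B. B 0 = 0 \<and> (\<forall>m\<in>{1..n}. t m powr (-\<mu>) \<le> alikhanov_mesh.disc_op \<alpha> t m B) \<and>
        B n \<le> C * t n powr (\<alpha> - 1) * (\<Sum>p=1..n. (t p - t (p - 1)) * t p powr (-\<mu>))"
proof -
  have "((\<lambda>N::real. N powr (-\<alpha>) + 1 / (N * (1 - \<alpha>))) \<longlongrightarrow> 0 + 0) at_top"
  proof (rule tendsto_add)
    show "((\<lambda>N::real. N powr (-\<alpha>)) \<longlongrightarrow> 0) at_top" using \<alpha> by (intro tendsto_neg_powr filterlim_ident) auto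
    have "((\<lambda>N::real. (1 / (1 - \<alpha>)) * inverse N) \<longlongrightarrow> (1 / (1 - \<alpha>)) * 0) at_top"
      by (intro tendsto_intros tendsto_inverse_0_at_top filterlim_ident)
    then show "((\<lambda>N::real. 1 / (N * (1 - \<alpha>))) \<longlongrightarrow> 0) at_top"
      by (simp add: divide_inverse mult.commute)
  qed
  then have "((\<lambda>N::real. N powr (-\<alpha>) + 1 / (N * (1 - \<alpha>))) \<longlongrightarrow> 0) at_top" by simp
  from ex_large[OF this, where e = "1 / 2" and C = "alikhanov_graded.barrier_const \<alpha> r (\<alpha> - 1)"]
  obtain N where N: "1 \<le> N"
    "alikhanov_graded.barrier_const \<alpha> r (\<alpha> - 1) * (N powr (-\<alpha>) + 1 / (N * (1 - \<alpha>))) \<le> 1 / 2"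
    by auto
  define c where "c = N powr \<alpha> / (2 * (1 + N))"
  have c: "0 < c" unfolding c_def using N by simp
  show thesis
  proof (rule that[of "1 / c"])
    fix t1 :: real and t :: "nat \<Rightarrow> real" and n :: nat
    assume t1: "0 < t1" and t: "\<And>j. t j = t1 * real j powr r" and n: "1 \<le> n"
    have grd: "alikhanov_graded \<alpha> r t1 t m" if "1 \<le> m" for m
      using \<alpha> rr t1 t that by unfold_locales auto
    interpret n: alikhanov_graded \<alpha> r t1 t n by (rule grd[OF n])
    define B where "B j = (\<Sum>p=1..n. (1 / c * ((t p - t (p - 1)) * t p powr (-\<mu>))) * (if j = 0 then 0 else (t j + N * t p) powr (\<alpha> - 1)))" for j
    have "t m powr (-\<mu>) \<le> alikhanov_mesh.disc_op \<alpha> t m B" if mn: "m \<in> {1..n}" for m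
    proof -
      interpret alikhanov_graded \<alpha> r t1 t m using grd mn by simp
      have "disc_op B = 1 / c * disc_op (\<lambda>j. \<Sum>p=1..n. (\<tau> p * t p powr (-\<mu>)) * (if j = 0 then 0 else (t j + N * t p) powr (\<alpha> - 1)))"
        unfolding B_def disc_op_sum \<tau>_def sum_distrib_left by (simp add: mult.assoc)
      moreover have "c * t m powr (-\<mu>) \<le> disc_op (\<lambda>j. \<Sum>p=1..n. (\<tau> p * t p powr (-\<mu>)) * (if j = 0 then 0 else (t j + N * t p) powr (\<alpha> - 1)))"
        unfolding c_def using mn by (intro superposed_barrier[OF rr(2) N(1) \<mu> _ N(2)]) auto
      then have "1 / c * (c * t m powr (-\<mu>)) \<le> 1 / c * disc_op (\<lambda>j. \<Sum>p=1..n. (\<tau> p * t p powr (-\<mu>)) * (if j = 0 then 0 else (t j + N * t p) powr (\<alpha> - 1)))"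
        using c by (intro mult_left_mono) auto
      ultimately show ?thesis using c by simp
    qed
    moreover have "B 0 = 0" by (simp add: B_def)
    moreover have "B n \<le> (\<Sum>p=1..n. (1 / c * ((t p - t (p - 1)) * t p powr (-\<mu>))) * t n powr (\<alpha> - 1))"
      unfolding B_def
    proof (rule sum_mono)
      fix p assume "p \<in> {1..n}"
      then have p: "0 < t p - t (p - 1)" "0 < t p" using n.tau_pos[of p] n.t_pos[of p] by (auto simp: n.\<tau>_def)
      have "(t n + N * t p) powr (\<alpha> - 1) \<le> t n powr (\<alpha> - 1)"
        using n.t_pos[OF n] p N \<alpha> by (intro powr_mono2') auto
      then show "(1 / c * ((t p - t (p - 1)) * t p powr (-\<mu>))) * (if n = 0 then 0 else (t n + N * t p) powr (\<alpha> - 1))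
          \<le> (1 / c * ((t p - t (p - 1)) * t p powr (-\<mu>))) * t n powr (\<alpha> - 1)"
        using p c by (intro mult_left_mono) auto
    qed
    then have "B n \<le> 1 / c * t n powr (\<alpha> - 1) * (\<Sum>p=1..n. (t p - t (p - 1)) * t p powr (-\<mu>))"
      by (simp add: sum_distrib_left mult_ac)
    ultimately show "\<exists>B. B 0 = 0 \<and> (\<forall>m\<in>{1..n}. t m powr (-\<mu>) \<le> alikhanov_mesh.disc_op \<alpha> t m B) \<and>
        B n \<le> 1 / c * t n powr (\<alpha> - 1) * (\<Sum>p=1..n. (t p - t (p - 1)) * t p powr (-\<mu>))" by blast
  qed (use c in simp)
qed

lemma (in alikhanov_mesh) disc_op_scale: "disc_op (\<lambda>j. c * B j) = c * disc_op B"
  by (simp add: disc_op_def sum_distrib_left algebra_simps)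

text \<open>For \<mu> \<le> \<alpha> a jump of height \<open>t n powr (\<alpha> - \<mu>)\<close>
  suffices. Otherwise one shifted power with exponent \<alpha> - \<mu>, above the critical value,
  and shift \<open>N * t1\<close> is enough: since \<open>t1 \<le> t m\<close>, it is comparable
  with the unshifted power.\<close>

lemma subcritical_stability:
  assumes \<alpha>: "0 < \<alpha>" "\<alpha> < 1" and r: "1 \<le> r" and \<mu>: "\<mu> < 1"
  obtains C where "0 < C"
    "\<And>t1 t n. 0 < t1 \<Longrightarrow> (\<And>j. t j = t1 * real j powr r) \<Longrightarrow> 1 \<le> n \<Longrightarrow>
      \<exists>B. B 0 = 0 \<and> (\<forall>m\<in>{1..n}. t m powr (-\<mu>) \<le> alikhanov_mesh.disc_op \<alpha> t m B) \<and>
        B n \<le> C * t n powr (\<alpha> - \<mu>)"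
proof (cases "\<mu> \<le> \<alpha>")
  case True
  show thesis
  proof (rule that[of 1])
    fix t1 :: real and t :: "nat \<Rightarrow> real" and n :: nat
    assume t1: "0 < t1" and t: "\<And>j. t j = t1 * real j powr r" and n: "1 \<le> n"
    have grd: "alikhanov_graded \<alpha> r t1 t m" if "1 \<le> m" for m
      using \<alpha> r t1 t that by unfold_locales auto
    let ?B = "\<lambda>j. t n powr (\<alpha> - \<mu>) * (if j = 0 then 0 else 1)"
    have "t m powr (-\<mu>) \<le> alikhanov_mesh.disc_op \<alpha> t m ?B" if mn: "m \<in> {1..n}" for m
    proof -
      interpret alikhanov_graded \<alpha> r t1 t m using grd mn by simp
      have "t m powr (-\<mu>) = t m powr (\<alpha> - \<mu>) * t m powr (-\<alpha>)" by (simp flip: powr_add)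
      also have "\<dots> \<le> t n powr (\<alpha> - \<mu>) * disc_op (\<lambda>j. if j = 0 then 0 else 1)"
      proof -
        have "t m \<le> t n" using mn by (intro t_le) auto
        then show ?thesis using True t_pos[OF m1] by (intro mult_mono powr_mono2 constant_barrier) auto
      qed
      finally show ?thesis unfolding disc_op_scale .
    qed
    then show "\<exists>B. B 0 = 0 \<and> (\<forall>m\<in>{1..n}. t m powr (-\<mu>) \<le> alikhanov_mesh.disc_op \<alpha> t m B) \<and>
        B n \<le> 1 * t n powr (\<alpha> - \<mu>)"
      using n by (intro exI[of _ ?B]) auto
  qed simp
next
  case False
  define \<sigma> where "\<sigma> = \<alpha> - \<mu>"
  have \<sigma>: "\<alpha> - 1 < \<sigma>" "\<sigma> < 0" using False \<mu> by (auto simp: \<sigma>_def)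
  define c0 where "c0 = (1 + \<sigma> / (1 - \<alpha>)) / 2"
  have c0: "0 < c0" using \<sigma> \<alpha> by (simp add: c0_def field_simps)
  have "((\<lambda>N::real. N powr (-(3 - \<alpha>) / r) + N powr (-3 / r) / (\<sigma> + 1)) \<longlongrightarrow> 0 + 0 / (\<sigma> + 1)) at_top"
    using \<alpha> r \<sigma> by (intro tendsto_add tendsto_divide tendsto_neg_powr filterlim_ident tendsto_const) (auto intro: divide_neg_pos)
  then have "((\<lambda>N::real. N powr (-(3 - \<alpha>) / r) + N powr (-3 / r) / (\<sigma> + 1)) \<longlongrightarrow> 0) at_top" by simp
  from ex_large[OF this c0, where C = "alikhanov_graded.barrier_const \<alpha> r \<sigma>"]
  obtain N where N: "1 \<le> N"
    "alikhanov_graded.barrier_const \<alpha> r \<sigma> * (N powr (-(3 - \<alpha>) / r) + N powr (-3 / r) / (\<sigma> + 1)) \<le> c0"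
    by auto
  define c where "c = c0 * (1 + N) powr \<sigma>"
  have c: "0 < c" using c0 N by (simp add: c_def)
  show thesis
  proof (rule that[of "1 / c"])
    fix t1 :: real and t :: "nat \<Rightarrow> real" and n :: nat
    assume t1: "0 < t1" and t: "\<And>j. t j = t1 * real j powr r" and n: "1 \<le> n"
    have grd: "alikhanov_graded \<alpha> r t1 t m" if "1 \<le> m" for m
      using \<alpha> r t1 t that by unfold_locales auto
    interpret n: alikhanov_graded \<alpha> r t1 t n by (rule grd[OF n])
    let ?B = "\<lambda>j. 1 / c * (if j = 0 then 0 else (t j + N * t1) powr \<sigma>)"
    have "t m powr (-\<mu>) \<le> alikhanov_mesh.disc_op \<alpha> t m ?B" if mn: "m \<in> {1..n}" for m
    proof -
      interpret alikhanov_graded \<alpha> r t1 t m using grd mn by simp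
      have tm: "0 < t m" "t m + N * t1 \<le> (1 + N) * t m" "0 < t m + N * t1"
        using t_pos[OF m1] t1_le[OF m1] N t1 by (auto simp: distrib_right intro: add_pos_pos)
      have "c * t m powr (-\<mu>) = c0 * (t m powr (-\<alpha>) * ((1 + N) * t m) powr \<sigma>)"
        using N tm by (simp add: c_def powr_mult \<sigma>_def mult_ac flip: powr_add)
      also have "\<dots> \<le> c0 * (t m powr (-\<alpha>) * (t m + N * t1) powr \<sigma>)"
        using c0 tm \<sigma> by (intro mult_left_mono powr_mono2') auto
      also have "\<dots> \<le> disc_op (\<lambda>j. if j = 0 then 0 else (t j + N * t1) powr \<sigma>)"
        unfolding c0_def by (rule subcritical_barrier[OF \<sigma> N(1) N(2)[unfolded c0_def]])
      finally show ?thesis unfolding disc_op_scale using c by (simp add: field_simps)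
    qed
    moreover have "?B n \<le> 1 / c * t n powr \<sigma>"
      using n.t_pos[OF n] N t1 c \<sigma> n by (auto intro!: divide_right_mono powr_mono2')
    ultimately show "\<exists>B. B 0 = 0 \<and> (\<forall>m\<in>{1..n}. t m powr (-\<mu>) \<le> alikhanov_mesh.disc_op \<alpha> t m B) \<and>
        B n \<le> 1 / c * t n powr (\<alpha> - \<mu>)"
      by (intro exI[of _ ?B]) (auto simp: \<sigma>_def)
  qed (use c in simp)
qed

section \<open>Consistency error\<close>

lemma powr_increment_bound:
  fixes f :: "real \<Rightarrow> 'b::real_normed_vector"
  assumes e: "e \<noteq> 0" and ab: "0 \<le> a" "a \<le> b" "0 < a \<or> 0 < e"
    and cont: "continuous_on {a..b} f"
    and deriv: "\<And>s. a < s \<Longrightarrow> s < b \<Longrightarrow> (f has_vector_derivative f' s) (at s)"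
    and bound: "\<And>s. a < s \<Longrightarrow> s < b \<Longrightarrow> norm (f' s) \<le> K * s powr (e - 1)"
  shows "norm (f b - f a) \<le> K / e * (b powr e - a powr e)"
proof (cases "a = b")
  case False
  have "norm (f b - f a) \<le> K / e * b powr e - K / e * a powr e"
  proof (rule differentiable_bound_general[OF _ cont _ deriv])
    show "a < b" using False ab by simp
    show "continuous_on {a..b} (\<lambda>s. K / e * s powr e)"
      using ab by (intro continuous_intros continuous_on_powr') auto
    show "((\<lambda>s. K / e * s powr e) has_vector_derivative K * s powr (e - 1)) (at s)"
      if "a < s" "s < b" for s
      unfolding has_real_derivative_iff_has_vector_derivative[symmetric]
      using DERIV_cmult[OF has_real_derivative_powr[of s e], of "K / e"] that ab e by simp
  qed (use bound in auto)
  then show ?thesis by (simp add: right_diff_distrib)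
qed simp

text \<open>The averaging weights are those of \<open>z\<close> as a convex combination of the end
  points, so the first-order terms at \<open>z\<close> cancel and only two Taylor remainders are
  left.\<close>

lemma linear_interpolation_remainder:
  fixes f :: "real \<Rightarrow> real"
  assumes d: "\<And>s. s \<in> {x..y} \<Longrightarrow> (f has_real_derivative f1 s) (at s within {x..y})"
      "\<And>s. s \<in> {x..y} \<Longrightarrow> (f1 has_real_derivative f2 s) (at s within {x..y})"
    and B: "\<And>s. s \<in> {x..y} \<Longrightarrow> \<bar>f2 s\<bar> \<le> B"
    and xy: "x \<le> y" and \<theta>: "0 \<le> \<theta>" "\<theta> \<le> 1" and z: "z = y - \<theta> * (y - x)"
  shows "\<bar>\<theta> * f x + (1 - \<theta>) * f y - f z\<bar> \<le> B * (y - x)\<^sup>2"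
proof -
  have zI: "z \<in> {x..y}" using xy \<theta> mult_left_le_one_le[of "y - x" \<theta>] by (auto simp: z)
  have B0: "0 \<le> B" using B[OF zI] by simp
  have dist: "\<bar>w - z\<bar> \<le> y - x" if "w \<in> {x..y}" for w using that zI by auto
  have 1: "\<bar>f1 w - f1 z\<bar> \<le> B * (y - x)" if "w \<in> {x..y}" for w
    using field_differentiable_bound[of "{x..y}" f1 f2 B w z] d(2) B zI that
      mult_left_mono[OF dist[OF that] B0] by auto
  define R where "R w = f w - f z - f1 z * (w - z)" for w
  have R: "\<bar>R w\<bar> \<le> B * (y - x)\<^sup>2" if w: "w \<in> {x..y}" for w
  proof -
    have "norm ((f w - f1 z * (w - z)) - (f z - f1 z * (z - z))) \<le> B * (y - x) * norm (w - z)"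
    proof (rule field_differentiable_bound[of "{x..y}"])
      show "((\<lambda>w. f w - f1 z * (w - z)) has_real_derivative f1 v - f1 z) (at v within {x..y})"
        if "v \<in> {x..y}" for v by (auto intro!: derivative_eq_intros d that)
    qed (use 1 w zI in auto)
    also have "\<dots> \<le> B * (y - x) * (y - x)"
      using dist[OF w] B0 xy by (intro mult_left_mono) auto
    finally show ?thesis by (simp add: R_def power2_eq_square mult.assoc diff_right_commute)
  qed
  have "\<theta> * f x + (1 - \<theta>) * f y - f z = \<theta> * R x + (1 - \<theta>) * R y"
    unfolding R_def z by (simp add: algebra_simps)
  also have "\<bar>\<dots>\<bar> \<le> \<theta> * (B * (y - x)\<^sup>2) + (1 - \<theta>) * (B * (y - x)\<^sup>2)"
    using R[of x] R[of y] xy \<theta>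
    by (intro order_trans[OF abs_triangle_ineq] add_mono) (auto simp: abs_mult intro!: mult_left_mono)
  finally show ?thesis by (simp add: algebra_simps)
qed

section \<open>Residuals of scalar functions with an initial layer\<close>

context alikhanov_graded
begin

definition rate where "rate = min (\<alpha> + 1) ((3 - \<alpha>) / r)"

definition sum_rate_const where
  "sum_rate_const = (if (3 - \<alpha>) / r < \<alpha> + 1 then 2 + 1 / (\<alpha> - (3 - \<alpha>) / r + 1) else 2 + 1 / (3 / r - \<alpha> - 1))"

lemma trunc_bound_rate: "trunc_bound 0 \<alpha> \<le> sum_rate_const * (t1 / t m) powr rate"
proof -
  define q where "q = (3 - \<alpha>) / r"
  have q3: "q < 3 / r" unfolding q_def using alpha_range r by (intro divide_strict_right_mono) auto
  have tm: "0 < t m" "0 < t1 / t m" "t1 / t m \<le> 1"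
    using t_pos[OF m1] t1 t1_le[OF m1] by auto
  have near: "t m powr (-\<alpha>) * ((t m + 0) powr \<alpha> * (t1 / (t m + 0)) powr q) \<le> (t1 / t m) powr rate"
  proof -
    have "t m powr (-\<alpha>) * (t m powr \<alpha> * (t1 / t m) powr q) = (t1 / t m) powr q"
      using tm by (simp add: powr_minus)
    also have "\<dots> \<le> (t1 / t m) powr rate" using tm by (intro powr_mono') (auto simp: rate_def q_def)
    finally show ?thesis by simp
  qed
  have sub: "(\<Sum>j\<in>{1..<m}. f j) \<le> (\<Sum>j=1..m. f j)" if "\<And>j. 1 \<le> j \<Longrightarrow> 0 \<le> f j" for f :: "nat \<Rightarrow> real"
    using that by (intro sum_mono2) auto
  have far: "t m powr (-\<alpha> - 1) * (\<Sum>j\<in>{1..<m}. \<tau> j * ((t j + 0) powr \<alpha> * (t1 / (t j + 0)) powr (3 / r)))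
      \<le> (sum_rate_const - 1) * (t1 / t m) powr rate"
  proof (cases "q < \<alpha> + 1")
    case True
    have rate: "rate = q" using True by (simp add: rate_def q_def)
    have each: "\<tau> j * ((t j + 0) powr \<alpha> * (t1 / (t j + 0)) powr (3 / r)) \<le> t1 powr q * (\<tau> j * t j powr (\<alpha> - q))"
      if "j \<in> {1..<m}" for j
    proof -
      have j: "0 < t j" "0 < \<tau> j" "t1 \<le> t j" using that t_pos[of j] tau_pos[of j] t1_le[of j] by auto
      \<comment> \<open>Lowering the exponent from 3 / r to \<open>q\<close> keeps the summed power
        above -1 and avoids the borderline 3 / r = \<alpha> + 1 with its logarithm. Nothing is lost,
        since the near term decays with exponent \<open>q\<close> as well.\<close>
      have "(t1 / t j) powr (3 / r) \<le> (t1 / t j) powr q" using j t1 q3 by (intro powr_mono') auto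
      then have "\<tau> j * (t j powr \<alpha> * (t1 / t j) powr (3 / r)) \<le> \<tau> j * (t j powr \<alpha> * (t1 / t j) powr q)"
        using j by (intro mult_left_mono) auto
      then show ?thesis using j t1 by (simp add: powr_divide powr_diff mult_ac)
    qed
    have "(\<Sum>j\<in>{1..<m}. \<tau> j * ((t j + 0) powr \<alpha> * (t1 / (t j + 0)) powr (3 / r)))
        \<le> t1 powr q * (\<Sum>j\<in>{1..<m}. \<tau> j * t j powr (\<alpha> - q))"
      unfolding sum_distrib_left by (rule sum_mono) (rule each)
    also have "\<dots> \<le> t1 powr q * (\<Sum>j=1..m. \<tau> j * t j powr (\<alpha> - q))"
      by (intro mult_left_mono sub) (auto intro!: mult_nonneg_nonneg less_imp_le[OF tau_pos])
    also have "\<dots> \<le> t1 powr q * ((1 + 1 / (\<alpha> - q + 1)) * t m powr (\<alpha> - q + 1))"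
      using True by (intro mult_left_mono sum_power_gt) auto
    finally have "t m powr (-\<alpha> - 1) * (\<Sum>j\<in>{1..<m}. \<tau> j * ((t j + 0) powr \<alpha> * (t1 / (t j + 0)) powr (3 / r)))
        \<le> t m powr (-\<alpha> - 1) * (t1 powr q * ((1 + 1 / (\<alpha> - q + 1)) * t m powr (\<alpha> - q + 1)))"
      by (intro mult_left_mono) auto
    also have "\<dots> = (1 + 1 / (\<alpha> - q + 1)) * (t1 powr q * (t m powr (-\<alpha> - 1) * t m powr (\<alpha> - q + 1)))"
      by (simp only: mult_ac)
    also have "t m powr (-\<alpha> - 1) * t m powr (\<alpha> - q + 1) = t m powr (-q)"
      by (simp only: powr_add[symmetric]) simp
    also have "t1 powr q * t m powr (-q) = (t1 / t m) powr q"
      using tm t1 by (simp add: powr_divide powr_minus_divide)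
    finally show ?thesis using True by (simp add: rate sum_rate_const_def flip: q_def)
  next
    case False
    have rate: "rate = \<alpha> + 1" using False by (simp add: rate_def q_def)
    define \<rho> where "\<rho> = \<alpha> - 3 / r"
    have \<rho>: "\<rho> < -1" using False q3 by (simp add: \<rho>_def)
    have each: "\<tau> j * ((t j + 0) powr \<alpha> * (t1 / (t j + 0)) powr (3 / r)) = t1 powr (3 / r) * (\<tau> j * t j powr \<rho>)"
      if "j \<in> {1..<m}" for j
      using that t_pos[of j] t1 by (simp add: \<rho>_def powr_divide powr_diff mult_ac)
    have "(\<Sum>j\<in>{1..<m}. \<tau> j * ((t j + 0) powr \<alpha> * (t1 / (t j + 0)) powr (3 / r)))
        = t1 powr (3 / r) * (\<Sum>j\<in>{1..<m}. \<tau> j * t j powr \<rho>)"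
      unfolding sum_distrib_left by (rule sum.cong) (auto simp: each simp del: add_0_right)
    also have "\<dots> \<le> t1 powr (3 / r) * (\<Sum>j=1..m. \<tau> j * t j powr \<rho>)"
      by (intro mult_left_mono sub) (auto intro!: mult_nonneg_nonneg less_imp_le[OF tau_pos])
    also have "\<dots> \<le> t1 powr (3 / r) * ((1 + 1 / (-\<rho> - 1)) * t1 powr (\<rho> + 1))"
      using \<rho> m1 by (intro mult_left_mono sum_power_lt) auto
    also have "\<dots> = (1 + 1 / (-\<rho> - 1)) * (t1 powr (3 / r) * t1 powr (\<rho> + 1))" by (simp only: mult_ac)
    also have "t1 powr (3 / r) * t1 powr (\<rho> + 1) = t1 powr (\<alpha> + 1)"
      by (simp only: powr_add[symmetric]) (simp add: \<rho>_def)
    finally have "t m powr (-\<alpha> - 1) * (\<Sum>j\<in>{1..<m}. \<tau> j * ((t j + 0) powr \<alpha> * (t1 / (t j + 0)) powr (3 / r)))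
        \<le> t m powr (-\<alpha> - 1) * ((1 + 1 / (-\<rho> - 1)) * t1 powr (\<alpha> + 1))"
      by (intro mult_left_mono) auto
    also have "\<dots> = (1 + 1 / (-\<rho> - 1)) * (t1 powr (\<alpha> + 1) * t m powr (- (\<alpha> + 1)))"
    proof -
      have "-\<alpha> - 1 = - (\<alpha> + 1)" by simp
      then show ?thesis by (simp only: mult_ac)
    qed
    also have "t1 powr (\<alpha> + 1) * t m powr (- (\<alpha> + 1)) = (t1 / t m) powr (\<alpha> + 1)"
      using tm t1 by (simp only: powr_divide powr_minus_divide) simp
    also have "1 + 1 / (-\<rho> - 1) = sum_rate_const - 1"
      using False by (simp add: sum_rate_const_def \<rho>_def flip: q_def)
    finally show ?thesis unfolding rate .
  qed
  show ?thesis
    unfolding trunc_bound_def q_def[symmetric] using near far by (simp add: left_diff_distrib)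
qed

text \<open>The product serves the levels \<open>m \<ge> 2\<close>; the remaining summands serve
  \<open>m = 1\<close>, where the discrete operator and the integral are bounded separately.\<close>

definition residual_const where
  "residual_const = (trunc_const \<alpha> + 4 * 2 powr (r * \<alpha>) / \<alpha>) * sum_const \<alpha> * sum_rate_const
    + 3 / (\<alpha> * (1 - \<alpha>)) + 2 / \<alpha> + 2 / (1 - \<alpha>)"

lemma residual_const_parts:
  "0 \<le> (trunc_const \<alpha> + 4 * 2 powr (r * \<alpha>) / \<alpha>) * sum_const \<alpha>" "0 \<le> sum_rate_const"
proof -
  have "0 \<le> step_const ^ 3" using step_const by simp
  then show "0 \<le> (trunc_const \<alpha> + 4 * 2 powr (r * \<alpha>) / \<alpha>) * sum_const \<alpha>"
    unfolding trunc_const_def sum_const_def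
    using r alpha_range by (intro mult_nonneg_nonneg add_nonneg_nonneg divide_nonneg_nonneg) auto
  have "(3 - \<alpha>) / r < 3 / r" using alpha_range r by (intro divide_strict_right_mono) auto
  then show "0 \<le> sum_rate_const"
    by (auto simp: sum_rate_const_def intro!: add_nonneg_nonneg)
qed

text \<open>The integral of \<open>\<kappa> s * s powr (\<alpha> - 1)\<close> is scale invariant,
  hence bounded independently of \<open>ts\<close>. On either side of \<open>ts / 2\<close> one of
  the two factors is nonsingular and is replaced by its value at \<open>ts / 2\<close>, so the
  product is dominated by a sum of two explicit integrands.\<close>

lemma first_residual_integral:
  assumes int: "(\<lambda>s. \<kappa> s * f s) integrable_on {0..ts}" and K: "0 \<le> K"
    and b: "\<And>s. s \<in> {0<..<ts} \<Longrightarrow> \<bar>f s\<bar> \<le> K * s powr (\<alpha> - 1)"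
  shows "\<bar>integral {0..ts} (\<lambda>s. \<kappa> s * f s)\<bar> \<le> K * (2 / \<alpha> + 2 / (1 - \<alpha>))"
proof -
  have ts: "0 < ts" using ts_bounds t_le[of 0 "m - 1"] t0 by auto
  define h where "h s = K * ((ts / 2) powr (-\<alpha>) * s powr (\<alpha> - 1) + (ts / 2) powr (\<alpha> - 1) * \<kappa> s)" for s
  have 1: "((\<lambda>s. s powr (\<alpha> - 1)) has_integral ts powr \<alpha> / \<alpha>) {0..ts}"
    using has_integral_powr_from_0[of "\<alpha> - 1" ts] alpha_range ts by simp
  have 2: "(\<kappa> has_integral ts powr (1 - \<alpha>) / (1 - \<alpha>)) {0..ts}"
    using kappa_integral[of 0 ts] ts alpha_range by simp
  have h: "(h has_integral K * ((ts / 2) powr (-\<alpha>) * (ts powr \<alpha> / \<alpha>) + (ts / 2) powr (\<alpha> - 1) * (ts powr (1 - \<alpha>) / (1 - \<alpha>)))) {0..ts}"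
    unfolding h_def by (intro has_integral_mult_right has_integral_add 1 2)
  let ?f = "\<lambda>s. if s \<in> {0<..<ts} then \<kappa> s * f s else 0"
  have f: "(?f has_integral integral {0..ts} (\<lambda>s. \<kappa> s * f s)) {0..ts}"
    by (rule has_integral_spike_finite[OF _ _ integrable_integral[OF int], of "{0, ts}"]) auto
  have h0: "0 \<le> h s" for s unfolding h_def using K by (simp add: \<kappa>_def)
  have "norm (integral {0..ts} ?f) \<le> integral {0..ts} h"
  proof (rule integral_norm_bound_integral)
    fix s
    show "norm (?f s) \<le> h s"
    proof (cases "s \<in> {0<..<ts}")
      case True
      have k0: "0 \<le> \<kappa> s" by (simp add: \<kappa>_def)
      have "\<kappa> s * s powr (\<alpha> - 1) \<le> (ts / 2) powr (-\<alpha>) * s powr (\<alpha> - 1) + (ts / 2) powr (\<alpha> - 1) * \<kappa> s"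
      proof (cases "s \<le> ts / 2")
        case True
        then have "\<kappa> s \<le> (ts / 2) powr (-\<alpha>)"
          unfolding \<kappa>_def using ts alpha_range by (intro powr_mono2') auto
        then have "\<kappa> s * s powr (\<alpha> - 1) \<le> (ts / 2) powr (-\<alpha>) * s powr (\<alpha> - 1)" by (intro mult_right_mono) auto
        then show ?thesis using k0 by (simp add: add_increasing2)
      next
        case False
        then have "s powr (\<alpha> - 1) \<le> (ts / 2) powr (\<alpha> - 1)"
          using ts alpha_range by (intro powr_mono2') auto
        then have "\<kappa> s * s powr (\<alpha> - 1) \<le> (ts / 2) powr (\<alpha> - 1) * \<kappa> s"
          using k0 by (subst mult.commute) (intro mult_right_mono)
        then show ?thesis by (simp add: add_increasing)
      qed
      then have "K * (\<kappa> s * s powr (\<alpha> - 1)) \<le> h s" unfolding h_def using K by (intro mult_left_mono)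
      moreover have "norm (?f s) \<le> \<kappa> s * (K * s powr (\<alpha> - 1))"
        using True mult_left_mono[OF b[OF True] k0] k0 by (simp add: abs_mult)
      ultimately show ?thesis by (simp add: mult_ac)
    qed (use h0 in auto)
  qed (use f h in auto)
  also have "integral {0..ts} h = K * (2 powr \<alpha> / \<alpha> + 2 powr (1 - \<alpha>) / (1 - \<alpha>))"
  proof -
    have "(ts / 2) powr (-\<alpha>) * (ts powr \<alpha> / \<alpha>) = 2 powr \<alpha> / \<alpha>"
      using ts by (simp add: powr_divide powr_minus_divide)
    moreover have "(ts / 2) powr (\<alpha> - 1) * (ts powr (1 - \<alpha>) / (1 - \<alpha>)) = 2 powr (1 - \<alpha>) / (1 - \<alpha>)"
    proof -
      have "(ts / 2) powr (\<alpha> - 1) * ts powr (1 - \<alpha>) = 2 powr (1 - \<alpha>) * (ts / 2 * 2 / ts) powr (1 - \<alpha>)"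
        using ts powr_minus_divide[of "ts / 2" "1 - \<alpha>"] by (simp add: powr_divide)
      then show ?thesis using ts by simp
    qed
    ultimately show ?thesis unfolding integral_unique[OF h] by (simp only:)
  qed
  also have "\<dots> \<le> K * (2 / \<alpha> + 2 / (1 - \<alpha>))"
  proof -
    have "(2::real) powr \<alpha> \<le> 2" "(2::real) powr (1 - \<alpha>) \<le> 2"
      using alpha_range powr_mono[of \<alpha> 1 "2::real"] powr_mono[of "1 - \<alpha>" 1 "2::real"] by auto
    then show ?thesis using K alpha_range by (intro mult_left_mono add_mono divide_right_mono) auto
  qed
  finally show ?thesis unfolding integral_unique[OF f] by simp
qed

text \<open>For \<open>m \<ge> 2\<close> this is \<open>truncation_graded\<close> without a shift.
  The third-derivative bound is useless on the first step; there the remainder is taken relative to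
  the constant \<open>\<phi> (t 1)\<close>, and the oscillation of order
  \<open>t1 powr \<alpha>\<close> has the same size as the weight
  \<open>\<tau> 1 ^ 3 * t 1 powr (\<alpha> - 3)\<close>. For \<open>m = 1\<close> boundedness is
  enough, as \<open>t1 / t m = 1\<close>.\<close>

lemma caputo_residual:
  fixes \<phi> :: "real \<Rightarrow> real"
  assumes K: "0 \<le> K" and cont: "continuous_on {0..t m} \<phi>"
    and d: "\<And>s. s \<in> {0<..t m} \<Longrightarrow> (\<phi> has_real_derivative \<phi>1 s) (at s within {0<..t m})"
      "\<And>s. s \<in> {0<..t m} \<Longrightarrow> (\<phi>1 has_real_derivative \<phi>2 s) (at s within {0<..t m})"
      "\<And>s. s \<in> {0<..t m} \<Longrightarrow> (\<phi>2 has_real_derivative \<phi>3 s) (at s within {0<..t m})"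
    and b1: "\<And>s. s \<in> {0<..t m} \<Longrightarrow> \<bar>\<phi>1 s\<bar> \<le> K * s powr (\<alpha> - 1)"
    and b3: "\<And>s. s \<in> {0<..t m} \<Longrightarrow> \<bar>\<phi>3 s\<bar> \<le> K * s powr (\<alpha> - 3)"
    and int: "(\<lambda>s. \<kappa> s * \<phi>1 s) integrable_on {0..ts}"
  shows "\<bar>disc_op (\<lambda>j. \<phi> (t j)) - integral {0..ts} (\<lambda>s. \<kappa> s * \<phi>1 s)\<bar> \<le> residual_const * K * (t1 / t m) powr rate"
proof -
  have deriv: "(\<phi> has_vector_derivative \<phi>1 s) (at s)" if "0 < s" "s < t m" for s
  proof -
    have "(\<phi> has_real_derivative \<phi>1 s) (at s within {0<..<t m})"
      using that by (intro DERIV_subset[OF d(1)]) auto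
    then show ?thesis
      using that at_within_open[of s "{0<..<t m}"] by (simp add: has_real_derivative_iff_has_vector_derivative)
  qed
  have osc: "\<bar>\<phi> y - \<phi> x\<bar> \<le> K / \<alpha> * (y powr \<alpha> - x powr \<alpha>)" if "0 \<le> x" "x \<le> y" "y \<le> t m" for x y
    unfolding real_norm_def[symmetric]
    using that alpha_range b1 by (intro powr_increment_bound[where f' = \<phi>1] deriv continuous_on_subset[OF cont]) auto
  have pos: "0 \<le> 3 / (\<alpha> * (1 - \<alpha>))" "0 \<le> 2 / \<alpha> + 2 / (1 - \<alpha>)" using alpha_range by auto
  show ?thesis
  proof (cases "2 \<le> m")
    case True
    define C where "C = trunc_const \<alpha> + 4 * 2 powr (r * \<alpha>) / \<alpha>"
    have C1: "trunc_const \<alpha> \<le> C" "4 * 2 powr (r * \<alpha>) / \<alpha> \<le> C"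
    proof -
      have "0 \<le> step_const ^ 3" using step_const by simp
      then have "0 \<le> trunc_const \<alpha>"
        unfolding trunc_const_def using alpha_range by (intro divide_nonneg_nonneg mult_nonneg_nonneg) auto
      then show "trunc_const \<alpha> \<le> C" "4 * 2 powr (r * \<alpha>) / \<alpha> \<le> C" using alpha_range by (auto simp: C_def)
    qed
    have first: "\<bar>quad \<phi> 1 s - \<phi> s\<bar> \<le> C * (K * (\<tau> 1 ^ 3 * (t 1 + 0) powr (\<alpha> - 3)))" if s: "s \<in> {0..t 1}" for s
    proof -
      have t2: "t 2 \<le> 2 powr r * t 1" "t 2 \<le> t m" "t 1 \<le> t 2" "0 < t 1"
        using t_prev[of 2] True t_le[of 1 2] t_le[of 2 m] t_pos[of 1] by auto
      have O: "\<bar>\<phi> x - \<phi> (t 1)\<bar> \<le> K / \<alpha> * (2 powr (r * \<alpha>) * t1 powr \<alpha>)" if x: "x \<in> {0..t 2}" for x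
      proof -
        have "\<bar>\<phi> x - \<phi> (t 1)\<bar> \<le> K / \<alpha> * (max x (t 1) powr \<alpha> - min x (t 1) powr \<alpha>)"
          using osc[of x "t 1"] osc[of "t 1" x] x t2 by (cases "x \<le> t 1") (auto simp: abs_minus_commute)
        also have "\<dots> \<le> K / \<alpha> * (2 powr r * t 1) powr \<alpha>"
        proof (rule mult_left_mono)
          have "max x (t 1) \<le> t 2" using x t2 by auto
          then have "max x (t 1) \<le> 2 powr r * t 1" using t2(1) by linarith
          then have "max x (t 1) powr \<alpha> \<le> (2 powr r * t 1) powr \<alpha>"
            using x t2 alpha_range by (intro powr_mono2) auto
          moreover have "0 \<le> min x (t 1) powr \<alpha>" by simp
          ultimately show "max x (t 1) powr \<alpha> - min x (t 1) powr \<alpha> \<le> (2 powr r * t 1) powr \<alpha>" by linarith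
        qed (use K alpha_range in auto)
        finally show ?thesis by (simp add: powr_mult powr_powr t_1[unfolded One_nat_def])
      qed
      have "\<bar>quad \<phi> 1 s - \<phi> s\<bar> \<le> 4 * (K / \<alpha> * (2 powr (r * \<alpha>) * t1 powr \<alpha>))"
      proof (rule quad_error[of 1 s \<phi> 0 0])
        show "\<bar>\<phi> x - \<phi> (t 1) - 0 * (x - t 1) - 0 * (x - t 1)\<^sup>2\<bar> \<le> K / \<alpha> * (2 powr (r * \<alpha>) * t1 powr \<alpha>)"
          if "x \<in> {t (1 - 1)..t (1 + 1)}" for x
          using O[of x] that t0 by (simp add: numeral_2_eq_2)
      qed (use s t0 in auto)
      also have "\<dots> = 4 * 2 powr (r * \<alpha>) / \<alpha> * (K * t1 powr \<alpha>)" by simp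
      also have "\<dots> \<le> C * (K * t1 powr \<alpha>)" using C1(2) K by (intro mult_right_mono) auto
      also have "t1 powr \<alpha> = \<tau> 1 ^ 3 * (t 1 + 0) powr (\<alpha> - 3)"
      proof -
        have "\<tau> 1 = t1" using t0 by (simp add: \<tau>_def t_1[unfolded One_nat_def])
        moreover have "t1 ^ 3 = t1 powr 3" using t1 by (simp add: powr_realpow)
        moreover have "t1 powr 3 * t1 powr (\<alpha> - 3) = t1 powr \<alpha>" by (simp only: powr_add[symmetric]) simp
        ultimately show ?thesis by (simp add: t_1[unfolded One_nat_def])
      qed
      finally show ?thesis .
    qed
    have "\<bar>\<phi>3 s\<bar> \<le> K * (s + 0) powr (\<alpha> - 3)" if "s \<in> {0<..t m}" for s using b3[OF that] by simp
    moreover have "(\<lambda>s. \<kappa> s * \<phi>1 s) integrable_on {t (m - 1)..ts}"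
      by (rule integrable_subinterval_real[OF int]) (use t_le[of 0 "m - 1"] t0 in auto)
    ultimately obtain E where
      E: "((\<lambda>s. \<kappa> s * \<phi>1 s) has_integral (\<Sum>j=1..m. g j * (\<phi> (t j) - \<phi> (t (j - 1)))) - E) {0..ts}"
      "\<bar>E\<bar> \<le> C * K * (sum_const \<alpha> * t1 powr (3 / r) *
        ((t m + 0) powr (\<alpha> - 3 / r) * \<tau> m powr (-\<alpha>)
        + t m powr (-\<alpha> - 1) * (\<Sum>j\<in>{1..<m}. \<tau> j * (t j + 0) powr (\<alpha> - 3 / r))))"
      using truncation_graded[where \<phi> = \<phi> and a = 0 and \<sigma> = \<alpha> and K = K and C = C and Z = "{0<..t m}"
        and ?\<phi>1.0 = \<phi>1 and ?\<phi>2.0 = \<phi>2 and ?\<phi>3.0 = \<phi>3, OF _ _ _ K C1(1) cont _ d] first True t1 alpha_range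
      by (auto simp del: One_nat_def add_0_right)
    have c: "0 \<le> C * sum_const \<alpha>" using residual_const_parts(1) by (simp add: C_def)
    have "\<bar>E\<bar> \<le> (C * sum_const \<alpha>) * (K * (t1 powr (3 / r) *
        ((t m + 0) powr (\<alpha> - 3 / r) * \<tau> m powr (-\<alpha>)
        + t m powr (-\<alpha> - 1) * (\<Sum>j\<in>{1..<m}. \<tau> j * (t j + 0) powr (\<alpha> - 3 / r)))))"
      using E(2) by (simp only: mult_ac)
    also have "\<dots> \<le> (C * sum_const \<alpha>) * (K * (sum_rate_const * (t1 / t m) powr rate))"
      using c K order_trans[OF trunc_bound[OF order_refl] trunc_bound_rate] by (intro mult_left_mono) auto
    also have "\<dots> = (C * sum_const \<alpha> * sum_rate_const) * (K * (t1 / t m) powr rate)" by (simp only: mult_ac)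
    also have "\<dots> \<le> residual_const * (K * (t1 / t m) powr rate)"
      using pos K unfolding residual_const_def C_def by (intro mult_right_mono) auto
    finally have "\<bar>E\<bar> \<le> residual_const * (K * (t1 / t m) powr rate)" .
    then show ?thesis unfolding integral_unique[OF E(1)] by (simp add: disc_op_def mult.assoc)
  next
    case False
    then have m: "m = 1" using m1 by simp
    have tm: "t m = t1" "t (m - 1) = 0" using t_1 t0 by (simp_all add: m)
    have tsL: "ts = (1 - \<alpha> / 2) * t1" "\<tau> m = t1" using ts_eq tm by (auto simp: \<tau>_def)
    have gm: "g m \<le> 1 / (1 - \<alpha>) * t1 powr (-\<alpha>)"
    proof -
      have b0: "bb 0 = 0" by (simp add: bb_def)
      have m0: "m - 1 = 0" using m by simp
      have bb: "bb m = 0" "bb (m - 1) = 0" unfolding m0 b0 by (simp_all add: bb_def q_def)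
      have "aa m = ts powr (1 - \<alpha>) / (1 - \<alpha>)"
        using kappa_integral[of 0 ts] ts_bounds alpha_range tm by (simp add: aa_def hi_def integral_unique)
      also have "\<dots> \<le> t1 powr (1 - \<alpha>) / (1 - \<alpha>)"
        using ts_bounds tm alpha_range by (intro divide_right_mono powr_mono2) auto
      finally have "aa m / t1 \<le> t1 powr (1 - \<alpha>) / (1 - \<alpha>) / t1"
        using t1 by (intro divide_right_mono) auto
      then have "g m \<le> t1 powr (1 - \<alpha>) / (1 - \<alpha>) / t1"
        unfolding g_def bb tsL by simp
      also have "t1 powr (1 - \<alpha>) = t1 * t1 powr (-\<alpha>)" using t1 powr_add[of t1 1 "-\<alpha>"] by simp
      finally show ?thesis using t1 by simp
    qed
    have "{1..m} = {m}" using m by simp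
    then have "disc_op (\<lambda>j. \<phi> (t j)) = g m * (\<phi> (t m) - \<phi> (t (m - 1)))"
      unfolding disc_op_def by (simp only:) simp
    moreover have "\<bar>g m * (\<phi> (t m) - \<phi> (t (m - 1)))\<bar> \<le> (1 / (1 - \<alpha>) * t1 powr (-\<alpha>)) * (K / \<alpha> * t1 powr \<alpha>)"
      using osc[of 0 t1] gm g_pos[OF m1] tm t1 unfolding abs_mult by (intro mult_mono) auto
    moreover have "(1 / (1 - \<alpha>) * t1 powr (-\<alpha>)) * (K / \<alpha> * t1 powr \<alpha>) = 1 / (\<alpha> * (1 - \<alpha>)) * K"
      using t1 by (simp add: powr_minus_divide)
    moreover have "1 / (\<alpha> * (1 - \<alpha>)) * K \<le> 3 / (\<alpha> * (1 - \<alpha>)) * K"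
      using K alpha_range by (intro mult_right_mono divide_right_mono) auto
    ultimately have 1: "\<bar>disc_op (\<lambda>j. \<phi> (t j))\<bar> \<le> 3 / (\<alpha> * (1 - \<alpha>)) * K" by linarith
    have 2: "\<bar>integral {0..ts} (\<lambda>s. \<kappa> s * \<phi>1 s)\<bar> \<le> K * (2 / \<alpha> + 2 / (1 - \<alpha>))"
      using b1 ts_bounds by (intro first_residual_integral int K) auto
    have "(3 / (\<alpha> * (1 - \<alpha>)) + (2 / \<alpha> + 2 / (1 - \<alpha>))) * K \<le> residual_const * K"
      using residual_const_parts K unfolding residual_const_def by (intro mult_right_mono) auto
    then have "\<bar>disc_op (\<lambda>j. \<phi> (t j)) - integral {0..ts} (\<lambda>s. \<kappa> s * \<phi>1 s)\<bar> \<le> residual_const * K"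
      using 1 2 by (simp only: distrib_right mult.commute[of K])
    then show ?thesis using tm t1 by simp
  qed
qed

definition interp_const where "interp_const = 2 powr (r * (2 - \<alpha>)) * r\<^sup>2 + 1 / \<alpha>"

lemma interpolation_residual:
  fixes f :: "real \<Rightarrow> real"
  assumes m2: "2 \<le> m" and K: "0 \<le> K"
    and d: "\<And>s. s \<in> {0<..t m} \<Longrightarrow> (f has_real_derivative f1 s) (at s within {0<..t m})"
      "\<And>s. s \<in> {0<..t m} \<Longrightarrow> (f1 has_real_derivative f2 s) (at s within {0<..t m})"
    and b: "\<And>s. s \<in> {0<..t m} \<Longrightarrow> \<bar>f2 s\<bar> \<le> K * s powr (\<alpha> - 2)"
  shows "\<bar>\<alpha> / 2 * f (t (m - 1)) + (1 - \<alpha> / 2) * f (t m) - f ts\<bar>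
    \<le> interp_const * K * (t1 powr (2 / r) * t m powr (\<alpha> - 2 / r))"
proof -
  have "1 \<le> m - 1" using m2 by simp
  then have tm: "0 < t (m - 1)" "0 < t m" "t (m - 1) \<le> t m" using t_pos m1 t_le[of "m - 1" m] by auto
  define B where "B = K * (2 powr (r * (2 - \<alpha>)) * t m powr (\<alpha> - 2))"
  have sub: "{t (m - 1)..t m} \<subseteq> {0<..t m}" using tm by auto
  have "\<bar>\<alpha> / 2 * f (t (m - 1)) + (1 - \<alpha> / 2) * f (t m) - f ts\<bar> \<le> B * (t m - t (m - 1))\<^sup>2"
  proof (rule linear_interpolation_remainder)
    show "(f has_real_derivative f1 s) (at s within {t (m - 1)..t m})"
      "(f1 has_real_derivative f2 s) (at s within {t (m - 1)..t m})" if "s \<in> {t (m - 1)..t m}" for s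
      using that sub by (meson DERIV_subset d subsetD)+
    show "\<bar>f2 s\<bar> \<le> B" if s: "s \<in> {t (m - 1)..t m}" for s
    proof -
      have "\<bar>f2 s\<bar> \<le> K * s powr (\<alpha> - 2)" using b s sub by blast
      also have "s powr (\<alpha> - 2) \<le> 2 powr (r * (2 - \<alpha>)) * t m powr (\<alpha> - 2)"
        using shifted_powr_bound[of m 0 s "\<alpha> + 1"] m1 m2 s alpha_range by simp
      finally show ?thesis using K by (simp add: B_def mult_left_mono)
    qed
    show "ts = t m - \<alpha> / 2 * (t m - t (m - 1))" by (simp add: ts_def tstar_def)
  qed (use tm alpha_range in auto)
  also have "\<dots> \<le> B * (r * t1 powr (1 / r) * t m powr (1 - 1 / r))\<^sup>2"
    using tau_upper[OF m1] tau_pos[OF m1] K by (intro mult_left_mono power_mono) (auto simp: \<tau>_def B_def)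
  also have "(r * t1 powr (1 / r) * t m powr (1 - 1 / r))\<^sup>2 = r\<^sup>2 * t1 powr (2 / r) * t m powr (2 - 2 / r)"
  proof -
    have sq: "(x powr e)\<^sup>2 = x powr (2 * e)" for x e :: real by (simp only: power2_eq_square mult_2 powr_add)
    have "2 * (1 / r) = 2 / r" "2 * (1 - 1 / r) = 2 - 2 / r" by (simp_all add: right_diff_distrib)
    then show ?thesis unfolding power_mult_distrib sq by (simp only:)
  qed
  also have "B * (r\<^sup>2 * t1 powr (2 / r) * t m powr (2 - 2 / r))
      = 2 powr (r * (2 - \<alpha>)) * r\<^sup>2 * K * (t1 powr (2 / r) * (t m powr (\<alpha> - 2) * t m powr (2 - 2 / r)))"
    by (simp only: B_def mult_ac)
  also have "t m powr (\<alpha> - 2) * t m powr (2 - 2 / r) = t m powr (\<alpha> - 2 / r)"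
    by (simp only: powr_add[symmetric]) simp
  also have "2 powr (r * (2 - \<alpha>)) * r\<^sup>2 * K * (t1 powr (2 / r) * t m powr (\<alpha> - 2 / r))
      \<le> interp_const * K * (t1 powr (2 / r) * t m powr (\<alpha> - 2 / r))"
    unfolding interp_const_def using K alpha_range by (intro mult_right_mono) auto
  finally show ?thesis .
qed

text \<open>The value at time 0 is replaced by the one at an arbitrary \<open>\<epsilon>\<close>,
  with a bound free of \<open>\<epsilon>\<close>: the derivative bound is integrable at 0, so
  \<open>f\<close> oscillates by at most a multiple of \<open>t1 powr \<alpha>\<close> on the whole
  step.\<close>

lemma interpolation_residual_first:
  fixes f :: "real \<Rightarrow> real"
  assumes m: "m = 1" and K: "0 \<le> K" and \<epsilon>: "\<epsilon> \<in> {0<..t1}"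
    and d: "\<And>s. s \<in> {0<..t m} \<Longrightarrow> (f has_real_derivative f1 s) (at s within {0<..t m})"
    and b: "\<And>s. s \<in> {0<..t m} \<Longrightarrow> \<bar>f1 s\<bar> \<le> K * s powr (\<alpha> - 1)"
  shows "\<bar>\<alpha> / 2 * f \<epsilon> + (1 - \<alpha> / 2) * f (t m) - f ts\<bar>
    \<le> interp_const * K * (t1 powr (2 / r) * t m powr (\<alpha> - 2 / r))"
proof -
  have tm: "t m = t1" using t_1 by (simp add: m)
  have ts: "0 < ts" "ts \<le> t1" using ts_bounds t0 tm by (auto simp: m)
  have deriv: "(f has_vector_derivative f1 s) (at s)" if "0 < s" "s < t1" for s
  proof -
    have "(f has_real_derivative f1 s) (at s within {0<..<t1})"
      using that tm by (intro DERIV_subset[OF d]) auto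
    then show ?thesis
      using that at_within_open[of s "{0<..<t1}"] by (simp add: has_real_derivative_iff_has_vector_derivative)
  qed
  have osc: "\<bar>f y - f x\<bar> \<le> K / \<alpha> * t1 powr \<alpha>" if xy: "0 < x" "x \<le> y" "y \<le> t1" for x y
  proof -
    have "continuous_on {x..y} f"
      using xy tm by (intro continuous_on_subset[OF DERIV_continuous_on[OF d]]) auto
    then have "norm (f y - f x) \<le> K / \<alpha> * (y powr \<alpha> - x powr \<alpha>)"
      using xy alpha_range b tm by (intro powr_increment_bound[where f' = f1] deriv) auto
    also have "\<dots> \<le> K / \<alpha> * t1 powr \<alpha>"
    proof (rule mult_left_mono)
      have "y powr \<alpha> \<le> t1 powr \<alpha>" using xy alpha_range by (intro powr_mono2) auto
      then show "y powr \<alpha> - x powr \<alpha> \<le> t1 powr \<alpha>" using powr_ge_zero[of x \<alpha>] by linarith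
    qed (use K alpha_range in auto)
    finally show ?thesis by simp
  qed
  have osc': "\<bar>f x - f ts\<bar> \<le> K / \<alpha> * t1 powr \<alpha>" if "0 < x" "x \<le> t1" for x
    using osc[of x ts] osc[of ts x] ts that by (cases "x \<le> ts") (auto simp: abs_minus_commute)
  have "\<bar>\<alpha> / 2 * f \<epsilon> + (1 - \<alpha> / 2) * f (t m) - f ts\<bar>
      = \<bar>\<alpha> / 2 * (f \<epsilon> - f ts) + (1 - \<alpha> / 2) * (f t1 - f ts)\<bar>"
    unfolding tm by (simp add: algebra_simps)
  also have "\<dots> \<le> \<alpha> / 2 * (K / \<alpha> * t1 powr \<alpha>) + (1 - \<alpha> / 2) * (K / \<alpha> * t1 powr \<alpha>)"
    using osc'[of \<epsilon>] osc'[of t1] \<epsilon> t1 alpha_range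
    by (intro order_trans[OF abs_triangle_ineq] add_mono) (auto simp: abs_mult simp del: times_divide_eq_left times_divide_eq_right intro!: mult_left_mono)
  also have "\<dots> = K / \<alpha> * t1 powr \<alpha>" by (simp only: distrib_right[symmetric]) simp
  also have "\<dots> = 1 / \<alpha> * K * t1 powr \<alpha>" by simp
  also have "\<dots> \<le> interp_const * K * t1 powr \<alpha>"
    unfolding interp_const_def using K by (intro mult_right_mono) auto
  also have "t1 powr \<alpha> = t1 powr (2 / r) * t m powr (\<alpha> - 2 / r)"
    unfolding tm by (simp flip: powr_add)
  finally show ?thesis .
qed

end

section \<open>The error estimate\<close>

lemma mesh_eq: "mesh T r M j = (T * real M powr (-r)) * real j powr r"
  by (simp add: mesh_def powr_divide powr_minus_divide)

lemma mesh_graded: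
  assumes "0 < \<alpha>" "\<alpha> < 1" "1 \<le> r" "0 < T" "1 \<le> M" "1 \<le> m"
  shows "alikhanov_graded \<alpha> r (T * real M powr (-r)) (mesh T r M) m"
  using assms by unfold_locales (auto simp: mesh_eq)

lemma mesh_le: "0 \<le> T \<Longrightarrow> 0 \<le> r \<Longrightarrow> j \<le> M \<Longrightarrow> mesh T r M j \<le> T"
  unfolding mesh_def by (intro mult_left_le powr_le1) (auto simp: divide_le_eq_1)

lemma first_step_powr:
  assumes "0 < T" "1 \<le> M"
  shows "(T * real M powr (-r)) powr e = T powr e * real M powr (- (r * e))"
  using assms by (simp add: powr_mult powr_powr)

text \<open>For \<open>\<mu>\<close> above 1 the sum in \<open>critical_stability\<close> is of
  order \<open>t1 powr (1 - \<mu>)\<close>, for \<open>\<mu> = 1\<close> it is logarithmic, and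
  below 1 \<open>subcritical_stability\<close> takes over. The factor \<open>t1 powr \<mu>\<close>
  then turns powers of \<open>t1\<close> into the powers of \<open>M\<close> of the three
  regimes.\<close>

lemma err_star_barrier:
  assumes \<alpha>: "0 < \<alpha>" "\<alpha> < 1" and rr: "1 \<le> r" and T: "0 < T"
  defines "\<mu> \<equiv> min (\<alpha> + 1) ((3 - \<alpha>) / r)"
  obtains C where "0 < C"
    "\<And>M n. 1 \<le> M \<Longrightarrow> n \<in> {1..M} \<Longrightarrow> \<exists>B. B 0 = 0 \<and>
      (\<forall>m\<in>{1..n}. (T * real M powr (-r) / mesh T r M m) powr \<mu> \<le> alikhanov_mesh.disc_op \<alpha> (mesh T r M) m B) \<and>
      B n \<le> C * err_star \<alpha> T r M n"
proof -
  define expo where "expo = (3 - \<alpha>) / r"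
  define t1 where "t1 M = T * real M powr (-r)" for M :: nat
  have t1pos: "0 < t1 M" if "1 \<le> M" for M using T that by (simp add: t1_def)
  have scale: "\<exists>B. B 0 = 0 \<and> (\<forall>m\<in>{1..n}. (t1 M / mesh T r M m) powr \<mu> \<le> alikhanov_mesh.disc_op \<alpha> (mesh T r M) m B) \<and>
      B n \<le> C * err_star \<alpha> T r M n"
    if M: "1 \<le> M" "n \<in> {1..M}" and B: "B 0 = 0"
      "\<forall>m\<in>{1..n}. mesh T r M m powr (-\<mu>) \<le> alikhanov_mesh.disc_op \<alpha> (mesh T r M) m B"
      "t1 M powr \<mu> * B n \<le> C * err_star \<alpha> T r M n" for M n B C
  proof (intro exI[of _ "\<lambda>j. t1 M powr \<mu> * B j"] conjI ballI)
    fix m assume mn: "m \<in> {1..n}"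
    interpret alikhanov_graded \<alpha> r "t1 M" "mesh T r M" m
      unfolding t1_def using mesh_graded \<alpha> rr T M mn by simp
    have "(t1 M / mesh T r M m) powr \<mu> = t1 M powr \<mu> * mesh T r M m powr (-\<mu>)"
      using t_pos[OF m1] t1pos[OF M(1)] by (simp add: powr_divide powr_minus_divide)
    also have "\<dots> \<le> t1 M powr \<mu> * disc_op B" using B(2) mn by (intro mult_left_mono) auto
    finally show "(t1 M / mesh T r M m) powr \<mu> \<le> disc_op (\<lambda>j. t1 M powr \<mu> * B j)"
      by (simp add: disc_op_scale)
  qed (use B in auto)
  have t1p: "t1 M powr e = T powr e * real M powr (- (r * e))" if "1 \<le> M" for M e
    unfolding t1_def using first_step_powr[OF T that] .
  consider "r < 3 - \<alpha>" | "r = 3 - \<alpha>" | "3 - \<alpha> < r" by linarith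
  then show thesis
  proof cases
    case 1
    have "1 < (3 - \<alpha>) / r" using 1 rr by simp
    then have "1 < \<mu>" using \<alpha> by (simp add: \<mu>_def)
    then have \<mu>: "1 < \<mu>" "\<alpha> \<le> \<mu>" using \<alpha> by auto
    obtain C where C: "0 < C" "\<And>t1 t n. 0 < t1 \<Longrightarrow> (\<And>j. t j = t1 * real j powr r) \<Longrightarrow> 1 \<le> n \<Longrightarrow>
      \<exists>B. B 0 = 0 \<and> (\<forall>m\<in>{1..n}. t m powr (-\<mu>) \<le> alikhanov_mesh.disc_op \<alpha> t m B) \<and>
        B n \<le> C * t n powr (\<alpha> - 1) * (\<Sum>p=1..n. (t p - t (p - 1)) * t p powr (-\<mu>))"
      using critical_stability[OF \<alpha> rr less_imp_le[OF 1] \<mu>(2)] by blast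
    define C' where "C' = C * (1 + 1 / (\<mu> - 1)) * T"
    show thesis
    proof (rule that[of C'])
      show "0 < C'" using C(1) \<mu> T by (auto simp: C'_def intro!: mult_pos_pos add_pos_pos)
      fix M n :: nat assume M: "1 \<le> M" "n \<in> {1..M}"
      then have n: "1 \<le> n" by auto
      interpret alikhanov_graded \<alpha> r "t1 M" "mesh T r M" n
        unfolding t1_def using mesh_graded \<alpha> rr T M n by simp
      obtain B where B: "B 0 = 0" "\<forall>m\<in>{1..n}. mesh T r M m powr (-\<mu>) \<le> alikhanov_mesh.disc_op \<alpha> (mesh T r M) m B"
        "B n \<le> C * mesh T r M n powr (\<alpha> - 1) * (\<Sum>p=1..n. (mesh T r M p - mesh T r M (p - 1)) * mesh T r M p powr (-\<mu>))"
        using C(2)[of "t1 M" "mesh T r M" n] t1pos[OF M(1)] t_eq n by blast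
      have "B n \<le> C * mesh T r M n powr (\<alpha> - 1) * ((1 + 1 / (\<mu> - 1)) * t1 M powr (1 - \<mu>))"
        using B(3) sum_power_lt[of "-\<mu>" n] \<mu> n C(1)
        by (elim order_trans, intro mult_left_mono) (auto simp: \<tau>_def)
      then have "t1 M powr \<mu> * B n \<le> t1 M powr \<mu> * (C * mesh T r M n powr (\<alpha> - 1) * ((1 + 1 / (\<mu> - 1)) * t1 M powr (1 - \<mu>)))"
        by (intro mult_left_mono) auto
      also have "\<dots> = C * (1 + 1 / (\<mu> - 1)) * (t1 M powr \<mu> * t1 M powr (1 - \<mu>)) * mesh T r M n powr (\<alpha> - 1)"
        by (simp only: mult_ac)
      also have "t1 M powr \<mu> * t1 M powr (1 - \<mu>) = T * real M powr (-r)"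
        unfolding powr_add[symmetric] using t1pos[OF M(1)] by (simp add: t1_def)
      finally have "t1 M powr \<mu> * B n \<le> C' * err_star \<alpha> T r M n"
        using 1 by (simp add: C'_def err_star_def Let_def mult_ac)
      from scale[OF M B(1,2) this]
      show "\<exists>B. B 0 = 0 \<and>
        (\<forall>m\<in>{1..n}. (T * real M powr (-r) / mesh T r M m) powr \<mu> \<le> alikhanov_mesh.disc_op \<alpha> (mesh T r M) m B) \<and>
        B n \<le> C' * err_star \<alpha> T r M n" unfolding t1_def .
    qed
  next
    case 2
    have "(3 - \<alpha>) / r = 1" using 2 rr by simp
    then have "\<mu> = 1" using \<alpha> by (simp add: \<mu>_def)
    then have \<mu>: "\<mu> = 1" "\<alpha> \<le> \<mu>" using \<alpha> by auto
    obtain C where C: "0 < C" "\<And>t1 t n. 0 < t1 \<Longrightarrow> (\<And>j. t j = t1 * real j powr r) \<Longrightarrow> 1 \<le> n \<Longrightarrow>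
      \<exists>B. B 0 = 0 \<and> (\<forall>m\<in>{1..n}. t m powr (-\<mu>) \<le> alikhanov_mesh.disc_op \<alpha> t m B) \<and>
        B n \<le> C * t n powr (\<alpha> - 1) * (\<Sum>p=1..n. (t p - t (p - 1)) * t p powr (-\<mu>))"
      using critical_stability[OF \<alpha> rr eq_refl[OF 2] \<mu>(2)] by blast
    show thesis
    proof (rule that[of "C * T"])
      show "0 < C * T" using C(1) T by simp
      fix M n :: nat assume M: "1 \<le> M" "n \<in> {1..M}"
      then have n: "1 \<le> n" by auto
      interpret alikhanov_graded \<alpha> r "t1 M" "mesh T r M" n
        unfolding t1_def using mesh_graded \<alpha> rr T M n by simp
      obtain B where B: "B 0 = 0" "\<forall>m\<in>{1..n}. mesh T r M m powr (-\<mu>) \<le> alikhanov_mesh.disc_op \<alpha> (mesh T r M) m B"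
        "B n \<le> C * mesh T r M n powr (\<alpha> - 1) * (\<Sum>p=1..n. (mesh T r M p - mesh T r M (p - 1)) * mesh T r M p powr (-\<mu>))"
        using C(2)[of "t1 M" "mesh T r M" n] t1pos[OF M(1)] t_eq n by blast
      have "B n \<le> C * mesh T r M n powr (\<alpha> - 1) * (1 + ln (mesh T r M n / t1 M))"
        using B(3) sum_power_eq[OF n] C(1) unfolding \<mu>(1)
        by (elim order_trans, intro mult_left_mono) (auto simp: \<tau>_def)
      then have "t1 M powr \<mu> * B n \<le> t1 M powr \<mu> * (C * mesh T r M n powr (\<alpha> - 1) * (1 + ln (mesh T r M n / t1 M)))"
        by (intro mult_left_mono) auto
      also have "\<dots> = C * T * err_star \<alpha> T r M n"
      proof -
        have "t1 M powr \<mu> = T * real M powr (\<alpha> - 3)"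
          using t1pos[OF M(1)] 2 by (simp add: \<mu>(1) t1_def)
        moreover have "err_star \<alpha> T r M n
            = real M powr (\<alpha> - 3) * mesh T r M n powr (\<alpha> - 1) * (1 + ln (mesh T r M n / t1 M))"
          unfolding err_star_def Let_def t_1 using 2 by (simp only: if_True if_False less_irrefl refl)
        ultimately show ?thesis by (simp only: mult_ac)
      qed
      finally have "t1 M powr \<mu> * B n \<le> C * T * err_star \<alpha> T r M n" .
      from scale[OF M B(1,2) this]
      show "\<exists>B. B 0 = 0 \<and>
        (\<forall>m\<in>{1..n}. (T * real M powr (-r) / mesh T r M m) powr \<mu> \<le> alikhanov_mesh.disc_op \<alpha> (mesh T r M) m B) \<and>
        B n \<le> C * T * err_star \<alpha> T r M n" unfolding t1_def .
    qed
  next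
    case 3
    then have "expo < 1" using rr by (simp add: expo_def)
    then have \<mu>: "\<mu> = expo" "\<mu> < 1" using \<alpha> by (auto simp: \<mu>_def expo_def)
    obtain C where C: "0 < C" "\<And>t1 t n. 0 < t1 \<Longrightarrow> (\<And>j. t j = t1 * real j powr r) \<Longrightarrow> 1 \<le> n \<Longrightarrow>
      \<exists>B. B 0 = 0 \<and> (\<forall>m\<in>{1..n}. t m powr (-\<mu>) \<le> alikhanov_mesh.disc_op \<alpha> t m B) \<and>
        B n \<le> C * t n powr (\<alpha> - \<mu>)"
      using subcritical_stability[OF \<alpha> rr \<mu>(2)] by blast
    show thesis
    proof (rule that[of "C * T powr \<mu>"])
      show "0 < C * T powr \<mu>" using C(1) T by simp
      fix M n :: nat assume M: "1 \<le> M" "n \<in> {1..M}"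
      then have n: "1 \<le> n" by auto
      interpret alikhanov_graded \<alpha> r "t1 M" "mesh T r M" n
        unfolding t1_def using mesh_graded \<alpha> rr T M n by simp
      obtain B where B: "B 0 = 0" "\<forall>m\<in>{1..n}. mesh T r M m powr (-\<mu>) \<le> alikhanov_mesh.disc_op \<alpha> (mesh T r M) m B"
        "B n \<le> C * mesh T r M n powr (\<alpha> - \<mu>)"
        using C(2)[of "t1 M" "mesh T r M" n] t1pos[OF M(1)] t_eq n by blast
      then have "t1 M powr \<mu> * B n \<le> t1 M powr \<mu> * (C * mesh T r M n powr (\<alpha> - \<mu>))"
        by (intro mult_left_mono) auto
      also have "\<dots> = C * T powr \<mu> * err_star \<alpha> T r M n"
      proof -
        have "t1 M powr \<mu> = T powr \<mu> * real M powr (\<alpha> - 3)"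
        proof -
          have "- (r * \<mu>) = \<alpha> - 3" unfolding \<mu>(1) expo_def using rr by simp
          then show ?thesis unfolding t1p[OF M(1)] by (simp only:)
        qed
        moreover have "err_star \<alpha> T r M n = real M powr (\<alpha> - 3) * mesh T r M n powr (\<alpha> - \<mu>)"
          using 3 by (simp add: err_star_def Let_def \<mu>(1) expo_def)
        ultimately show ?thesis by (simp only: mult_ac)
      qed
      finally have "t1 M powr \<mu> * B n \<le> C * T powr \<mu> * err_star \<alpha> T r M n" .
      from scale[OF M B(1,2) this]
      show "\<exists>B. B 0 = 0 \<and>
        (\<forall>m\<in>{1..n}. (T * real M powr (-r) / mesh T r M m) powr \<mu> \<le> alikhanov_mesh.disc_op \<alpha> (mesh T r M) m B) \<and>
        B n \<le> C * T powr \<mu> * err_star \<alpha> T r M n" unfolding t1_def .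
    qed
  qed
qed

lemma err_star_nonneg:
  assumes "0 < \<alpha>" "\<alpha> < 1" "1 \<le> r" "0 < T" "1 \<le> M" "1 \<le> n"
  shows "0 \<le> err_star \<alpha> T r M n"
proof -
  interpret alikhanov_graded \<alpha> r "T * real M powr (-r)" "mesh T r M" n
    using mesh_graded assms by simp
  have "1 \<le> mesh T r M n / mesh T r M 1" using t_le[of 1 n] t_pos[of 1] assms(6) by simp
  then have *: "0 \<le> ln (mesh T r M n / mesh T r M 1)" by (rule ln_ge_zero)
  have "0 \<le> (if c then x else if d then y else z)" if "0 \<le> x" "0 \<le> y" "0 \<le> z" for c d and x y z :: real
    using that by simp
  then show ?thesis
    unfolding err_star_def Let_def
    by this (intro mult_nonneg_nonneg add_nonneg_nonneg * powr_ge_zero zero_le_one)+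
qed

text \<open>If \<open>2 / r < \<alpha> + 1\<close>, the exponent 2 / r - \<alpha> is below 1 and
  \<open>subcritical_stability\<close> produces the extra term. Otherwise the required lower bound
  is \<open>t m powr \<alpha> * (t1 / t m) powr (2 / r)\<close>, at most
  \<open>T powr \<alpha> * (t1 / t m) powr \<mu>\<close> because
  \<open>\<mu> \<le> \<alpha> + 1 \<le> 2 / r\<close> and the ratio is at most 1; the barrier for
  \<open>err_star\<close> covers it.\<close>

lemma err_star2_barrier:
  assumes \<alpha>: "0 < \<alpha>" "\<alpha> < 1" and rr: "1 \<le> r" and T: "0 < T"
  obtains C where "0 < C"
    "\<And>M n. 1 \<le> M \<Longrightarrow> n \<in> {1..M} \<Longrightarrow> \<exists>B. B 0 = 0 \<and>
      (\<forall>m\<in>{1..n}. (T * real M powr (-r)) powr (2 / r) * mesh T r M m powr (\<alpha> - 2 / r)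
        \<le> alikhanov_mesh.disc_op \<alpha> (mesh T r M) m B) \<and>
      B n \<le> C * err_star2 \<alpha> T r M n"
proof (cases "2 / r < \<alpha> + 1")
  case True
  obtain C where C: "0 < C" "\<And>t1 t n. 0 < t1 \<Longrightarrow> (\<And>j. t j = t1 * real j powr r) \<Longrightarrow> 1 \<le> n \<Longrightarrow>
      \<exists>B. B 0 = 0 \<and> (\<forall>m\<in>{1..n}. t m powr (- (2 / r - \<alpha>)) \<le> alikhanov_mesh.disc_op \<alpha> t m B) \<and>
        B n \<le> C * t n powr (\<alpha> - (2 / r - \<alpha>))"
    using subcritical_stability[OF \<alpha> rr, of "2 / r - \<alpha>"] True by auto
  show thesis
  proof (rule that[of "C * T powr (2 / r)"])
    show "0 < C * T powr (2 / r)" using C(1) T by simp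
    fix M n :: nat assume M: "1 \<le> M" "n \<in> {1..M}"
    then have n: "1 \<le> n" by auto
    define t1 where "t1 = T * real M powr (-r)"
    have grd: "alikhanov_graded \<alpha> r t1 (mesh T r M) m" if "1 \<le> m" for m
      unfolding t1_def using mesh_graded \<alpha> rr T M that by simp
    interpret alikhanov_graded \<alpha> r t1 "mesh T r M" n by (rule grd[OF n])
    obtain B where B: "B 0 = 0" "\<forall>m\<in>{1..n}. mesh T r M m powr (- (2 / r - \<alpha>)) \<le> alikhanov_mesh.disc_op \<alpha> (mesh T r M) m B"
      "B n \<le> C * mesh T r M n powr (\<alpha> - (2 / r - \<alpha>))"
      using C(2)[of t1 "mesh T r M" n] t1 t_eq n by blast
    have t1p: "t1 powr (2 / r) = T powr (2 / r) * real M powr (-2)"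
      unfolding t1_def using first_step_powr[OF T M(1), of r "2 / r"] rr by simp
    have "\<forall>m\<in>{1..n}. t1 powr (2 / r) * mesh T r M m powr (\<alpha> - 2 / r)
        \<le> alikhanov_mesh.disc_op \<alpha> (mesh T r M) m (\<lambda>j. t1 powr (2 / r) * B j)"
    proof
      fix m assume m: "m \<in> {1..n}"
      interpret m: alikhanov_graded \<alpha> r t1 "mesh T r M" m using grd m by simp
      show "t1 powr (2 / r) * mesh T r M m powr (\<alpha> - 2 / r) \<le> m.disc_op (\<lambda>j. t1 powr (2 / r) * B j)"
        unfolding m.disc_op_scale using B(2) m by (intro mult_left_mono) auto
    qed
    moreover have "t1 powr (2 / r) * B n \<le> C * T powr (2 / r) * err_star2 \<alpha> T r M n"
    proof -
      have "t1 powr (2 / r) * B n \<le> t1 powr (2 / r) * (C * mesh T r M n powr (2 * \<alpha> - 2 / r))"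
        using B(3) by (intro mult_left_mono) (auto simp: algebra_simps)
      also have "\<dots> = C * T powr (2 / r) * (real M powr (-2) * mesh T r M n powr (2 * \<alpha> - 2 / r))"
        unfolding t1p by (simp only: mult_ac)
      also have "\<dots> \<le> C * T powr (2 / r) * err_star2 \<alpha> T r M n"
        using err_star_nonneg[OF \<alpha> rr T M(1) n] C(1) True unfolding err_star2_def by (intro mult_left_mono) auto
      finally show ?thesis .
    qed
    ultimately show "\<exists>B. B 0 = 0 \<and>
      (\<forall>m\<in>{1..n}. (T * real M powr (-r)) powr (2 / r) * mesh T r M m powr (\<alpha> - 2 / r)
        \<le> alikhanov_mesh.disc_op \<alpha> (mesh T r M) m B) \<and>
      B n \<le> C * T powr (2 / r) * err_star2 \<alpha> T r M n"
      using B(1) unfolding t1_def by (intro exI[of _ "\<lambda>j. (T * real M powr (-r)) powr (2 / r) * B j"]) auto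
  qed
next
  case False
  define \<mu> where "\<mu> = min (\<alpha> + 1) ((3 - \<alpha>) / r)"
  obtain C where C: "0 < C" "\<And>M n. 1 \<le> M \<Longrightarrow> n \<in> {1..M} \<Longrightarrow> \<exists>B. B 0 = 0 \<and>
      (\<forall>m\<in>{1..n}. (T * real M powr (-r) / mesh T r M m) powr \<mu> \<le> alikhanov_mesh.disc_op \<alpha> (mesh T r M) m B) \<and>
      B n \<le> C * err_star \<alpha> T r M n"
    using err_star_barrier[OF \<alpha> rr T] unfolding \<mu>_def by blast
  show thesis
  proof (rule that[of "C * T powr \<alpha>"])
    show "0 < C * T powr \<alpha>" using C(1) T by simp
    fix M n :: nat assume M: "1 \<le> M" "n \<in> {1..M}"
    then have n: "1 \<le> n" by auto
    define t1 where "t1 = T * real M powr (-r)"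
    obtain B where B: "B 0 = 0" "\<forall>m\<in>{1..n}. (t1 / mesh T r M m) powr \<mu> \<le> alikhanov_mesh.disc_op \<alpha> (mesh T r M) m B"
      "B n \<le> C * err_star \<alpha> T r M n"
      using C(2)[OF M] unfolding t1_def by blast
    have "\<forall>m\<in>{1..n}. t1 powr (2 / r) * mesh T r M m powr (\<alpha> - 2 / r)
        \<le> alikhanov_mesh.disc_op \<alpha> (mesh T r M) m (\<lambda>j. T powr \<alpha> * B j)"
    proof
      fix m assume m: "m \<in> {1..n}"
      interpret m: alikhanov_graded \<alpha> r t1 "mesh T r M" m
        unfolding t1_def using mesh_graded \<alpha> rr T M m by simp
      have tm: "0 < mesh T r M m" "t1 \<le> mesh T r M m" "mesh T r M m \<le> T"
        using m.t_pos[OF m.m1] m.t1_le[OF m.m1] mesh_le[of T r m M] T rr m M by auto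
      have "t1 powr (2 / r) * mesh T r M m powr (\<alpha> - 2 / r) = mesh T r M m powr \<alpha> * (t1 / mesh T r M m) powr (2 / r)"
        using tm m.t1 by (simp add: powr_divide powr_diff)
      also have "\<dots> \<le> T powr \<alpha> * (t1 / mesh T r M m) powr \<mu>"
        using tm m.t1 \<alpha> False by (intro mult_mono powr_mono2 powr_mono') (auto simp: \<mu>_def)
      also have "\<dots> \<le> T powr \<alpha> * m.disc_op B" using B(2) m by (intro mult_left_mono) auto
      finally show "t1 powr (2 / r) * mesh T r M m powr (\<alpha> - 2 / r) \<le> m.disc_op (\<lambda>j. T powr \<alpha> * B j)"
        unfolding m.disc_op_scale .
    qed
    moreover have "T powr \<alpha> * B n \<le> C * T powr \<alpha> * err_star2 \<alpha> T r M n"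
      using mult_left_mono[OF B(3), of "T powr \<alpha>"] False by (simp add: err_star2_def mult_ac)
    ultimately show "\<exists>B. B 0 = 0 \<and>
      (\<forall>m\<in>{1..n}. (T * real M powr (-r)) powr (2 / r) * mesh T r M m powr (\<alpha> - 2 / r)
        \<le> alikhanov_mesh.disc_op \<alpha> (mesh T r M) m B) \<and>
      B n \<le> C * T powr \<alpha> * err_star2 \<alpha> T r M n"
      using B(1) unfolding t1_def by (intro exI[of _ "\<lambda>j. T powr \<alpha> * B j"]) auto
  qed
qed

section \<open>From vector-valued functions of time to scalar ones\<close>

lemma time_diff_has_vector_derivative:
  assumes "time_diff n T v" "l < n" "s \<in> {0<..T}"
  shows "((time_deriv T ^^ l) v has_vector_derivative (time_deriv T ^^ Suc l) v s) (at s within {0<..T})"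
  using assms unfolding time_diff_def by (simp add: time_deriv_def vector_derivative_works)

lemma time_diff_inner:
  fixes v :: "real \<Rightarrow> 'b::real_inner"
  assumes "time_diff n T v" "l < n" "T' \<le> T" "s \<in> {0<..T'}"
  shows "((\<lambda>s. inner ((time_deriv T ^^ l) v s) y) has_real_derivative inner ((time_deriv T ^^ Suc l) v s) y)
    (at s within {0<..T'})"
proof -
  have "((time_deriv T ^^ l) v has_vector_derivative (time_deriv T ^^ Suc l) v s) (at s within {0<..T'})"
    using assms by (intro has_vector_derivative_within_subset[OF time_diff_has_vector_derivative]) auto
  then show ?thesis
    unfolding has_real_derivative_iff_has_vector_derivative
    by (rule bounded_linear.has_vector_derivative[OF bounded_linear_inner_left])
qed

lemma norm_le_inner:
  fixes x :: "'b::real_inner"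
  assumes "\<And>y. norm y = 1 \<Longrightarrow> inner x y \<le> R" "0 \<le> R"
  shows "norm x \<le> R"
proof (cases "x = 0")
  case False
  then have "inner x (sgn x) = norm x"
    by (simp add: sgn_div_norm dot_square_norm power2_eq_square)
  then show ?thesis using assms(1)[of "sgn x"] False by (simp add: norm_sgn)
qed (use assms in simp)

text \<open>The integrand refers to a two-sided derivative, while the regularity hypotheses speak of
  derivatives within the time interval. Both agree in the open interval, and the two end points do
  not affect the integral.\<close>

lemma caputo_inner:
  fixes v :: "real \<Rightarrow> 'b::real_inner"
  assumes int: "caputo_integrand \<alpha> v x integrable_on {0..x}"
    and d: "\<And>s. 0 < s \<Longrightarrow> s < x \<Longrightarrow> vector_derivative v (at s) = v' s"
  shows "(\<lambda>s. (x - s) powr (-\<alpha>) * inner (v' s) y) integrable_on {0..x}"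
    and "inner (integral {0..x} (caputo_integrand \<alpha> v x)) y = integral {0..x} (\<lambda>s. (x - s) powr (-\<alpha>) * inner (v' s) y)"
proof -
  have "((\<lambda>s. inner (caputo_integrand \<alpha> v x s) y) has_integral inner (integral {0..x} (caputo_integrand \<alpha> v x)) y) {0..x}"
    using has_integral_linear[OF integrable_integral[OF int] bounded_linear_inner_left[of y]] by (simp add: o_def)
  then have "((\<lambda>s. (x - s) powr (-\<alpha>) * inner (v' s) y) has_integral inner (integral {0..x} (caputo_integrand \<alpha> v x)) y) {0..x}"
    by (rule has_integral_spike_finite[of "{0, x}", rotated 2]) (auto simp: caputo_integrand_def d)
  then show "(\<lambda>s. (x - s) powr (-\<alpha>) * inner (v' s) y) integrable_on {0..x}"
    "inner (integral {0..x} (caputo_integrand \<alpha> v x)) y = integral {0..x} (\<lambda>s. (x - s) powr (-\<alpha>) * inner (v' s) y)"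
    by (auto simp: integral_unique)
qed

section \<open>Consistency and error of the scheme for the evolution problem\<close>

locale alikhanov_problem =
  fixes \<Omega> :: "'a::euclidean_space set"
    and a :: "'a \<Rightarrow> 'a \<Rightarrow> real" and c :: "'a \<Rightarrow> real"
    and \<alpha> T r K :: real
    and f u :: "real \<Rightarrow> 'a l2" and u0 :: "'a l2"
  assumes \<Omega>: "open \<Omega>" "bounded \<Omega>"
    and a_cont: "\<And>b. b \<in> Basis \<Longrightarrow> continuous_on (closure \<Omega>) (a b)"
    and a_pos: "\<And>b x. b \<in> Basis \<Longrightarrow> x \<in> closure \<Omega> \<Longrightarrow> a b x > 0"
    and c_cont: "continuous_on (closure \<Omega>) c"
    and c_nonneg: "\<And>x. x \<in> closure \<Omega> \<Longrightarrow> c x \<ge> 0"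
    and alpha: "0 < \<alpha>" "\<alpha> < 1" and T: "T > 0" and r: "r \<ge> 1"
    and sol: "ibvp_solution \<Omega> a c \<alpha> T f u0 u"
    and u_diff: "time_diff 3 T u"
    and Lu_diff: "time_diff 2 T (\<lambda>t. elliptic_op \<Omega> a c (u t))"
    and u_bound: "\<And>l t. l \<in> {1, 3} \<Longrightarrow> t \<in> {0<..T} \<Longrightarrow>
      norm ((time_deriv T ^^ l) u t) \<le> K * (1 + t powr (\<alpha> - real l))"
    and Lu_bound: "\<And>t. t \<in> {0<..T} \<Longrightarrow>
      norm ((time_deriv T ^^ 2) (\<lambda>t. elliptic_op \<Omega> a c (u t)) t) \<le> K * (1 + t powr (\<alpha> - 2))"
begin

abbreviation "w \<equiv> \<lambda>s. elliptic_op \<Omega> a c (u s)"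
abbreviation "du l \<equiv> (time_deriv T ^^ l) u"
abbreviation "dw l \<equiv> (time_deriv T ^^ l) w"

text \<open>\<open>K1\<close> and \<open>K2\<close> absorb the summand 1 of the regularity bounds,
  so that pure powers of time remain; this works on a bounded interval since the exponents are
  negative. \<open>K3\<close> plays the same role for the first time derivative of the elliptic
  term, see \<open>dw1_bound\<close>.\<close>

definition "K1 = K * (1 + T powr (1 - \<alpha>) + T powr (3 - \<alpha>))"
definition "K2 = K * (1 + T powr (2 - \<alpha>))"
definition "K3 = norm (dw 1 T) * T powr (1 - \<alpha>) + K2 / (1 - \<alpha>)"

lemma u_props: "continuous_on {0..T} u" "u 0 = u0"
  using sol unfolding ibvp_solution_def by blast+

lemma u_at:
  assumes "s \<in> {0<..T}"
  shows "caputo_integrand \<alpha> u s integrable_on {0..s}" "u s \<in> H10 \<Omega>" "u s \<in> elliptic_dom \<Omega> a c"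
    "caputo \<alpha> u s + w s = f s"
  using sol assms unfolding ibvp_solution_def by blast+

lemma K_nonneg: "0 \<le> K" "0 \<le> K1" "0 \<le> K2" "0 \<le> K3"
proof -
  have "0 \<le> K * (1 + T powr (\<alpha> - real 1))"
    by (rule order_trans[OF norm_ge_zero u_bound[of 1 T]]) (use T in auto)
  moreover have "0 < 1 + T powr (\<alpha> - real 1)" by (intro add_pos_nonneg) auto
  ultimately show K: "0 \<le> K" by (simp add: zero_le_mult_iff)
  then show "0 \<le> K1" "0 \<le> K2" by (auto simp: K1_def K2_def)
  then show "0 \<le> K3" using alpha by (auto simp: K3_def)
qed

lemma powr_weight:
  assumes "s \<in> {0<..T}" "e \<le> 0"
  shows "1 + s powr e \<le> (1 + T powr (-e)) * s powr e"
proof -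
  have "1 = s powr (-e) * s powr e" using assms by (simp flip: powr_add)
  also have "\<dots> \<le> T powr (-e) * s powr e" using assms by (intro mult_right_mono powr_mono2) auto
  finally show ?thesis by (simp add: distrib_right)
qed

lemma du_bound:
  assumes "l \<in> {1, 3}" "s \<in> {0<..T}"
  shows "norm (du l s) \<le> K1 * s powr (\<alpha> - real l)"
proof -
  have "norm (du l s) \<le> K * (1 + s powr (\<alpha> - real l))" by (rule u_bound[OF assms])
  also have "\<dots> \<le> K * ((1 + T powr (- (\<alpha> - real l))) * s powr (\<alpha> - real l))"
    using assms alpha K_nonneg(1) by (intro mult_left_mono powr_weight) auto
  also have "\<dots> \<le> K * ((1 + T powr (1 - \<alpha>) + T powr (3 - \<alpha>)) * s powr (\<alpha> - real l))"
    using assms(1) K_nonneg(1) by (intro mult_left_mono mult_right_mono) auto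
  finally show ?thesis by (simp add: K1_def mult.assoc)
qed

lemma dw2_bound:
  assumes "s \<in> {0<..T}"
  shows "norm (dw 2 s) \<le> K2 * s powr (\<alpha> - 2)"
proof -
  have "norm (dw 2 s) \<le> K * (1 + s powr (\<alpha> - 2))" by (rule Lu_bound[OF assms])
  also have "\<dots> \<le> K * ((1 + T powr (- (\<alpha> - 2))) * s powr (\<alpha> - 2))"
    using assms alpha K_nonneg(1) by (intro mult_left_mono powr_weight) auto
  finally show ?thesis by (simp add: K2_def mult.assoc)
qed

text \<open>The regularity bound concerns the second derivative, which need not be integrable at 0.
  It is therefore integrated backwards from \<open>T\<close>, where the first derivative is a fixed
  vector.\<close>

lemma dw1_bound:
  assumes "s \<in> {0<..T}"
  shows "norm (dw 1 s) \<le> K3 * s powr (\<alpha> - 1)"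
proof -
  have d: "(dw 1 has_vector_derivative dw 2 x) (at x within {0<..T})" if "x \<in> {0<..T}" for x
    using time_diff_has_vector_derivative[OF Lu_diff, of 1 x] that by (simp add: numeral_2_eq_2)
  have "norm (dw 1 T - dw 1 s) \<le> K2 / (\<alpha> - 1) * (T powr (\<alpha> - 1) - s powr (\<alpha> - 1))"
  proof (rule powr_increment_bound)
    have "continuous_on {0<..T} (dw 1)"
      using d has_vector_derivative_continuous by (blast intro: continuous_on_eq_continuous_within[THEN iffD2])
    then show "continuous_on {s..T} (dw 1)" by (rule continuous_on_subset) (use assms in auto)
    fix x assume x: "s < x" "x < T"
    have "(dw 1 has_vector_derivative dw 2 x) (at x within {0<..<T})"
      by (rule has_vector_derivative_within_subset[OF d]) (use x assms in auto)
    then show "(dw 1 has_vector_derivative dw 2 x) (at x)"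
      using x assms at_within_open[of x "{0<..<T}"] by simp
    show "norm (dw 2 x) \<le> K2 * x powr (\<alpha> - 1 - 1)" using dw2_bound[of x] x assms by simp
  qed (use assms alpha in auto)
  also have "\<dots> = K2 / (1 - \<alpha>) * (s powr (\<alpha> - 1) - T powr (\<alpha> - 1))"
  proof -
    have "K2 / (\<alpha> - 1) = - (K2 / (1 - \<alpha>))" using minus_divide_right[of K2 "1 - \<alpha>"] by simp
    moreover have "- b * (x - y) = b * (y - x)" for b x y :: real by (simp add: algebra_simps)
    ultimately show ?thesis by (simp only:)
  qed
  also have "\<dots> \<le> K2 / (1 - \<alpha>) * s powr (\<alpha> - 1)"
    using K_nonneg alpha by (intro mult_left_mono) auto
  finally have 1: "norm (dw 1 T - dw 1 s) \<le> K2 / (1 - \<alpha>) * s powr (\<alpha> - 1)" .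
  have "1 = s powr (1 - \<alpha>) * s powr (\<alpha> - 1)" using assms by (simp flip: powr_add)
  also have "\<dots> \<le> T powr (1 - \<alpha>) * s powr (\<alpha> - 1)" using assms alpha by (intro mult_right_mono powr_mono2) auto
  finally have "norm (dw 1 T) \<le> norm (dw 1 T) * (T powr (1 - \<alpha>) * s powr (\<alpha> - 1))"
    by (simp add: mult_le_cancel_left1)
  moreover have "norm (dw 1 s) \<le> norm (dw 1 T) + norm (dw 1 T - dw 1 s)"
    using norm_triangle_ineq4[of "dw 1 T" "dw 1 T - dw 1 s"] by simp
  ultimately have "norm (dw 1 s) \<le> norm (dw 1 T) * (T powr (1 - \<alpha>) * s powr (\<alpha> - 1)) + K2 / (1 - \<alpha>) * s powr (\<alpha> - 1)"
    using 1 by linarith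
  then show ?thesis by (simp only: K3_def distrib_right mult.assoc)
qed

lemma Gamma_pos: "0 < Gamma (1 - \<alpha>)"
  using alpha by (intro Gamma_real_pos) auto

text \<open>The error equation is multiplied by \<open>Gamma (1 - \<alpha>)\<close>, because the
  weights \<open>g\<close> leave this factor out; hence its appearance in the elliptic part
  only.\<close>

definition consistency_bound where
  "consistency_bound M m = alikhanov_graded.residual_const \<alpha> r * K1 *
      (T * real M powr (-r) / mesh T r M m) powr (min (\<alpha> + 1) ((3 - \<alpha>) / r))
    + Gamma (1 - \<alpha>) * alikhanov_graded.interp_const \<alpha> r * (K2 + K3) *
      ((T * real M powr (-r)) powr (2 / r) * mesh T r M m powr (\<alpha> - 2 / r))"

text \<open>
  For \<open>m = 1\<close> the initial value need not lie in the domain of the elliptic operator, which is why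
  the value at time \<open>0\<close> is replaced by that at a small positive time \<open>x\<close>.
\<close>

lemma consistency:
  fixes M m :: nat
  defines "t \<equiv> mesh T r M" and "ts \<equiv> tstar \<alpha> (mesh T r M) m"
  assumes M: "1 \<le> M" "m \<in> {1..M}"
    and x: "if m = 1 then x \<in> {0<..t 1} else x = t (m - 1)"
  shows "norm (Gamma (1 - \<alpha>) *\<^sub>R (alikhanov_op \<alpha> t (\<lambda>j. u (t j)) m - caputo \<alpha> u ts)
      + Gamma (1 - \<alpha>) *\<^sub>R ((\<alpha> / 2) *\<^sub>R w x + (1 - \<alpha> / 2) *\<^sub>R w (t m) - w ts))
    \<le> consistency_bound M m"
proof -
  define t1 where "t1 = T * real M powr (-r)"
  interpret g: alikhanov_graded \<alpha> r t1 t m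
    unfolding t1_def t_def using mesh_graded alpha r T M by simp
  have ts: "g.ts = ts" by (simp only: g.ts_def ts_def) (simp only: t_def)
  have tm: "0 < t m" "t m \<le> T" "0 < ts" "ts < t m"
  proof -
    show "t m \<le> T" unfolding t_def using mesh_le[of T r m M] T r M by simp
    show "0 < t m" "0 < ts" "ts < t m"
      using g.t_pos[OF g.m1] g.ts_bounds g.t_le[of 0 "m - 1"] g.t0 by (auto simp: ts)
  qed
  have Gp: "0 < Gamma (1 - \<alpha>)" by (rule Gamma_pos)
  have cint: "caputo_integrand \<alpha> u ts integrable_on {0..ts}"
    using tm by (intro u_at) auto
  have vd: "vector_derivative u (at s) = du 1 s" if "0 < s" "s < ts" for s
  proof (rule vector_derivative_at)
    have "(u has_vector_derivative du 1 s) (at s within {0<..<T})"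
    proof (rule has_vector_derivative_within_subset)
      show "(u has_vector_derivative du 1 s) (at s within {0<..T})"
        using time_diff_has_vector_derivative[OF u_diff, of 0 s] that tm by simp
    qed auto
    then show "(u has_vector_derivative du 1 s) (at s)"
      using that tm at_within_open[of s "{0<..<T}"] by simp
  qed
  define B1 where "B1 = g.residual_const * K1 * (t1 / t m) powr g.rate"
  define B2 where "B2 = g.interp_const * (K2 + K3) * (t1 powr (2 / r) * t m powr (\<alpha> - 2 / r))"
  have ic: "0 \<le> g.interp_const" using alpha r by (simp add: g.interp_const_def)
  have cb: "consistency_bound M m = B1 + Gamma (1 - \<alpha>) * B2"
    by (simp only: consistency_bound_def B1_def B2_def g.rate_def t1_def t_def mult.assoc)
  show ?thesis
  proof (rule norm_le_inner)
    fix y :: "'a l2" assume y: "norm y = 1"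
    have cs: "\<bar>inner v y\<bar> \<le> norm v" for v using Cauchy_Schwarz_ineq2[of v y] y by simp
    define \<phi> where "\<phi> l s = inner (du l s) y" for l s
    define \<psi> where "\<psi> l s = inner (dw l s) y" for l s
    have d\<phi>: "(\<phi> l has_real_derivative \<phi> (Suc l) s) (at s within {0<..t m})" if "l < 3" "s \<in> {0<..t m}" for l s
      unfolding \<phi>_def using time_diff_inner[OF u_diff that(1) tm(2) that(2)] .
    have d\<psi>: "(\<psi> l has_real_derivative \<psi> (Suc l) s) (at s within {0<..t m})" if "l < 2" "s \<in> {0<..t m}" for l s
      unfolding \<psi>_def using time_diff_inner[OF Lu_diff that(1) tm(2) that(2)] .
    note ci = caputo_inner[OF cint vd, of y]
    have 1: "\<bar>g.disc_op (\<lambda>j. \<phi> 0 (t j)) - integral {0..g.ts} (\<lambda>s. g.\<kappa> s * \<phi> 1 s)\<bar> \<le> B1"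
      unfolding B1_def
    proof (rule g.caputo_residual)
      show "continuous_on {0..t m} (\<phi> 0)"
        unfolding \<phi>_def using tm by (intro continuous_intros) (auto intro: continuous_on_subset[OF u_props(1)])
      show "(\<phi> 0 has_real_derivative \<phi> 1 s) (at s within {0<..t m})"
        "(\<phi> 1 has_real_derivative \<phi> 2 s) (at s within {0<..t m})"
        "(\<phi> 2 has_real_derivative \<phi> 3 s) (at s within {0<..t m})" if "s \<in> {0<..t m}" for s
        using d\<phi>[of 0 s] d\<phi>[of 1 s] d\<phi>[of 2 s] that by (simp_all add: eval_nat_numeral)
      show "\<bar>\<phi> 1 s\<bar> \<le> K1 * s powr (\<alpha> - 1)" "\<bar>\<phi> 3 s\<bar> \<le> K1 * s powr (\<alpha> - 3)" if "s \<in> {0<..t m}" for s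
        unfolding \<phi>_def using order_trans[OF cs du_bound[of 1 s]] order_trans[OF cs du_bound[of 3 s]] that tm by auto
      show "(\<lambda>s. g.\<kappa> s * \<phi> 1 s) integrable_on {0..g.ts}"
        unfolding g.\<kappa>_def ts \<phi>_def by (rule ci(1))
    qed (rule K_nonneg)
    have 2: "\<bar>\<alpha> / 2 * \<psi> 0 x + (1 - \<alpha> / 2) * \<psi> 0 (t m) - \<psi> 0 g.ts\<bar> \<le> B2"
    proof (cases "m = 1")
      case True
      have "\<bar>\<alpha> / 2 * \<psi> 0 x + (1 - \<alpha> / 2) * \<psi> 0 (t m) - \<psi> 0 g.ts\<bar>
          \<le> g.interp_const * K3 * (t1 powr (2 / r) * t m powr (\<alpha> - 2 / r))"
      proof (rule g.interpolation_residual_first[OF True])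
        show "x \<in> {0<..t1}" using x True g.t_1 by simp
        show "(\<psi> 0 has_real_derivative \<psi> 1 s) (at s within {0<..t m})" if "s \<in> {0<..t m}" for s
          using d\<psi>[of 0 s] that by simp
        show "\<bar>\<psi> 1 s\<bar> \<le> K3 * s powr (\<alpha> - 1)" if "s \<in> {0<..t m}" for s
          unfolding \<psi>_def using order_trans[OF cs dw1_bound[of s]] that tm by auto
      qed (rule K_nonneg)
      also have "\<dots> \<le> B2"
        unfolding B2_def using ic K_nonneg by (intro mult_right_mono mult_left_mono) auto
      finally show ?thesis .
    next
      case False
      then have x': "x = t (m - 1)" using x by simp
      have "\<bar>\<alpha> / 2 * \<psi> 0 x + (1 - \<alpha> / 2) * \<psi> 0 (t m) - \<psi> 0 g.ts\<bar>
          \<le> g.interp_const * K2 * (t1 powr (2 / r) * t m powr (\<alpha> - 2 / r))"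
        unfolding x'
      proof (rule g.interpolation_residual)
        show "2 \<le> m" using False g.m1 by simp
        show "(\<psi> 0 has_real_derivative \<psi> 1 s) (at s within {0<..t m})"
          "(\<psi> 1 has_real_derivative \<psi> 2 s) (at s within {0<..t m})" if "s \<in> {0<..t m}" for s
          using d\<psi>[of 0 s] d\<psi>[of 1 s] that by (simp_all add: eval_nat_numeral)
        show "\<bar>\<psi> 2 s\<bar> \<le> K2 * s powr (\<alpha> - 2)" if "s \<in> {0<..t m}" for s
          unfolding \<psi>_def using order_trans[OF cs dw2_bound[of s]] that tm by auto
      qed (rule K_nonneg)
      also have "\<dots> \<le> B2"
        unfolding B2_def using ic K_nonneg by (intro mult_right_mono mult_left_mono) auto
      finally show ?thesis .
    qed
    have 3: "inner (Gamma (1 - \<alpha>) *\<^sub>R (alikhanov_op \<alpha> t (\<lambda>j. u (t j)) m - caputo \<alpha> u ts)) y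
        = g.disc_op (\<lambda>j. \<phi> 0 (t j)) - integral {0..g.ts} (\<lambda>s. g.\<kappa> s * \<phi> 1 s)"
    proof -
      have "Gamma (1 - \<alpha>) *\<^sub>R (alikhanov_op \<alpha> t (\<lambda>j. u (t j)) m - caputo \<alpha> u ts)
          = (\<Sum>j=1..m. g.g j *\<^sub>R (u (t j) - u (t (j - 1)))) - integral {0..ts} (caputo_integrand \<alpha> u ts)"
        unfolding g.alikhanov_op_eq caputo_def using Gp by (simp add: scaleR_diff_right)
      then show ?thesis
        by (simp add: inner_diff_left inner_sum_left ci(2) g.disc_op_def \<phi>_def g.\<kappa>_def ts)
    qed
    have 4: "inner (Gamma (1 - \<alpha>) *\<^sub>R ((\<alpha> / 2) *\<^sub>R w x + (1 - \<alpha> / 2) *\<^sub>R w (t m) - w ts)) y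
        = Gamma (1 - \<alpha>) * (\<alpha> / 2 * \<psi> 0 x + (1 - \<alpha> / 2) * \<psi> 0 (t m) - \<psi> 0 g.ts)"
      by (simp add: \<psi>_def ts inner_diff_left inner_add_left)
    have "Gamma (1 - \<alpha>) * (\<alpha> / 2 * \<psi> 0 x + (1 - \<alpha> / 2) * \<psi> 0 (t m) - \<psi> 0 g.ts) \<le> Gamma (1 - \<alpha>) * B2"
      using 2 Gp by (intro mult_left_mono) auto
    then show "inner (Gamma (1 - \<alpha>) *\<^sub>R (alikhanov_op \<alpha> t (\<lambda>j. u (t j)) m - caputo \<alpha> u ts)
        + Gamma (1 - \<alpha>) *\<^sub>R ((\<alpha> / 2) *\<^sub>R w x + (1 - \<alpha> / 2) *\<^sub>R w (t m) - w ts)) y \<le> consistency_bound M m"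
      unfolding inner_add_left 3 4 cb using 1 by linarith
  next
    have "0 \<le> g.residual_const"
      using g.residual_const_parts alpha by (auto simp: g.residual_const_def intro!: add_nonneg_nonneg)
    then show "0 \<le> consistency_bound M m"
      unfolding cb B1_def B2_def using ic K_nonneg Gp by (intro add_nonneg_nonneg mult_nonneg_nonneg) auto
  qed
qed

lemma error_inequality:
  fixes M m :: nat
  defines "t \<equiv> mesh T r M"
  assumes scheme: "alikhanov_scheme \<Omega> a c \<alpha> t M f u0 U" and M: "1 \<le> M" "m \<in> {1..M}"
  shows "alikhanov_mesh.disc_op \<alpha> t m (\<lambda>j. norm (u (t j) - U j)) \<le> consistency_bound M m"
proof -
  define t1 where "t1 = T * real M powr (-r)"
  define ts where "ts = tstar \<alpha> t m"
  interpret g: alikhanov_graded \<alpha> r t1 t m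
    unfolding t1_def t_def using mesh_graded alpha r T M by simp
  have ts: "g.ts = ts" by (simp add: g.ts_def ts_def)
  have tm: "0 < t m" "t m \<le> T" "0 < ts" "ts < t m"
  proof -
    show "t m \<le> T" unfolding t_def using mesh_le[of T r m M] T r M by simp
    show "0 < t m" "0 < ts" "ts < t m"
      using g.t_pos[OF g.m1] g.ts_bounds g.t_le[of 0 "m - 1"] g.t0 by (auto simp: ts)
  qed
  have Gp: "0 < Gamma (1 - \<alpha>)" by (rule Gamma_pos)
  define E where "E j = u (t j) - U j" for j
  define Us where "Us = elliptic_op \<Omega> a c (ustar \<alpha> U m)"
  define \<rho> where "\<rho> x = Gamma (1 - \<alpha>) *\<^sub>R (alikhanov_op \<alpha> t (\<lambda>j. u (t j)) m - caputo \<alpha> u ts)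
      + Gamma (1 - \<alpha>) *\<^sub>R ((\<alpha> / 2) *\<^sub>R w x + (1 - \<alpha> / 2) *\<^sub>R w (t m) - w ts)" for x
  define W where "W x = Gamma (1 - \<alpha>) *\<^sub>R ((\<alpha> / 2) *\<^sub>R w x + (1 - \<alpha> / 2) *\<^sub>R w (t m) - Us)" for x
  have E0: "E 0 = 0"
    using scheme u_props(2) unfolding alikhanov_scheme_def by (simp add: E_def g.t0)
  have Urel: "elliptic_rel \<Omega> a c (ustar \<alpha> U m) Us"
    unfolding Us_def using scheme M unfolding alikhanov_scheme_def by (intro elliptic_op_rel) blast
  have urel: "elliptic_rel \<Omega> a c (u s) (w s)" if "s \<in> {0<..T}" for s
    using that by (intro elliptic_op_rel u_at)
  \<comment> \<open>\<open>w x\<close> enters \<open>W x\<close> and \<open>\<rho> x\<close> with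
    the same coefficient, so the identity holds for every \<open>x\<close>. This leaves
    \<open>x\<close> free: it will be \<open>t (m - 1)\<close> for \<open>m \<ge> 2\<close>, and a
    point tending to 0 for \<open>m = 1\<close>.\<close>
  have eq: "(\<Sum>j=1..m. g.g j *\<^sub>R (E j - E (j - 1))) + W x = \<rho> x" for x
  proof -
    have "f ts = caputo \<alpha> u ts + w ts" using u_at(4)[of ts] tm by simp
    moreover have "f ts = alikhanov_op \<alpha> t U m + Us"
      using scheme M unfolding Us_def ts_def alikhanov_scheme_def by metis
    ultimately have f: "caputo \<alpha> u ts + w ts = alikhanov_op \<alpha> t U m + Us" by simp
    have "(\<Sum>j=1..m. g.g j *\<^sub>R (E j - E (j - 1))) = (\<Sum>j=1..m. g.g j *\<^sub>R (u (t j) - u (t (j - 1))))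
        - (\<Sum>j=1..m. g.g j *\<^sub>R (U j - U (j - 1)))"
      unfolding E_def sum_subtractf[symmetric] by (intro sum.cong) (simp_all add: algebra_simps)
    also have "\<dots> = Gamma (1 - \<alpha>) *\<^sub>R (alikhanov_op \<alpha> t (\<lambda>j. u (t j)) m - alikhanov_op \<alpha> t U m)"
      unfolding g.alikhanov_op_eq using Gp by (simp add: scaleR_diff_right)
    also have "alikhanov_op \<alpha> t U m = caputo \<alpha> u ts + w ts - Us" using f by (simp add: algebra_simps)
    finally show ?thesis by (simp add: \<rho>_def W_def algebra_simps)
  qed
  have nonneg: "0 \<le> inner (W x) ((\<alpha> / 2) *\<^sub>R u x + (1 - \<alpha> / 2) *\<^sub>R u (t m) - ustar \<alpha> U m)"
    if "x \<in> {0<..T}" for x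
  proof -
    note lin = elliptic_rel_lincomb[OF \<Omega> a_cont c_cont]
    have "elliptic_rel \<Omega> a c (1 *\<^sub>R ((\<alpha> / 2) *\<^sub>R u x + (1 - \<alpha> / 2) *\<^sub>R u (t m)) + (-1) *\<^sub>R ustar \<alpha> U m)
        (1 *\<^sub>R ((\<alpha> / 2) *\<^sub>R w x + (1 - \<alpha> / 2) *\<^sub>R w (t m)) + (-1) *\<^sub>R Us)"
      using urel[OF that] urel[of "t m"] tm by (intro lin Urel) auto
    from elliptic_rel_nonneg[OF \<Omega> a_cont a_pos c_cont c_nonneg this]
    show ?thesis using Gp by (simp add: W_def)
  qed
  have bound: "norm (\<rho> x) \<le> consistency_bound M m" if "if m = 1 then x \<in> {0<..t 1} else x = t (m - 1)" for x
    using consistency[OF M, of x] that unfolding \<rho>_def ts_def t_def by simp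
  show ?thesis
  proof (cases "m = 1")
    case False
    then have m2: "2 \<le> m" "1 \<le> m - 1" using g.m1 by auto
    have tT: "t (m - 1) \<in> {0<..T}" using g.t_pos[OF m2(2)] g.t_le[of "m - 1" m] tm by auto
    have "(\<alpha> / 2) *\<^sub>R u (t (m - 1)) + (1 - \<alpha> / 2) *\<^sub>R u (t m) - ustar \<alpha> U m
        = (\<alpha> / 2) *\<^sub>R E (m - 1) + (1 - \<alpha> / 2) *\<^sub>R E m"
      by (simp add: ustar_def E_def algebra_simps)
    with nonneg[OF tT] have "g.disc_op (\<lambda>j. norm (E j)) \<le> norm (\<rho> (t (m - 1)))"
      by (intro g.norm_disc_op[OF m2(1) eq]) simp
    also have "\<dots> \<le> consistency_bound M m" using False by (intro bound) simp
    finally show ?thesis by (simp add: E_def)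
  next
    case True
    have t1: "t 1 = t1" "t m = t1" using g.t_1 True by auto
    \<comment> \<open>\<open>u (x n)\<close> tends to \<open>u0\<close> by continuity at 0, while no
      convergence of \<open>w (x n)\<close> is claimed; the residual bound, uniform in the point, is
      used instead.\<close>
    define x where "x n = t1 / real (Suc n)" for n
    have x: "x n \<in> {0<..t1}" "x n \<in> {0<..T}" for n
    proof -
      have "0 < x n" "x n \<le> t1" using g.t1 by (auto simp: x_def divide_le_eq mult_left_le)
      then show "x n \<in> {0<..t1}" "x n \<in> {0<..T}" using tm t1 by auto
    qed
    have S: "(\<Sum>j=1..m. g.g j *\<^sub>R (E j - E (j - 1))) = g.g m *\<^sub>R E m"
    proof -
      have "{1..m} = {m}" "m - 1 = 0" using True by auto
      then show ?thesis using E0 by simp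
    qed
    have "g.g m * norm (E m) \<le> consistency_bound M m"
    proof (rule energy_estimate_limit[where \<theta> = "\<alpha> / 2" and \<rho> = "\<lambda>n. \<rho> (x n)" and d = "\<lambda>n. u (x n) - u0"])
      show "0 \<le> g.g m" using g.g_pos[OF g.m1 order_refl] by simp
      have "x \<longlonglongrightarrow> 0"
        unfolding x_def using tendsto_mult_right_zero[OF LIMSEQ_inverse_real_of_nat, of t1]
        by (simp add: divide_inverse)
      then have "(\<lambda>n. u (x n)) \<longlonglongrightarrow> u0"
        using continuous_on_tendsto_compose[OF u_props(1), of x 0 sequentially] x T u_props(2)
        by (auto simp: less_imp_le)
      then show "(\<lambda>n. u (x n) - u0) \<longlonglongrightarrow> 0" by (simp add: LIM_zero)
      show "norm (\<rho> (x n)) \<le> consistency_bound M m" for n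
        using True x(1)[of n] t1 by (intro bound) simp
      show "0 \<le> inner (\<rho> (x n) - g.g m *\<^sub>R E m) ((\<alpha> / 2) *\<^sub>R (u (x n) - u0) + (1 - \<alpha> / 2) *\<^sub>R E m)" for n
      proof -
        have "\<rho> (x n) - g.g m *\<^sub>R E m = W (x n)" using eq[of "x n"] unfolding S by (simp add: algebra_simps)
        moreover have "ustar \<alpha> U m = (\<alpha> / 2) *\<^sub>R u0 + (1 - \<alpha> / 2) *\<^sub>R U m"
          using scheme True unfolding alikhanov_scheme_def by (simp add: ustar_def)
        then have "(\<alpha> / 2) *\<^sub>R u (x n) + (1 - \<alpha> / 2) *\<^sub>R u (t m) - ustar \<alpha> U m
            = (\<alpha> / 2) *\<^sub>R (u (x n) - u0) + (1 - \<alpha> / 2) *\<^sub>R E m"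
          by (simp add: E_def algebra_simps)
        ultimately show ?thesis using nonneg[OF x(2), of n] by simp
      qed
    qed (use alpha in auto)
    moreover have "g.disc_op (\<lambda>j. norm (E j)) = g.g m * norm (E m)"
    proof -
      have "{1..m} = {m}" "m - 1 = 0" using True by auto
      then show ?thesis using E0 unfolding g.disc_op_def by simp
    qed
    ultimately show ?thesis by (simp add: E_def)
  qed
qed

lemma error_bound:
  "\<exists>C>0. \<forall>M\<ge>1. \<forall>U.
    alikhanov_scheme \<Omega> a c \<alpha> (mesh T r M) M f u0 U \<longrightarrow>
    (\<forall>m\<in>{1..M}. norm (u (mesh T r M m) - U m) \<le> C * err_star2 \<alpha> T r M m)"
proof -
  define R1 where "R1 = alikhanov_graded.residual_const \<alpha> r * K1"
  define R2 where "R2 = Gamma (1 - \<alpha>) * alikhanov_graded.interp_const \<alpha> r * (K2 + K3)"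
  \<comment> \<open>The constants depend on \<alpha> and \<open>r\<close> only, so their signs can
    be read off on any sample mesh.\<close>
  interpret g1: alikhanov_graded \<alpha> r 1 "\<lambda>j. 1 * real j powr r" 1
    using alpha r by unfold_locales auto
  have R: "0 \<le> R1" "0 \<le> R2"
  proof -
    have "0 \<le> g1.residual_const"
      using g1.residual_const_parts alpha by (auto simp: g1.residual_const_def intro!: add_nonneg_nonneg)
    moreover have "0 \<le> g1.interp_const" using alpha r by (simp add: g1.interp_const_def)
    ultimately show "0 \<le> R1" "0 \<le> R2" using K_nonneg Gamma_pos by (auto simp: R1_def R2_def)
  qed
  obtain C1 where C1: "0 < C1"
    "\<And>M n. 1 \<le> M \<Longrightarrow> n \<in> {1..M} \<Longrightarrow> \<exists>B. B 0 = 0 \<and>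
      (\<forall>m\<in>{1..n}. (T * real M powr (-r) / mesh T r M m) powr (min (\<alpha> + 1) ((3 - \<alpha>) / r))
        \<le> alikhanov_mesh.disc_op \<alpha> (mesh T r M) m B) \<and> B n \<le> C1 * err_star \<alpha> T r M n"
    using err_star_barrier[OF alpha r T] by blast
  obtain C2 where C2: "0 < C2"
    "\<And>M n. 1 \<le> M \<Longrightarrow> n \<in> {1..M} \<Longrightarrow> \<exists>B. B 0 = 0 \<and>
      (\<forall>m\<in>{1..n}. (T * real M powr (-r)) powr (2 / r) * mesh T r M m powr (\<alpha> - 2 / r)
        \<le> alikhanov_mesh.disc_op \<alpha> (mesh T r M) m B) \<and> B n \<le> C2 * err_star2 \<alpha> T r M n"
    using err_star2_barrier[OF alpha r T] by blast
  show ?thesis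
  \<comment> \<open>The summand 1 keeps the constant positive even if \<open>R1\<close> and
    \<open>R2\<close> vanish.\<close>
  proof (intro exI[of _ "R1 * C1 + R2 * C2 + 1"] conjI allI impI ballI)
    show "0 < R1 * C1 + R2 * C2 + 1" using R C1(1) C2(1) by (intro add_nonneg_pos add_nonneg_nonneg) auto
    fix M n :: nat and U assume M: "1 \<le> M" "n \<in> {1..M}"
      and scheme: "alikhanov_scheme \<Omega> a c \<alpha> (mesh T r M) M f u0 U"
    define t where "t = mesh T r M"
    obtain B1 where B1: "B1 0 = 0" "\<forall>m\<in>{1..n}. (T * real M powr (-r) / t m) powr (min (\<alpha> + 1) ((3 - \<alpha>) / r))
        \<le> alikhanov_mesh.disc_op \<alpha> t m B1" "B1 n \<le> C1 * err_star \<alpha> T r M n"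
      using C1(2)[OF M] unfolding t_def by blast
    obtain B2 where B2: "B2 0 = 0" "\<forall>m\<in>{1..n}. (T * real M powr (-r)) powr (2 / r) * t m powr (\<alpha> - 2 / r)
        \<le> alikhanov_mesh.disc_op \<alpha> t m B2" "B2 n \<le> C2 * err_star2 \<alpha> T r M n"
      using C2(2)[OF M] unfolding t_def by blast
    have grd: "alikhanov_graded \<alpha> r (T * real M powr (-r)) t m" if "m \<in> {1..n}" for m
      unfolding t_def using mesh_graded alpha r T M that by simp
    \<comment> \<open>\<open>B1\<close> and \<open>B2\<close> were built for this \<open>n\<close>:
      the comparison runs through all levels up to \<open>n\<close>, but its result is read off at
      \<open>n\<close> alone.\<close>
    define B where "B j = R1 * B1 j + R2 * B2 j" for j
    have "norm (u (t n) - U n) \<le> B n"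
    proof (rule discrete_comparison[where e = "\<lambda>j. norm (u (t j) - U j)" and B = B])
      show "alikhanov_mesh \<alpha> t m" if "m \<in> {1..n}" for m
      proof -
        interpret g: alikhanov_graded \<alpha> r "T * real M powr (-r)" t m by (rule grd[OF that])
        show ?thesis by (rule g.alikhanov_mesh_axioms)
      qed
      show "alikhanov_mesh.disc_op \<alpha> t m (\<lambda>j. norm (u (t j) - U j)) \<le> alikhanov_mesh.disc_op \<alpha> t m B"
        if mn: "m \<in> {1..n}" for m
      proof -
        interpret g: alikhanov_graded \<alpha> r "T * real M powr (-r)" t m by (rule grd[OF mn])
        have "g.disc_op (\<lambda>j. norm (u (t j) - U j)) \<le> consistency_bound M m"
          unfolding t_def using mn M by (intro error_inequality[OF scheme M(1)]) auto
        also have "\<dots> = R1 * (T * real M powr (-r) / t m) powr (min (\<alpha> + 1) ((3 - \<alpha>) / r))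
            + R2 * ((T * real M powr (-r)) powr (2 / r) * t m powr (\<alpha> - 2 / r))"
          by (simp only: consistency_bound_def R1_def R2_def t_def)
        also have "\<dots> \<le> R1 * g.disc_op B1 + R2 * g.disc_op B2"
          using B1(2) B2(2) mn R by (intro add_mono mult_left_mono) auto
        also have "\<dots> = g.disc_op B"
          unfolding B_def g.disc_op_def sum_distrib_left sum.distrib[symmetric]
          by (intro sum.cong) (simp_all add: algebra_simps)
        finally show ?thesis .
      qed
      have "u (t 0) = U 0"
        using u_props(2) scheme r unfolding alikhanov_scheme_def by (simp add: t_def mesh_def)
      then show "norm (u (t 0) - U 0) \<le> B 0" using B1(1) B2(1) by (simp add: B_def)
    qed simp
    also have "\<dots> \<le> R1 * (C1 * err_star \<alpha> T r M n) + R2 * (C2 * err_star2 \<alpha> T r M n)"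
      unfolding B_def using B1(3) B2(3) R by (intro add_mono mult_left_mono) auto
    also have "\<dots> \<le> R1 * (C1 * err_star2 \<alpha> T r M n) + R2 * (C2 * err_star2 \<alpha> T r M n)"
      using R C1(1) by (intro add_right_mono mult_left_mono) (auto simp: err_star2_def)
    also have "\<dots> \<le> (R1 * C1 + R2 * C2 + 1) * err_star2 \<alpha> T r M n"
    proof -
      have "0 \<le> err_star2 \<alpha> T r M n"
        using err_star_nonneg[OF alpha r T, of M n] M by (simp add: err_star2_def)
      then show ?thesis by (simp add: algebra_simps)
    qed
    finally show "norm (u (mesh T r M n) - U n) \<le> (R1 * C1 + R2 * C2 + 1) * err_star2 \<alpha> T r M n"
      by (simp add: t_def)
  qed
qed

end

theorem theorem4p10:
  fixes \<Omega> :: "'a::euclidean_space set"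
    and a :: "'a \<Rightarrow> 'a \<Rightarrow> real" and c :: "'a \<Rightarrow> real"
    and \<alpha> T r K :: real
    and f u :: "real \<Rightarrow> 'a l2" and u0 :: "'a l2"
  assumes dim: "DIM('a) \<in> {1, 2, 3}"
    and dom: "bounded_lipschitz_domain \<Omega>"
    and a_cont: "\<And>b. b \<in> Basis \<Longrightarrow> continuous_on (closure \<Omega>) (a b)"
    and a_pos: "\<And>b x. b \<in> Basis \<Longrightarrow> x \<in> closure \<Omega> \<Longrightarrow> a b x > 0"
    and c_cont: "continuous_on (closure \<Omega>) c"
    and c_nonneg: "\<And>x. x \<in> closure \<Omega> \<Longrightarrow> c x \<ge> 0"
    and alpha: "0 < \<alpha>" "\<alpha> < 1" and T: "T > 0" and r: "r \<ge> 1"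
    and f_L2: "\<And>t. t \<in> {0<..T} \<Longrightarrow> f t \<in> L2_on \<Omega>" and u0_L2: "u0 \<in> L2_on \<Omega>"
    and sol: "ibvp_solution \<Omega> a c \<alpha> T f u0 u"
    and uniq: "\<And>v. ibvp_solution \<Omega> a c \<alpha> T f u0 v \<Longrightarrow> (\<forall>t\<in>{0..T}. v t = u t)"
    and u_diff: "time_diff 3 T u"
    and Lu_diff: "time_diff 2 T (\<lambda>t. elliptic_op \<Omega> a c (u t))"
    and u_bound: "\<And>l t. l \<in> {1, 3} \<Longrightarrow> t \<in> {0<..T} \<Longrightarrow>
      norm ((time_deriv T ^^ l) u t) \<le> K * (1 + t powr (\<alpha> - real l))"
    and Lu_bound: "\<And>t. t \<in> {0<..T} \<Longrightarrow>
      norm ((time_deriv T ^^ 2) (\<lambda>t. elliptic_op \<Omega> a c (u t)) t) \<le> K * (1 + t powr (\<alpha> - 2))"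
  shows "\<exists>C>0. \<forall>M\<ge>1. \<forall>U.
    alikhanov_scheme \<Omega> a c \<alpha> (mesh T r M) M f u0 U \<longrightarrow>
    (\<forall>m\<in>{1..M}. norm (u (mesh T r M m) - U m) \<le> C * err_star2 \<alpha> T r M m)"
proof -
  have o: "open \<Omega>" and b: "bounded \<Omega>"
    using dom by (simp_all add: bounded_lipschitz_domain_def)
  interpret alikhanov_problem \<Omega> a c \<alpha> T r K f u u0
    by (rule alikhanov_problem.intro) (fact o b a_cont a_pos c_cont c_nonneg alpha T r sol u_diff Lu_diff u_bound Lu_bound)+
  show ?thesis by (rule error_bound)
qed

end
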